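(* Let $p\ge 0$ be a fixed integer constant. The problem \textsc{Parameterized Equal Clustering} (with the $\ell_p$-norm), parameterized by the budget $B$, admits a $2$-approximate kernel in which the output instance $(\mathbf{X}',k',B')$ consists of a collection $\mathbf{X}'$ of $\mathcal{O}(B^2)$ points of $\mathbb{Z}^{d'}$ with $d'=\mathcal{O}(B^{p+2})$, each coordinate of each point having absolute value $\mathcal{O}(B^3)$.
   Context: For a nonnegative integer $p$ and $\mathbf{x}\in\mathbb{R}^d$, $\|\mathbf{x}\|_p=(\sum_{i=1}^d|x[i]|^p)^{1/p}$ for $p\ge1$, and $\|\mathbf{x}\|_0$ is the number of nonzero coordinates of $\mathbf{x}$ (Hamming norm). Collections of points are multisets (identical points are treated as distinct elements). For a finite collection $T\subseteq\mathbb{Z}^d$, ${\sf cost}_p(T)=\min_{\mathbf{c}\in\mathbb{R}^d}\sum_{\mathbf{x}\in T}\|\mathbf{c}-\mathbf{x}\|_p$. Given a collection $\mathbf{X}$ of $n$ points of $\mathbb{Z}^d$ and a positive integer $k$ dividing $n$, an equal $k$-clustering is a partition $\{X_1,\dots,X_k\}$ of $\mathbf{X}$ with $|X_i|=n/k$ for all $i$; its cost is ${\sf cost}_p(X_1,\dots,X_k)=\sum_i{\sf cost}_p(X_i)$. In \textsc{Parameterized Equal Clustering}, an instance is $(\mathbf{X},k,B)$ with $B$ a nonnegative integer (the parameter); a solution is an equal $k$-clustering, and its value is ${\sf cost}^B_p(X_1,\dots,X_k)={\sf cost}_p(X_1,\dots,X_k)$ if this is at most $B$, and $B+1$ otherwise;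 ${\sf Opt}(\mathbf{X},k,B)$ is the minimum value over all equal $k$-clusterings. An $\alpha$-approximate kernel (of size $g$) for such a parameterized minimization problem is a pair of polynomial-time algorithms: a reduction algorithm that, given an instance $(I,B)$, outputs an instance $(I',B')$ of the same problem with $|I'|+B'\le g(B)$; and a solution-lifting algorithm that, given $(I,B)$, $(I',B')$ and any solution $s'$ of $(I',B')$, outputs a solution $s$ of $(I,B)$ such that $\frac{\mathrm{val}(I,B,s)}{{\sf Opt}(I,B)}\le\alpha\cdot\frac{\mathrm{val}(I',B',s')}{{\sf Opt}(I',B')}$, where a ratio is taken to be $1$ when its denominator ${\sf Opt}$ is $0$. *)

theory Defs
  imports
    Complex_Main
    "HOL-Library.Multiset"
    "HOL-Library.Landau_Symbols"
    "HOL-Computational_Algebra.Polynomial"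
begin

subsection \<open>Polynomial-time computability\<close>

text \<open>
  The model of computation is the language of WHILE programs over binary trees (as in
  N. D. Jones, Computability and Complexity from a Programming Perspective), in variable-free
  form: a program transforms one tree.  Every primitive is charged the full size of its
  argument, so a run of cost t only ever handles trees of size at most t (lemma
  \<open>exec_size\<close> below); in particular copying is not free and no exponentially large output
  can be produced cheaply.  The model and multi-tape Turing machines simulate each other with
  polynomial overhead.
\<close>

datatype data = Atom | Pair data data

fun dsize :: "data \<Rightarrow> nat" where
  "dsize Atom = 1"
| "dsize (Pair a b) = dsize a + dsize b + 1"

fun left :: "data \<Rightarrow> data" where
  "left Atom = Atom"
| "left (Pair a b) = a"

fun right :: "data \<Rightarrow> data" where
  "right Atom = Atom"
| "right (Pair a b) = b"

datatype prog =
    Ident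
  | Const_Atom
  | Left
  | Right
  | Fork prog prog
  | Seq prog prog
  | Cond prog prog prog
  | While prog prog

text \<open>\<open>exec P v w t\<close>: started on \<open>v\<close>, program \<open>P\<close> halts with result \<open>w\<close> at cost \<open>t\<close>.
  As a truth value, \<open>Atom\<close> is false and everything else is true.\<close>

inductive exec :: "prog \<Rightarrow> data \<Rightarrow> data \<Rightarrow> nat \<Rightarrow> bool" where
  Ident: "exec Ident v v (dsize v)"
| Const_Atom: "exec Const_Atom v Atom (dsize v)"
| Left: "exec Left v (left v) (dsize v)"
| Right: "exec Right v (right v) (dsize v)"
| Fork: "exec P v a t \<Longrightarrow> exec Q v b u \<Longrightarrow> exec (Fork P Q) v (Pair a b) (t + u + 1)"
| Seq: "exec P v w t \<Longrightarrow> exec Q w x u \<Longrightarrow> exec (Seq P Q) v x (t + u + 1)"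
| Cond_True: "exec C v c t \<Longrightarrow> c \<noteq> Atom \<Longrightarrow> exec P v w u \<Longrightarrow> exec (Cond C P Q) v w (t + u + 1)"
| Cond_False: "exec C v Atom t \<Longrightarrow> exec Q v w u \<Longrightarrow> exec (Cond C P Q) v w (t + u + 1)"
| While_True: "exec C v c t \<Longrightarrow> c \<noteq> Atom \<Longrightarrow> exec P v w u \<Longrightarrow> exec (While C P) w x r
    \<Longrightarrow> exec (While C P) v x (t + u + r + 1)"
| While_False: "exec C v Atom t \<Longrightarrow> exec (While C P) v v (t + dsize v + 1)"

lemma exec_size: "exec P v w t \<Longrightarrow> dsize v \<le> t \<and> dsize w \<le> t"
proof (induction rule: exec.induct)
  case (Const_Atom v)
  then show ?case by (cases v) auto
next
  case (Left v)
  then show ?case by (cases v) auto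
next
  case (Right v)
  then show ?case by (cases v) auto
qed auto

inductive_cases exec_IdentE: "exec Ident v w t"
inductive_cases exec_Const_AtomE: "exec Const_Atom v w t"
inductive_cases exec_LeftE: "exec Left v w t"
inductive_cases exec_RightE: "exec Right v w t"
inductive_cases exec_ForkE: "exec (Fork P Q) v w t"
inductive_cases exec_SeqE: "exec (Seq P Q) v w t"
inductive_cases exec_CondE: "exec (Cond C P Q) v w t"
inductive_cases exec_WhileE: "exec (While C P) v w t"

lemma exec_deterministic: "exec P v w t \<Longrightarrow> exec P v w' t' \<Longrightarrow> w = w' \<and> t = t'"
proof (induction arbitrary: w' t' rule: exec.induct)
  case Ident then show ?case by (auto elim: exec_IdentE)
next
  case Const_Atom then show ?case by (auto elim: exec_Const_AtomE)
next
  case Left then show ?case by (auto elim: exec_LeftE)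
next
  case Right then show ?case by (auto elim: exec_RightE)
next
  case Fork from Fork.prems show ?case by (rule exec_ForkE) (auto dest: Fork.IH)
next
  case Seq from Seq.prems show ?case by (rule exec_SeqE) (auto dest!: Seq.IH)
next
  case Cond_True from Cond_True.prems show ?case
    by (rule exec_CondE) (use Cond_True.hyps in \<open>auto dest!: Cond_True.IH\<close>)
next
  case Cond_False from Cond_False.prems show ?case
    by (rule exec_CondE) (auto dest!: Cond_False.IH)
next
  case While_True from While_True.prems show ?case
    by (rule exec_WhileE) (use While_True.hyps in \<open>auto dest!: While_True.IH\<close>)
next
  case While_False from While_False.prems show ?case
    by (rule exec_WhileE) (auto dest!: While_False.IH)
qed

definition polytime_on :: "'a set \<Rightarrow> ('a \<Rightarrow> data) \<Rightarrow> ('b \<Rightarrow> data) \<Rightarrow> ('a \<Rightarrow> 'b) \<Rightarrow> bool" where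
  "polytime_on D enc_in enc_out f \<longleftrightarrow>
    (\<exists>P :: prog. \<exists>q :: nat poly. \<forall>x\<in>D. \<exists>t \<le> poly q (dsize (enc_in x)).
        exec P (enc_in x) (enc_out (f x)) t)"

text \<open>Numbers are encoded in binary, least significant bit first.\<close>

fun enc_bool :: "bool \<Rightarrow> data" where
  "enc_bool False = Atom"
| "enc_bool True = Pair Atom Atom"

fun enc_list :: "('a \<Rightarrow> data) \<Rightarrow> 'a list \<Rightarrow> data" where
  "enc_list e [] = Atom"
| "enc_list e (x # xs) = Pair (e x) (enc_list e xs)"

fun enc_prod :: "('a \<Rightarrow> data) \<Rightarrow> ('b \<Rightarrow> data) \<Rightarrow> 'a \<times> 'b \<Rightarrow> data" where
  "enc_prod e f (x, y) = Pair (e x) (f y)"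

fun enc_nat :: "nat \<Rightarrow> data" where
  "enc_nat n = (if n = 0 then Atom else Pair (enc_bool (odd n)) (enc_nat (n div 2)))"

declare enc_nat.simps [simp del]

definition enc_int :: "int \<Rightarrow> data" where
  "enc_int i = Pair (enc_bool (i < 0)) (enc_nat (nat \<bar>i\<bar>))"


subsection \<open>Approximate kernels for parameterized minimization problems\<close>

record ('i, 's) param_min_problem =
  insts :: "'i set"
  sols :: "'i \<Rightarrow> nat \<Rightarrow> 's set"
  val :: "'i \<Rightarrow> nat \<Rightarrow> 's \<Rightarrow> real"
  enc_inst :: "'i \<Rightarrow> data"
  enc_sol :: "'s \<Rightarrow> data"

text \<open>A parameterized instance is a pair of an element of \<open>insts\<close> and an arbitrary natural
  number.  \<open>Opt\<close> is meant for problems with finite nonempty solution sets.\<close>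

definition Opt :: "('i, 's) param_min_problem \<Rightarrow> 'i \<Rightarrow> nat \<Rightarrow> real" where
  "Opt \<Pi> I B = Min (val \<Pi> I B ` sols \<Pi> I B)"

definition ratio :: "real \<Rightarrow> real \<Rightarrow> real" where
  "ratio a b = (if b = 0 then 1 else a / b)"

abbreviation enc_param_inst :: "('i, 's) param_min_problem \<Rightarrow> 'i \<times> nat \<Rightarrow> data" where
  "enc_param_inst \<Pi> \<equiv> enc_prod (enc_inst \<Pi>) enc_nat"

definition approx_kernel ::
  "('i, 's) param_min_problem \<Rightarrow> real \<Rightarrow> (nat \<Rightarrow> nat)
    \<Rightarrow> ('i \<times> nat \<Rightarrow> 'i \<times> nat) \<Rightarrow> (('i \<times> nat) \<times> ('i \<times> nat) \<times> 's \<Rightarrow> 's) \<Rightarrow> bool" where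
  "approx_kernel \<Pi> \<alpha> g reduce lift \<longleftrightarrow>
    polytime_on (insts \<Pi> \<times> UNIV) (enc_param_inst \<Pi>) (enc_param_inst \<Pi>) reduce \<and>
    polytime_on
      {(x, x', s'). fst x \<in> insts \<Pi> \<and> x' = reduce x \<and> s' \<in> sols \<Pi> (fst x') (snd x')}
      (enc_prod (enc_param_inst \<Pi>) (enc_prod (enc_param_inst \<Pi>) (enc_sol \<Pi>)))
      (enc_sol \<Pi>) lift \<and>
    (\<forall>I\<in>insts \<Pi>. \<forall>B I' B'. reduce (I, B) = (I', B') \<longrightarrow>
      I' \<in> insts \<Pi> \<and>
      dsize (enc_inst \<Pi> I') + B' \<le> g B \<and>
      (\<forall>s'\<in>sols \<Pi> I' B'.
        lift ((I, B), (I', B'), s') \<in> sols \<Pi> I B \<and>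
        ratio (val \<Pi> I B (lift ((I, B), (I', B'), s'))) (Opt \<Pi> I B)
          \<le> \<alpha> * ratio (val \<Pi> I' B' s') (Opt \<Pi> I' B')))"


subsection \<open>Parameterized Equal Clustering\<close>

definition lp_norm :: "nat \<Rightarrow> real list \<Rightarrow> real" where
  "lp_norm p z =
    (if p = 0 then real (card {i. i < length z \<and> z ! i \<noteq> 0})
     else root p (\<Sum>i<length z. \<bar>z ! i\<bar> ^ p))"

text \<open>The infimum defining the cost is attained: for positive \<open>p\<close> the objective is continuous
  and coercive (or identically 0, if the collection is empty), and for \<open>p = 0\<close> it takes
  only finitely many values.\<close>

definition cluster_cost :: "nat \<Rightarrow> nat \<Rightarrow> int list multiset \<Rightarrow> real" where
  "cluster_cost p d T =
    (INF c \<in> {c :: real list. length c = d}.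
      \<Sum>x\<in>#T. lp_norm p (map2 (-) c (map real_of_int x)))"

text \<open>An instance is a triple \<open>(d, X, k)\<close>, where the list \<open>X\<close> holds the points of the
  collection with repetitions.\<close>

type_synonym clust_inst = "nat \<times> int list list \<times> nat"

definition clust_insts :: "clust_inst set" where
  "clust_insts =
    {(d, X, k). d > 0 \<and> X \<noteq> [] \<and> (\<forall>x\<in>set X. length x = d) \<and> k > 0 \<and> k dvd length X}"

text \<open>A clustering is a list of \<open>k\<close> clusters, each of them given by a list of positions in \<open>X\<close>,
  so that equal points at different positions are different elements.\<close>

fun equal_clusterings :: "clust_inst \<Rightarrow> nat list list set" where
  "equal_clusterings (d, X, k) =
    {Cs. length Cs = k \<and> distinct (concat Cs) \<and> set (concat Cs) = {..<length X} \<and>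
         (\<forall>C\<in>set Cs. length C = length X div k)}"

fun clustering_cost :: "nat \<Rightarrow> clust_inst \<Rightarrow> nat list list \<Rightarrow> real" where
  "clustering_cost p (d, X, k) Cs =
    (\<Sum>C\<leftarrow>Cs. cluster_cost p d (mset (map ((!) X) C)))"

definition clustering_value :: "nat \<Rightarrow> clust_inst \<Rightarrow> nat \<Rightarrow> nat list list \<Rightarrow> real" where
  "clustering_value p I B Cs =
    (if clustering_cost p I Cs \<le> real B then clustering_cost p I Cs else real B + 1)"

definition equal_clustering_problem ::
  "nat \<Rightarrow> (clust_inst, nat list list) param_min_problem" where
  "equal_clustering_problem p =
    \<lparr>insts = clust_insts,
     sols = (\<lambda>I B. equal_clusterings I),
     val = clustering_value p,
     enc_inst = enc_prod enc_nat (enc_prod (enc_list (enc_list enc_int)) enc_nat),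
     enc_sol = enc_list (enc_list enc_nat)\<rparr>"

lemma finite_equal_clusterings: "finite (equal_clusterings I)"
proof (cases I)
  case (fields d X k)
  let ?L = "{C. set C \<subseteq> {..<length X} \<and> length C = length X div k}"
  have "finite {Cs. set Cs \<subseteq> ?L \<and> length Cs = k}"
    by (intro finite_lists_length_eq) simp
  then show ?thesis
    unfolding fields by (rule rev_finite_subset) auto
qed

lemma equal_clusterings_nonempty:
  assumes "I \<in> clust_insts"
  shows "equal_clusterings I \<noteq> {}"
proof (cases I)
  case (fields d X k)
  then obtain m where m: "length X = k * m" and k: "k > 0"
    using assms by (auto simp: clust_insts_def)
  have "concat (map (\<lambda>j. [j * m..<Suc j * m]) [0..<i]) = [0..<i * m]" for i
  proof (induction i)
    case (Suc i)
    then show ?case using upt_add_eq_append[of 0 "i * m" m] by (simp add: add.commute)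
  qed simp
  from this[of k] have "map (\<lambda>j. [j * m..<Suc j * m]) [0..<k] \<in> equal_clusterings I"
    unfolding fields by (auto simp: m k simp del: set_concat)
  then show ?thesis by blast
qed

end

theory Submission imports Defs "HOL-Analysis.Convex"
begin

text \<open>
  As long as one point occurs at least \<open>s = n / k\<close> times, a cluster of \<open>s\<close> copies of it is split
  off.  This at most doubles the optimum: the clusters split off and those of an optimal
  clustering are the two sides of a regular bipartite multigraph, whose lightest perfect matching
  tells which optimal cluster is given up for which uniform one, and the points displaced from it
  travel through its uniform point.  A cluster of cost at most \<open>B\<close> and more than \<open>2 B\<close> points has a
  majority point, which is an optimal center, so removing \<open>s - (2 B + 1)\<close> copies of each
  remaining point with more than \<open>B\<close> copies changes no relevant cost.  If \<open>2 Opt < B + 1\<close>, then at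
  most \<open>2 B\<close> different points remain; otherwise every solution is good enough and the output is
  trivial.

  A distance that matters involves at most \<open>B ^ max p 1\<close> coordinates.  Coordinates are selected
  greedily, each separating some pair of points that was separated only this many times before; a
  dimension argument bounds their number.  Finally, in each coordinate the axis is cut into blocks
  whose length is the power of two in \<open>{B + 1..2 B + 1}\<close> given by the binary digits of \<open>B\<close>, and
  blocks far from all values are deleted; differences up to \<open>B\<close> are kept and larger ones stay
  larger than \<open>B\<close>.
\<close>

text \<open>The ratio 2 must survive the cap of the value at \<open>B + 1\<close>. If the optimum
  \<open>v\<close> has \<open>2 v\<close> strictly between \<open>B\<close> and
  \<open>B + 1\<close>, a kernel whose best clustering costs \<open>2 v\<close> has optimal value
  \<open>B + 1\<close>, more than \<open>2 v\<close>. So the bound to reach is the minimum of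
  \<open>2 v\<close> and \<open>B\<close>. The exchange of clusters yields the slightly better
  factor \<open>2 - 2 / s\<close>, because a matched pair of clusters shares a point, which is not
  displaced; this is enough for \<open>s \<le> B + 1\<close>. For larger \<open>s\<close> every
  optimal cluster has a majority point as center, the distances involved are 0 or at least 1, and
  some matching only joins clusters at distance 0, so that nothing is lost.

  Programs are treated as total functions on all inputs, which lets polynomial time compose without
  side conditions. \<open>B\<close> is given in binary and may be exponential in the input size, so
  whatever is counted has to be bounded through the length of a list at hand. Cluster sizes and
  thresholds are handled by such counting, and block lengths are powers of two because division is
  then the splitting of a digit list.\<close>

definition runs :: "prog \<Rightarrow> data \<Rightarrow> data \<Rightarrow> nat \<Rightarrow> bool" where
  "runs P v w T \<longleftrightarrow> (\<exists>t\<le>T. exec P v w t)"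

lemma runs_mono: "runs P v w T \<Longrightarrow> T \<le> T' \<Longrightarrow> runs P v w T'"
  unfolding runs_def by (meson order_trans)

lemma runs_size: "runs P v w T \<Longrightarrow> dsize w \<le> T"
  unfolding runs_def by (meson exec_size order_trans)

lemma runs_Ident: "runs Ident v v (dsize v)"
  and runs_Const_Atom: "runs Const_Atom v Atom (dsize v)"
  and runs_Left: "runs Left v (left v) (dsize v)"
  and runs_Right: "runs Right v (right v) (dsize v)"
  unfolding runs_def by (blast intro: exec.intros)+

lemma runs_Left_Pair: "runs Left (Pair x y) x (dsize (Pair x y))"
  and runs_Right_Pair: "runs Right (Pair x y) y (dsize (Pair x y))"
  using runs_Left[of "Pair x y"] runs_Right[of "Pair x y"] by simp_all

lemma runs_Fork: "runs P v a T \<Longrightarrow> runs Q v b U \<Longrightarrow> runs (Fork P Q) v (Pair a b) (T + U + 1)"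
  unfolding runs_def by (meson add_le_mono exec.Fork le_refl)

lemma runs_Seq: "runs P v w T \<Longrightarrow> runs Q w x U \<Longrightarrow> runs (Seq P Q) v x (T + U + 1)"
  unfolding runs_def by (meson add_le_mono exec.Seq le_refl)

lemma runs_Cond_True:
  "runs C v c T \<Longrightarrow> c \<noteq> Atom \<Longrightarrow> runs P v w U \<Longrightarrow> runs (Cond C P Q) v w (T + U + 1)"
  unfolding runs_def by (meson add_le_mono exec.Cond_True le_refl)

lemma runs_Cond_False:
  "runs C v Atom T \<Longrightarrow> runs Q v w U \<Longrightarrow> runs (Cond C P Q) v w (T + U + 1)"
  unfolding runs_def by (meson add_le_mono exec.Cond_False le_refl)

lemma runs_While_True:
  "runs C v c T \<Longrightarrow> c \<noteq> Atom \<Longrightarrow> runs P v w U \<Longrightarrow> runs (While C P) w x R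
    \<Longrightarrow> runs (While C P) v x (T + U + R + 1)"
  unfolding runs_def by (meson add_le_mono exec.While_True le_refl)

lemma runs_While_False: "runs C v Atom T \<Longrightarrow> runs (While C P) v v (T + dsize v + 1)"
  unfolding runs_def by (meson add_le_mono exec.While_False le_refl)

lemma poly_nat_mono: "x \<le> y \<Longrightarrow> poly (q :: nat poly) x \<le> poly q y"
  by (induction q) (auto intro!: add_mono mult_mono)

text \<open>With closure under the arithmetic operations, running times can be written as ordinary
  functions of the size, without explicit polynomials.\<close>

definition polybounded :: "(nat \<Rightarrow> nat) \<Rightarrow> bool" where
  "polybounded b \<longleftrightarrow> (\<exists>q :: nat poly. \<forall>n. b n \<le> poly q n)"

lemma polybounded_const: "polybounded (\<lambda>_. c)"
  unfolding polybounded_def by (rule exI[of _ "[:c:]"]) simp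

lemma polybounded_ident: "polybounded (\<lambda>n. n)"
  unfolding polybounded_def by (rule exI[of _ "[:0, 1:]"]) simp

lemma polybounded_add: "polybounded b \<Longrightarrow> polybounded b' \<Longrightarrow> polybounded (\<lambda>n. b n + b' n)"
  unfolding polybounded_def by (metis add_le_mono poly_add)

lemma polybounded_mult: "polybounded b \<Longrightarrow> polybounded b' \<Longrightarrow> polybounded (\<lambda>n. b n * b' n)"
  unfolding polybounded_def by (metis mult_le_mono poly_mult)

lemma polybounded_poly:
  assumes "polybounded b"
  shows "polybounded (\<lambda>n. poly q (b n))"
proof -
  obtain r where "\<And>n. b n \<le> poly r n"
    using assms unfolding polybounded_def by blast
  then have "poly q (b n) \<le> poly (pcompose q r) n" for n
    by (simp add: poly_pcompose poly_nat_mono)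
  then show ?thesis unfolding polybounded_def by blast
qed

lemmas polybounded_intros =
  polybounded_const polybounded_ident polybounded_add polybounded_mult polybounded_poly

abbreviation polytime :: "('a \<Rightarrow> data) \<Rightarrow> ('b \<Rightarrow> data) \<Rightarrow> ('a \<Rightarrow> 'b) \<Rightarrow> bool" where
  "polytime \<equiv> polytime_on UNIV"

lemma polytime_runs:
  "polytime a b f \<longleftrightarrow> (\<exists>P (q :: nat poly). \<forall>x. runs P (a x) (b (f x)) (poly q (dsize (a x))))"
  unfolding polytime_on_def runs_def by simp

lemma polytimeI:
  assumes "polybounded c" "\<And>x. runs P (a x) (b (f x)) (c (dsize (a x)))"
  shows "polytime a b f"
  using assms unfolding polytime_runs polybounded_def by (meson runs_mono)

text \<open>The bound is stated for every \<open>n\<close> above the input size, so that it applies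
  with a mere estimate of the size of an intermediate result.\<close>

lemma polytimeE:
  assumes "polytime a b f"
  obtains P q where "\<And>x n. dsize (a x) \<le> n \<Longrightarrow> runs P (a x) (b (f x)) (poly q n)"
  using assms unfolding polytime_runs by (meson runs_mono poly_nat_mono)

lemma polytime_on_subset: "polytime_on D a b f \<Longrightarrow> D' \<subseteq> D \<Longrightarrow> polytime_on D' a b f"
  unfolding polytime_on_def by blast

lemma polytime_size:
  assumes "polytime a b f"
  obtains q where "\<And>x n. dsize (a x) \<le> n \<Longrightarrow> dsize (b (f x)) \<le> poly q n"
  using polytimeE[OF assms] by (metis runs_size)

lemma enc_prod_eq: "enc_prod a b z = Pair (a (fst z)) (b (snd z))"
  by (cases z) simp

section \<open>Closure properties of polynomial time\<close>

named_theorems polytime_intros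

lemma polytime_ident [polytime_intros]: "polytime a a (\<lambda>x. x)"
  by (rule polytimeI[OF polybounded_ident]) (rule runs_Ident)

lemma polytime_comp:
  assumes "polytime b c g" "polytime a b f"
  shows "polytime a c (\<lambda>x. g (f x))"
proof -
  obtain P q where P: "\<And>x n. dsize (b x) \<le> n \<Longrightarrow> runs P (b x) (c (g x)) (poly q n)"
    using polytimeE[OF assms(1)] by blast
  obtain Q r where Q: "\<And>x n. dsize (a x) \<le> n \<Longrightarrow> runs Q (a x) (b (f x)) (poly r n)"
    using polytimeE[OF assms(2)] by blast
  show ?thesis
  proof (rule polytimeI)
    show "polybounded (\<lambda>n. poly r n + poly q (poly r n) + 1)"
      by (intro polybounded_intros)
  next
    fix x
    have "dsize (b (f x)) \<le> poly r (dsize (a x))"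
      using Q[OF order_refl] by (rule runs_size)
    then show "runs (Seq Q P) (a x) (c (g (f x)))
        (poly r (dsize (a x)) + poly q (poly r (dsize (a x))) + 1)"
      by (intro runs_Seq[OF Q[OF order_refl]] P)
  qed
qed

lemma polytime_data:
  assumes "\<And>x. runs P (a x) (b (f x)) (K * dsize (a x) + K)"
  shows "polytime a b f"
proof (rule polytimeI)
  show "polybounded (\<lambda>n. K * n + K)" by (intro polybounded_intros)
qed (rule assms)

lemma polytime_const [polytime_intros]: "polytime a b (\<lambda>_. y)"
proof -
  \<comment> \<open>The program is built along the tree \<open>w\<close>; each of its leaves costs
    one scan of the input.\<close>
  have "\<exists>P K. \<forall>v. runs P v w (K * dsize v + K)" for w
  proof (induction w)
    case Atom
    show ?case
      by (intro exI[of _ Const_Atom] exI[of _ 1] allI) (rule runs_mono[OF runs_Const_Atom], simp)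
  next
    case (Pair w1 w2)
    then obtain P1 P2 K1 K2 where "\<And>v. runs P1 v w1 (K1 * dsize v + K1)"
      "\<And>v. runs P2 v w2 (K2 * dsize v + K2)" by blast
    then show ?case
      by (intro exI[of _ "Fork P1 P2"] exI[of _ "K1 + K2 + 1"] allI)
        (rule runs_mono[OF runs_Fork], auto simp: algebra_simps)
  qed
  then obtain P K where "\<And>v. runs P v (b y) (K * dsize v + K)" by blast
  then show ?thesis by (rule polytime_data)
qed

lemma polytime_Pair [polytime_intros]:
  assumes "polytime a b f" "polytime a c g"
  shows "polytime a (enc_prod b c) (\<lambda>x. (f x, g x))"
proof -
  obtain P q where P: "\<And>x n. dsize (a x) \<le> n \<Longrightarrow> runs P (a x) (b (f x)) (poly q n)"
    using polytimeE[OF assms(1)] by blast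
  obtain Q r where Q: "\<And>x n. dsize (a x) \<le> n \<Longrightarrow> runs Q (a x) (c (g x)) (poly r n)"
    using polytimeE[OF assms(2)] by blast
  show ?thesis
  proof (rule polytimeI)
    show "polybounded (\<lambda>n. poly q n + poly r n + 1)"
      by (intro polybounded_intros)
  next
    fix x
    show "runs (Fork P Q) (a x) (enc_prod b c (f x, g x)) (poly q (dsize (a x)) + poly r (dsize (a x)) + 1)"
      unfolding enc_prod.simps by (intro runs_Fork P Q order_refl)
  qed
qed

lemma polytime_Left:
  assumes "\<And>x. left (a x) = b (f x)"
  shows "polytime a b f"
  by (rule polytime_data[where P = Left and K = 1])
    (metis assms runs_mono[OF runs_Left] le_add1 mult_1)

lemma polytime_Right:
  assumes "\<And>x. right (a x) = b (f x)"
  shows "polytime a b f"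
  by (rule polytime_data[where P = Right and K = 1])
    (metis assms runs_mono[OF runs_Right] le_add1 mult_1)

text \<open>For a mere change of type: argument and result are the same tree, and the program is the
  identity.\<close>

lemma polytime_cast:
  assumes "\<And>x. a x = b (f x)"
  shows "polytime a b f"
  by (rule polytime_data[where P = Ident and K = 1])
    (metis assms runs_mono[OF runs_Ident] le_add1 mult_1)

lemma polytime_fst [polytime_intros]:
  "polytime a (enc_prod b c) f \<Longrightarrow> polytime a b (\<lambda>x. fst (f x))"
  by (rule polytime_comp[OF polytime_Left]) (auto simp: enc_prod_eq)

lemma polytime_snd [polytime_intros]:
  "polytime a (enc_prod b c) f \<Longrightarrow> polytime a c (\<lambda>x. snd (f x))"
  by (rule polytime_comp[OF polytime_Right]) (auto simp: enc_prod_eq)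

text \<open>The condition may be any tree that is \<open>Atom\<close> exactly when the test fails,
  so lists and numbers serve directly as tests for emptiness and zero.\<close>

lemma polytime_if_data:
  assumes "polytime a b c" "\<And>x. b (c x) = Atom \<longleftrightarrow> \<not> p x" "polytime a d f" "polytime a d g"
  shows "polytime a d (\<lambda>x. if p x then f x else g x)"
proof -
  obtain C s where C: "\<And>x n. dsize (a x) \<le> n \<Longrightarrow> runs C (a x) (b (c x)) (poly s n)"
    using polytimeE[OF assms(1)] by blast
  obtain P q where P: "\<And>x n. dsize (a x) \<le> n \<Longrightarrow> runs P (a x) (d (f x)) (poly q n)"
    using polytimeE[OF assms(3)] by blast
  obtain Q r where Q: "\<And>x n. dsize (a x) \<le> n \<Longrightarrow> runs Q (a x) (d (g x)) (poly r n)"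
    using polytimeE[OF assms(4)] by blast
  show ?thesis
  proof (rule polytimeI)
    show "polybounded (\<lambda>n. poly s n + (poly q n + poly r n) + 1)"
      by (intro polybounded_intros)
  next
    fix x
    let ?n = "dsize (a x)"
    show "runs (Cond C P Q) (a x) (d (if p x then f x else g x)) (poly s ?n + (poly q ?n + poly r ?n) + 1)"
    proof (cases "p x")
      case True
      then show ?thesis
        using runs_mono[OF runs_Cond_True[OF C[OF order_refl] _ P[OF order_refl]], of x
            "poly s ?n + (poly q ?n + poly r ?n) + 1" Q] assms(2)[of x]
        by simp
    next
      case False
      then have "runs C (a x) Atom (poly s ?n)"
        using C[of x, OF order_refl] assms(2)[of x] by simp
      from runs_mono[OF runs_Cond_False[OF this Q[OF order_refl]], of "poly s ?n + (poly q ?n + poly r ?n) + 1" P]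
      show ?thesis using False by simp
    qed
  qed
qed

lemma dsize_enc_bool: "dsize (enc_bool b) \<le> 3"
  by (cases b) auto

lemma dsize_pos: "0 < dsize v"
  by (cases v) auto

lemma polytime_if [polytime_intros]:
  "polytime a enc_bool p \<Longrightarrow> polytime a b f \<Longrightarrow> polytime a b g
    \<Longrightarrow> polytime a b (\<lambda>x. if p x then f x else g x)"
  by (rule polytime_if_data) auto

lemma polytime_not [polytime_intros]:
  assumes "polytime a enc_bool p"
  shows "polytime a enc_bool (\<lambda>x. \<not> p x)"
proof -
  have "polytime a enc_bool (\<lambda>x. if p x then False else True)"
    by (intro polytime_intros assms)
  moreover have "(\<lambda>x. if p x then False else True) = (\<lambda>x. \<not> p x)" by auto
  ultimately show ?thesis by simp
qed

lemma polytime_conj [polytime_intros]: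
  assumes "polytime a enc_bool p" "polytime a enc_bool q"
  shows "polytime a enc_bool (\<lambda>x. p x \<and> q x)"
proof -
  have "polytime a enc_bool (\<lambda>x. if p x then q x else False)"
    by (intro polytime_intros assms)
  moreover have "(\<lambda>x. if p x then q x else False) = (\<lambda>x. p x \<and> q x)" by auto
  ultimately show ?thesis by simp
qed

lemma polytime_disj [polytime_intros]:
  assumes "polytime a enc_bool p" "polytime a enc_bool q"
  shows "polytime a enc_bool (\<lambda>x. p x \<or> q x)"
  using polytime_not[OF polytime_conj[OF polytime_not polytime_not, OF assms]] by simp

lemma polytime_eq_bool:
  assumes "polytime a enc_bool p" "polytime a enc_bool q"
  shows "polytime a enc_bool (\<lambda>x. p x = q x)"
proof -
  have "polytime a enc_bool (\<lambda>x. if p x then q x else \<not> q x)"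
    by (intro polytime_intros assms)
  moreover have "(\<lambda>x. if p x then q x else \<not> q x) = (\<lambda>x. p x = q x)" by auto
  ultimately show ?thesis by simp
qed

subsection \<open>Lists\<close>

lemma enc_list_eq_Atom: "enc_list a xs = Atom \<longleftrightarrow> xs = []"
  by (cases xs) auto

lemma length_le_dsize: "length xs < dsize (enc_list a xs)"
  by (induction xs) auto

lemma polytime_Cons [polytime_intros]:
  assumes "polytime a b f" "polytime a (enc_list b) g"
  shows "polytime a (enc_list b) (\<lambda>x. f x # g x)"
proof -
  have "polytime (enc_prod b (enc_list b)) (enc_list b) (\<lambda>z. fst z # snd z)"
    by (rule polytime_cast) (simp add: enc_prod_eq)
  from polytime_comp[OF this polytime_Pair[OF assms]] show ?thesis by simp
qed

lemma polytime_tl [polytime_intros]: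
  "polytime a (enc_list b) f \<Longrightarrow> polytime a (enc_list b) (\<lambda>x. tl (f x))"
proof (rule polytime_comp[OF polytime_Right[where f = tl]])
  show "right (enc_list b xs) = enc_list b (tl xs)" for xs
    by (cases xs) auto
qed

lemma polytime_eq_Nil [polytime_intros]:
  assumes "polytime a (enc_list b) f"
  shows "polytime a enc_bool (\<lambda>x. f x = [])"
proof -
  have "polytime a enc_bool (\<lambda>x. if f x \<noteq> [] then False else True)"
    by (rule polytime_if_data[OF assms]) (auto simp: enc_list_eq_Atom intro: polytime_const)
  moreover have "(\<lambda>x. if f x \<noteq> [] then False else True) = (\<lambda>x. f x = [])" by auto
  ultimately show ?thesis by simp
qed

text \<open>The default keeps the head a total function, computable on every list including the
  empty one.\<close>

definition hd_or :: "'a \<Rightarrow> 'a list \<Rightarrow> 'a" where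
  "hd_or y xs = (case xs of [] \<Rightarrow> y | x # _ \<Rightarrow> x)"

lemma hd_or_simps [simp]: "hd_or y [] = y" "hd_or y (x # xs) = x"
  by (auto simp: hd_or_def)

lemma polytime_hd_or [polytime_intros]:
  assumes "polytime a (enc_list b) f"
  shows "polytime a b (\<lambda>x. hd_or y (f x))"
proof (rule polytime_comp[OF _ assms])
  obtain P q where P: "\<And>x n. dsize (enc_list b x) \<le> n \<Longrightarrow> runs P (enc_list b x) (b y) (poly q n)"
    using polytimeE[OF polytime_const[of "enc_list b" b y]] by blast
  show "polytime (enc_list b) b (hd_or y)"
  proof (rule polytimeI)
    show "polybounded (\<lambda>n. n + (n + poly q n) + 1)"
      by (intro polybounded_intros)
  next
    fix xs
    let ?n = "dsize (enc_list b xs)"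
    show "runs (Cond Ident Left P) (enc_list b xs) (b (hd_or y xs)) (?n + (?n + poly q ?n) + 1)"
    proof (cases xs)
      case Nil
      then have "runs Ident (enc_list b xs) Atom ?n" using runs_Ident by (metis enc_list.simps(1))
      from runs_mono[OF runs_Cond_False[OF this P[OF order_refl]], where T' = "?n + (?n + poly q ?n) + 1"]
      show ?thesis using Nil by simp
    next
      case (Cons x xs')
      have "runs Left (enc_list b xs) (b x) ?n"
        using runs_Left[of "enc_list b xs"] Cons by simp
      from runs_mono[OF runs_Cond_True[OF runs_Ident _ this], where T' = "?n + (?n + poly q ?n) + 1"]
      show ?thesis using Cons by simp
    qed
  qed
qed

text \<open>The measure \<open>w\<close> of the accumulator may grow, in each step, only by an amount that does not
  depend on the accumulator; otherwise the size could double in each step.\<close>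

lemma polytime_fold_measure:
  fixes f :: "'a \<Rightarrow> 'b \<Rightarrow> 'c \<Rightarrow> 'c" and w :: "'c \<Rightarrow> nat"
  assumes xs: "polytime a (enc_list b) xs" and init: "polytime a c init"
    and f: "polytime (enc_prod (enc_prod a b) c) c (\<lambda>z. f (fst (fst z)) (snd (fst z)) (snd z))"
    and w: "\<And>u. dsize (c u) \<le> w u"
    and w_init: "\<And>x. w (init x) \<le> poly q1 (dsize (a x))"
    and w_step: "\<And>x y u. w (f x y u) \<le> w u + poly q2 (dsize (a x) + dsize (b y))"
  shows "polytime a c (\<lambda>x. fold (f x) (xs x) (init x))"
proof -
  obtain Pf qf where Pf': "\<And>z n. dsize (enc_prod (enc_prod a b) c z) \<le> n \<Longrightarrow>
     runs Pf (enc_prod (enc_prod a b) c z) (c (f (fst (fst z)) (snd (fst z)) (snd z))) (poly qf n)"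
    using polytimeE[OF f] by blast
  have Pf: "runs Pf (Pair (Pair (a x) (b y)) (c u)) (c (f x y u)) (poly qf n)"
    if "dsize (a x) + dsize (b y) + dsize (c u) + 2 \<le> n" for x y u n
    using Pf'[of "((x, y), u)" n] that by simp
  obtain Px qx where Px: "\<And>x n. dsize (a x) \<le> n \<Longrightarrow> runs Px (a x) (enc_list b (xs x)) (poly qx n)"
    using polytimeE[OF xs] by blast
  obtain Pi qi where Pi: "\<And>x n. dsize (a x) \<le> n \<Longrightarrow> runs Pi (a x) (c (init x)) (poly qi n)"
    using polytimeE[OF init] by blast
  \<comment> \<open>The loop state is \<open>Pair (a x) (Pair ys u)\<close>: the fixed argument, the
    unread part of the list and the accumulator. \<open>cond\<close> extracts the list, which as a
    truth value says that it is nonempty; \<open>arg\<close> assembles the argument of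
    \<open>Pf\<close>.\<close>
  define cond where "cond = Seq Right Left"
  define arg where "arg = Fork (Fork Left (Seq Right (Seq Left Left))) (Seq Right Right)"
  define body where "body = Fork Left (Fork (Seq Right (Seq Left Right)) (Seq arg Pf))"
  \<comment> \<open>\<open>N\<close> bounds the argument together with the list, \<open>W\<close>
    the measure of the accumulator over the whole run, \<open>S\<close> the loop state, and
    \<open>C\<close> the cost of one round.\<close>
  define N where "N = (\<lambda>n. n + poly qx n)"
  define W where "W = (\<lambda>n. poly q1 n + poly qx n * poly q2 (N n))"
  define S where "S = (\<lambda>n. N n + W n + 3)"
  define C where "C = (\<lambda>n. 20 * S n + 20 + poly qf (S n))"
  have loop: "runs (While cond body) (Pair (a x) (Pair (enc_list b ys) (c u)))
      (Pair (a x) (Pair Atom (c (fold (f x) ys u)))) ((length ys + 1) * C n)"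
    if "w u + length ys * poly q2 (N n) \<le> W n" "dsize (a x) + dsize (enc_list b ys) \<le> N n" for x ys u n
    using that
  proof (induction ys arbitrary: u)
    case Nil
    let ?v = "Pair (a x) (Pair Atom (c u))"
    have "dsize (c u) \<le> W n" using w[of u] Nil by simp
    with Nil have v: "dsize ?v \<le> S n" unfolding S_def by simp
    have "runs cond ?v Atom (dsize ?v + dsize ?v + 1)"
      unfolding cond_def by (rule runs_mono[OF runs_Seq[OF runs_Right_Pair runs_Left_Pair]]) simp
    from runs_mono[OF runs_While_False[OF this, of body], of "(length [] + 1) * C n"] v
    show ?case by (simp add: C_def)
  next
    case (Cons y ys)
    let ?l = "Pair (b y) (enc_list b ys)"
    let ?v = "Pair (a x) (Pair ?l (c u))"
    let ?u = "f x y u"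
    have u: "dsize (c u) \<le> W n" using w[of u] Cons.prems by simp
    with Cons.prems have v: "dsize ?v \<le> S n" unfolding S_def by simp
    have R: "runs Right ?v (Pair ?l (c u)) (S n)"
      by (rule runs_mono[OF runs_Right_Pair v])
    have RL: "runs cond ?v ?l (2 * S n + 1)"
      unfolding cond_def by (rule runs_mono[OF runs_Seq[OF R runs_Left_Pair]]) (use v in simp)
    have "runs (Seq Left Left) (Pair ?l (c u)) (b y) (2 * S n + 1)"
      by (rule runs_mono[OF runs_Seq[OF runs_Left_Pair runs_Left_Pair]]) (use v in simp)
    from runs_Seq[OF R this] have RLL: "runs (Seq Right (Seq Left Left)) ?v (b y) (3 * S n + 2)"
      by (rule runs_mono) simp
    have "runs (Seq Left Right) (Pair ?l (c u)) (enc_list b ys) (2 * S n + 1)"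
      by (rule runs_mono[OF runs_Seq[OF runs_Left_Pair runs_Right_Pair]]) (use v in simp)
    from runs_Seq[OF R this] have RLR: "runs (Seq Right (Seq Left Right)) ?v (enc_list b ys) (3 * S n + 2)"
      by (rule runs_mono) simp
    have RR: "runs (Seq Right Right) ?v (c u) (2 * S n + 1)"
      by (rule runs_mono[OF runs_Seq[OF R runs_Right_Pair]]) (use v in simp)
    have L: "runs Left ?v (a x) (S n)"
      by (rule runs_mono[OF runs_Left_Pair v])
    have "runs arg ?v (Pair (Pair (a x) (b y)) (c u)) (6 * S n + 5)"
      unfolding arg_def by (rule runs_mono[OF runs_Fork[OF runs_Fork[OF L RLL] RR]]) simp
    moreover have "runs Pf (Pair (Pair (a x) (b y)) (c u)) (c ?u) (poly qf (S n))"
      using Cons.prems u by (intro Pf) (auto simp: S_def)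
    ultimately have "runs (Seq arg Pf) ?v (c ?u) (6 * S n + 5 + poly qf (S n) + 1)"
      by (rule runs_Seq)
    from runs_Fork[OF L runs_Fork[OF RLR this]]
    have B: "runs body ?v (Pair (a x) (Pair (enc_list b ys) (c ?u))) (10 * S n + 10 + poly qf (S n))"
      unfolding body_def by (rule runs_mono) simp
    have "poly q2 (dsize (a x) + dsize (b y)) \<le> poly q2 (N n)"
      using Cons.prems by (intro poly_nat_mono) auto
    then have "w ?u + length ys * poly q2 (N n) \<le> W n"
      using w_step[of x y u] Cons.prems by simp
    from Cons.IH[OF this] Cons.prems have
      "runs (While cond body) (Pair (a x) (Pair (enc_list b ys) (c ?u)))
        (Pair (a x) (Pair Atom (c (fold (f x) ys ?u)))) ((length ys + 1) * C n)" by simp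
    from runs_mono[OF runs_While_True[OF RL _ B this], of "(length (y # ys) + 1) * C n"]
    show ?case by (simp add: C_def)
  qed
  show ?thesis
  proof (rule polytimeI)
    show "polybounded (\<lambda>n. (n + (poly qx n + poly qi n + 1) + 1) +
        ((poly qx n + 1) * C n + 4 * S n + 3))"
      unfolding C_def S_def W_def N_def by (intro polybounded_intros)
  next
    fix x
    let ?n = "dsize (a x)"
    let ?r = "fold (f x) (xs x) (init x)"
    let ?fin = "Pair (a x) (Pair Atom (c ?r))"
    have sx: "dsize (enc_list b (xs x)) \<le> poly qx ?n"
      using Px[OF order_refl] by (rule runs_size)
    then have len: "length (xs x) \<le> poly qx ?n"
      using length_le_dsize[of "xs x" b] by simp
    have st: "w (init x) + length (xs x) * poly q2 (N ?n) \<le> W ?n"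
      unfolding W_def using w_init[of x] len by (intro add_mono mult_right_mono) auto
    \<comment> \<open>The projection after the loop is charged for the final state, so the
      accumulator must be bounded at the end as well.\<close>
    have wf: "w (fold (f x) ys u) + length [] * poly q2 (N ?n) \<le> w u + length ys * poly q2 (N ?n)"
      if "\<And>y. y \<in> set ys \<Longrightarrow> dsize (a x) + dsize (b y) \<le> N ?n" for ys u
      using that
    proof (induction ys arbitrary: u)
      case (Cons y ys)
      have "poly q2 (dsize (a x) + dsize (b y)) \<le> poly q2 (N ?n)"
        using Cons.prems by (intro poly_nat_mono) auto
      then show ?case using Cons.IH[of "f x y u"] Cons.prems w_step[of x y u] by simp
    qed simp
    have mem: "y \<in> set ys \<Longrightarrow> dsize (b y) \<le> dsize (enc_list b ys)" for y ys
      by (induction ys) auto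
    have "dsize (a x) + dsize (b y) \<le> N ?n" if "y \<in> set (xs x)" for y
      using mem[OF that] sx unfolding N_def by simp
    from wf[OF this, of "xs x" "init x"] st have "dsize (c ?r) \<le> W ?n"
      using w[of ?r] by simp
    then have fin: "dsize ?fin \<le> S ?n" unfolding S_def N_def by (simp add: dsize_pos)
    have I: "runs (Fork Ident (Fork Px Pi)) (a x) (Pair (a x) (Pair (enc_list b (xs x)) (c (init x))))
        (?n + (poly qx ?n + poly qi ?n + 1) + 1)"
      by (intro runs_Fork runs_Ident Px Pi order_refl)
    have "runs (While cond body) (Pair (a x) (Pair (enc_list b (xs x)) (c (init x)))) ?fin
        ((length (xs x) + 1) * C ?n)"
      by (rule loop[OF st]) (use sx in \<open>simp add: N_def\<close>)
    then have L: "runs (While cond body) (Pair (a x) (Pair (enc_list b (xs x)) (c (init x)))) ?fin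
        ((poly qx ?n + 1) * C ?n)"
      by (rule runs_mono) (use len in \<open>simp\<close>)
    have R: "runs (Seq Right Right) ?fin (c ?r) (2 * S ?n + 1)"
      by (rule runs_mono[OF runs_Seq[OF runs_Right_Pair runs_Right_Pair]]) (use fin in simp)
    have "runs (Seq (Fork Ident (Fork Px Pi)) (Seq (While cond body) (Seq Right Right))) (a x) (c ?r)
        (?n + (poly qx ?n + poly qi ?n + 1) + 1 + ((poly qx ?n + 1) * C ?n + (2 * S ?n + 1) + 1) + 1)"
      by (rule runs_Seq[OF I runs_Seq[OF L R]])
    then show "runs (Seq (Fork Ident (Fork Px Pi)) (Seq (While cond body) (Seq Right Right))) (a x) (c ?r)
       ((?n + (poly qx ?n + poly qi ?n + 1) + 1) + ((poly qx ?n + 1) * C ?n + 4 * S ?n + 3))"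
      by (rule runs_mono) simp
  qed
qed

lemma polytime_fold:
  assumes "polytime a (enc_list b) xs" "polytime a c init"
    and "polytime (enc_prod (enc_prod a b) c) c (\<lambda>z. f (fst (fst z)) (snd (fst z)) (snd z))"
    and "\<And>x y u. dsize (c (f x y u)) \<le> dsize (c u) + poly q (dsize (a x) + dsize (b y))"
  shows "polytime a c (\<lambda>x. fold (f x) (xs x) (init x))"
proof -
  obtain r where "\<And>x n. dsize (a x) \<le> n \<Longrightarrow> dsize (c (init x)) \<le> poly r n"
    using polytime_size[OF assms(2)] by blast
  then show ?thesis
    by (intro polytime_fold_measure[OF assms(1-3), where w = "\<lambda>u. dsize (c u)"]) (auto intro: assms(4))
qed

lemma polytime_fold_linear:
  assumes "polytime a (enc_list b) xs" "polytime a c init"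
    and "polytime (enc_prod (enc_prod a b) c) c (\<lambda>z. f (fst (fst z)) (snd (fst z)) (snd z))"
    and "\<And>x y u. dsize (c (f x y u)) \<le> dsize (c u) + K * dsize (b y) + K"
  shows "polytime a c (\<lambda>x. fold (f x) (xs x) (init x))"
proof (rule polytime_fold[OF assms(1-3)])
  show "dsize (c (f x y u)) \<le> dsize (c u) + poly [:K, K:] (dsize (a x) + dsize (b y))" for x y u
    using assms(4)[of x y u] by (simp add: algebra_simps)
qed

lemma polytime_rev [polytime_intros]:
  assumes "polytime a (enc_list b) f"
  shows "polytime a (enc_list b) (\<lambda>x. rev (f x))"
proof -
  have "polytime a (enc_list b) (\<lambda>x. fold (\<lambda>y u. y # u) (f x) [])"
    by (rule polytime_fold_linear[where K = 1]) ((rule assms polytime_intros)+, simp)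
  then show ?thesis by (simp add: rev_conv_fold)
qed

lemma polytime_append [polytime_intros]:
  assumes "polytime a (enc_list b) f" "polytime a (enc_list b) g"
  shows "polytime a (enc_list b) (\<lambda>x. f x @ g x)"
proof -
  have "polytime a (enc_list b) (\<lambda>x. fold (\<lambda>y u. y # u) (rev (f x)) (g x))"
    by (rule polytime_fold_linear[where K = 1]) ((rule assms polytime_intros)+, simp)
  then show ?thesis by (simp add: fold_Cons_rev)
qed

lemma polytime_map [polytime_intros]:
  assumes "polytime a (enc_list b) l" "polytime (enc_prod a b) c (\<lambda>z. g (fst z) (snd z))"
  shows "polytime a (enc_list c) (\<lambda>x. map (g x) (l x))"
proof -
  obtain q where q: "\<And>z n. dsize (enc_prod a b z) \<le> n \<Longrightarrow> dsize (c (g (fst z) (snd z))) \<le> poly q n"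
    using polytime_size[OF assms(2)] by blast
  have g: "polytime (enc_prod (enc_prod a b) (enc_list c)) c (\<lambda>z. g (fst (fst z)) (snd (fst z)))"
    by (rule polytime_comp[OF assms(2)]) (rule polytime_intros)+
  have "polytime a (enc_list c) (\<lambda>x. fold (\<lambda>y u. g x y # u) (l x) [])"
  proof (rule polytime_fold[OF assms(1)])
    \<comment> \<open>The pair \<open>(x, y)\<close> is larger by 1 than its components together,
      hence \<open>[:1, 1:]\<close>; the outer summand 1 pays for the new list cell.\<close>
    show "dsize (enc_list c (g x y # u))
        \<le> dsize (enc_list c u) + poly (pcompose q [:1, 1:] + 1) (dsize (a x) + dsize (b y))" for x y u
      using q[of "(x, y)" "1 + (dsize (a x) + dsize (b y))"] by (simp add: poly_pcompose)
  qed (rule g polytime_intros)+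
  then have "polytime a (enc_list c) (\<lambda>x. rev (fold (\<lambda>y u. g x y # u) (l x) []))"
    by (rule polytime_rev)
  moreover have "fold (\<lambda>y u. g x y # u) ys us = rev (map (g x) ys) @ us" for x ys us
    by (induction ys arbitrary: us) auto
  ultimately show ?thesis by simp
qed

lemma polytime_filter [polytime_intros]:
  assumes "polytime a (enc_list b) l" "polytime (enc_prod a b) enc_bool (\<lambda>z. p (fst z) (snd z))"
  shows "polytime a (enc_list b) (\<lambda>x. filter (p x) (l x))"
proof -
  have g: "polytime (enc_prod (enc_prod a b) (enc_list b)) enc_bool (\<lambda>z. p (fst (fst z)) (snd (fst z)))"
    by (rule polytime_comp[OF assms(2)]) (rule polytime_intros)+
  have "polytime a (enc_list b) (\<lambda>x. fold (\<lambda>y u. if p x y then y # u else u) (l x) [])"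
    by (rule polytime_fold_linear[OF assms(1), where K = 1]) ((rule g polytime_intros)+, simp)
  then have "polytime a (enc_list b) (\<lambda>x. rev (fold (\<lambda>y u. if p x y then y # u else u) (l x) []))"
    by (rule polytime_rev)
  moreover have "fold (\<lambda>y u. if p x y then y # u else u) ys us = rev (filter (p x) ys) @ us" for x ys us
    by (induction ys arbitrary: us) auto
  ultimately show ?thesis by simp
qed

lemma dsize_append: "dsize (enc_list b (xs @ ys)) + 1 = dsize (enc_list b xs) + dsize (enc_list b ys)"
  by (induction xs) auto

lemma polytime_concat [polytime_intros]:
  assumes "polytime a (enc_list (enc_list b)) l"
  shows "polytime a (enc_list b) (\<lambda>x. concat (l x))"
proof -
  have "polytime a (enc_list b) (\<lambda>x. fold (\<lambda>ys us. us @ ys) (l x) [])"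
  proof (rule polytime_fold_linear[OF assms(1), where K = 1])
    show "dsize (enc_list b (us @ ys)) \<le> dsize (enc_list b us) + 1 * dsize (enc_list b ys) + 1" for us ys
      using dsize_append[of b us ys] by linarith
  qed (rule polytime_intros)+
  moreover have "fold (\<lambda>ys us. us @ ys) yss us = us @ concat yss" for yss and us :: "'b list"
    by (induction yss arbitrary: us) auto
  ultimately show ?thesis by simp
qed

lemma polytime_Bex_set [polytime_intros]:
  assumes "polytime a (enc_list b) l" "polytime (enc_prod a b) enc_bool (\<lambda>z. p (fst z) (snd z))"
  shows "polytime a enc_bool (\<lambda>x. \<exists>y\<in>set (l x). p x y)"
  using polytime_not[OF polytime_eq_Nil[OF polytime_filter[OF assms]]]
  by (simp add: filter_empty_conv)

lemma polytime_Ball_set [polytime_intros]: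
  assumes "polytime a (enc_list b) l" "polytime (enc_prod a b) enc_bool (\<lambda>z. p (fst z) (snd z))"
  shows "polytime a enc_bool (\<lambda>x. \<forall>y\<in>set (l x). p x y)"
  using polytime_eq_Nil[OF polytime_filter[OF assms(1) polytime_not[OF assms(2)]]]
  by (simp add: filter_empty_conv)

lemma polytime_zip [polytime_intros]:
  assumes "polytime a (enc_list b) f" "polytime a (enc_list c) g"
  shows "polytime a (enc_list (enc_prod b c)) (\<lambda>x. zip (f x) (g x))"
proof -
  let ?step = "\<lambda>y u. if fst u = [] then u else (tl (fst u), (y, hd_or undefined (fst u)) # snd u)"
  have r: "polytime a (enc_prod (enc_list c) (enc_list (enc_prod b c))) (\<lambda>x. fold ?step (f x) (g x, []))"
  proof (rule polytime_fold_linear[where K = 2])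
    fix y and u :: "'c list \<times> ('b \<times> 'c) list"
    show "dsize (enc_prod (enc_list c) (enc_list (enc_prod b c)) (?step y u))
        \<le> dsize (enc_prod (enc_list c) (enc_list (enc_prod b c)) u) + 2 * dsize (b y) + 2"
      by (cases "fst u") (auto simp: enc_prod_eq)
  qed (rule assms polytime_intros)+
  have "polytime a (enc_list (enc_prod b c)) (\<lambda>x. rev (snd (fold ?step (f x) (g x, []))))"
    by (rule r polytime_intros)+
  moreover have "rev (snd (fold ?step ys (zs, us))) = rev us @ zip ys zs"
    for ys :: "'b list" and zs :: "'c list" and us
  proof (induction ys arbitrary: zs us)
    case (Cons y ys)
    show ?case
    proof (cases zs)
      case Nil
      then show ?thesis using Cons.IH[of "[]" us] by simp
    next
      case (Cons z zs')
      then show ?thesis using Cons.IH[of zs' "(y, z) # us"] by simp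
    qed
  qed simp
  ultimately show ?thesis by (simp only: rev.simps append_Nil)
qed

definition eq_polytime :: "('a \<Rightarrow> data) \<Rightarrow> bool" where
  "eq_polytime b \<longleftrightarrow> polytime (enc_prod b b) enc_bool (\<lambda>z. fst z = snd z)"

lemma polytime_eq [polytime_intros]:
  assumes "polytime a b f" "polytime a b g" "eq_polytime b"
  shows "polytime a enc_bool (\<lambda>x. f x = g x)"
  using polytime_comp[OF assms(3)[unfolded eq_polytime_def] polytime_Pair[OF assms(1,2)]] by simp

lemma eq_polytime_bool [polytime_intros]: "eq_polytime enc_bool"
  unfolding eq_polytime_def by (rule polytime_eq_bool polytime_intros)+

lemma eq_polytime_list [polytime_intros]:
  assumes "eq_polytime b"
  shows "eq_polytime (enc_list b)"
proof -
  let ?a = "enc_prod (enc_list b) (enc_list b)"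
  \<comment> \<open>Once the second list is exhausted the state is stuck at
    \<open>([], False)\<close>, which rejects a longer first list; a longer second list leaves a
    nonempty rest.\<close>
  let ?step = "\<lambda>y u. if fst u = [] then ([], False) else (tl (fst u), snd u \<and> y = hd_or undefined (fst u))"
  have r: "polytime ?a (enc_prod (enc_list b) enc_bool) (\<lambda>z. fold ?step (fst z) (snd z, True))"
  proof (rule polytime_fold_linear[where K = 3])
    fix y and u :: "'a list \<times> bool"
    show "dsize (enc_prod (enc_list b) enc_bool (?step y u))
        \<le> dsize (enc_prod (enc_list b) enc_bool u) + 3 * dsize (b y) + 3"
      using dsize_enc_bool[of "snd u \<and> y = hd_or undefined (fst u)"]
      by (cases "fst u") (auto simp: enc_prod_eq)
  qed (rule assms polytime_intros)+
  have "polytime ?a enc_bool (\<lambda>z. fst (fold ?step (fst z) (snd z, True)) = []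
      \<and> snd (fold ?step (fst z) (snd z, True)))"
    by (rule r polytime_intros)+
  moreover have "(fst (fold ?step ys (zs, p)) = [] \<and> snd (fold ?step ys (zs, p))) = (p \<and> ys = zs)"
    for ys zs :: "'a list" and p
  proof (induction ys arbitrary: zs p)
    case (Cons y ys)
    show ?case
    proof (cases zs)
      case Nil
      then show ?thesis using Cons.IH[of "[]" False] by simp
    next
      case (Cons z zs')
      then show ?thesis using Cons.IH[of zs' "p \<and> y = z"] by auto
    qed
  qed auto
  ultimately show ?thesis unfolding eq_polytime_def by (simp only: simp_thms)
qed

lemma polytime_mem [polytime_intros]:
  assumes "polytime a b f" "polytime a (enc_list b) l" "eq_polytime b"
  shows "polytime a enc_bool (\<lambda>x. f x \<in> set (l x))"
proof -
  have r: "polytime a enc_bool (\<lambda>x. \<exists>y\<in>set (l x). f x = y)"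
    by (rule assms polytime_comp[OF assms(1)] polytime_intros)+
  then show ?thesis by simp
qed

subsection \<open>Numbers\<close>

fun bits :: "nat \<Rightarrow> bool list" where
  "bits n = (if n = 0 then [] else odd n # bits (n div 2))"

declare bits.simps [simp del]

lemma bits_0 [simp]: "bits 0 = []"
  by (simp add: bits.simps)

lemma bits_pos: "n > 0 \<Longrightarrow> bits n = odd n # bits (n div 2)"
  by (subst bits.simps) simp

lemma enc_nat_0 [simp]: "enc_nat 0 = Atom"
  by (simp add: enc_nat.simps)

lemma enc_nat_pos: "n > 0 \<Longrightarrow> enc_nat n = Pair (enc_bool (odd n)) (enc_nat (n div 2))"
  by (subst enc_nat.simps) simp

text \<open>Makes all programs on lists available for binary numbers.\<close>

lemma enc_nat_bits: "enc_nat n = enc_list enc_bool (bits n)"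
proof (induction n rule: bits.induct)
  case (1 n)
  then show ?case by (cases "n = 0") (auto simp: bits_pos enc_nat_pos)
qed

lemma enc_nat_eq_Atom: "enc_nat n = Atom \<longleftrightarrow> n = 0"
  by (cases "n = 0") (simp_all add: enc_nat_pos)

lemma bits_eq_Nil: "bits n = [] \<longleftrightarrow> n = 0"
  by (cases "n = 0") (simp_all add: bits_pos)

lemma bits_inject: "bits m = bits n \<longleftrightarrow> m = n"
proof (induction m arbitrary: n rule: bits.induct)
  case (1 m)
  show ?case
  proof (cases "m = 0 \<or> n = 0")
    case True
    then show ?thesis using bits_eq_Nil[of m] bits_eq_Nil[of n] by auto
  next
    case False
    then have "bits m = bits n \<longleftrightarrow> odd m = odd n \<and> m div 2 = n div 2"
      using 1[of "n div 2"] False by (simp add: bits_pos)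
    also have "\<dots> \<longleftrightarrow> m = n"
      by presburger
    finally show ?thesis .
  qed
qed

lemma less_2_power_length_bits: "n < 2 ^ length (bits n)"
proof (induction n rule: bits.induct)
  case (1 n)
  then show ?case by (cases "n = 0") (auto simp: bits_pos)
qed

lemma polytime_bits [polytime_intros]:
  "polytime a enc_nat f \<Longrightarrow> polytime a (enc_list enc_bool) (\<lambda>x. bits (f x))"
  by (rule polytime_comp[OF polytime_cast]) (auto simp: enc_nat_bits)

lemma eq_polytime_nat [polytime_intros]: "eq_polytime enc_nat"
proof -
  have "polytime (enc_prod enc_nat enc_nat) enc_bool (\<lambda>z. bits (fst z) = bits (snd z))"
    by (rule polytime_intros)+
  then show ?thesis unfolding eq_polytime_def bits_inject .
qed

lemma polytime_div2 [polytime_intros]: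
  "polytime a enc_nat f \<Longrightarrow> polytime a enc_nat (\<lambda>x. f x div 2)"
proof (rule polytime_comp[OF polytime_Right[where f = "\<lambda>n. n div 2"]])
  show "right (enc_nat n) = enc_nat (n div 2)" for n
    by (cases "n = 0") (auto simp: enc_nat_pos)
qed

lemma polytime_odd [polytime_intros]:
  "polytime a enc_nat f \<Longrightarrow> polytime a enc_bool (\<lambda>x. odd (f x))"
proof (rule polytime_comp[OF polytime_Left[where f = odd]])
  show "left (enc_nat n) = enc_bool (odd n)" for n
    by (cases "n = 0") (auto simp: enc_nat_pos)
qed

lemma polytime_shift [polytime_intros]:
  assumes "polytime a enc_bool p" "polytime a enc_nat f"
  shows "polytime a enc_nat (\<lambda>x. of_bool (p x) + 2 * f x)"
proof -
  have f0: "polytime a enc_bool (\<lambda>x. f x \<noteq> 0)"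
  proof -
    have "polytime a enc_bool (\<lambda>x. if f x \<noteq> 0 then True else False)"
      by (rule polytime_if_data[OF assms(2)]) (auto simp: enc_nat_eq_Atom intro: polytime_const)
    moreover have "(\<lambda>x. if f x \<noteq> 0 then True else False) = (\<lambda>x. f x \<noteq> 0)" by auto
    ultimately show ?thesis by simp
  qed
  \<comment> \<open>Numbers carry no leading zeros: a digit is put in front by \<open>Pair\<close>,
    except that a zero digit in front of the number 0 must give \<open>Atom\<close> again.\<close>
  let ?g = "\<lambda>x. if p x \<or> f x \<noteq> 0 then Pair (enc_bool (p x)) (enc_nat (f x)) else Atom"
  have "polytime (enc_prod enc_bool enc_nat) (\<lambda>v. v) (\<lambda>z. Pair (enc_bool (fst z)) (enc_nat (snd z)))"
    by (rule polytime_cast) (simp add: enc_prod_eq)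
  from polytime_comp[OF this polytime_Pair[OF assms]]
  have r: "polytime a (\<lambda>v. v) (\<lambda>x. Pair (enc_bool (p x)) (enc_nat (f x)))" by simp
  have "polytime a (\<lambda>v. v) ?g"
    by (rule assms f0 r polytime_intros)+
  moreover have "?g x = enc_nat (of_bool (p x) + 2 * f x)" for x
    by (auto simp: enc_nat_pos)
  ultimately show ?thesis by (simp add: polytime_on_def)
qed

lemma polytime_double [polytime_intros]:
  assumes "polytime a enc_nat f"
  shows "polytime a enc_nat (\<lambda>x. 2 * f x)"
  using polytime_shift[OF polytime_const[of _ _ False] assms] by simp

text \<open>The most significant bit comes first, so this undoes digit lists that were collected in
  reverse; \<open>r\<close> supplies the part above them.\<close>

definition of_bits :: "bool list \<Rightarrow> nat \<Rightarrow> nat" where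
  "of_bits = fold (\<lambda>b r. of_bool b + 2 * r)"

lemma of_bits_simps [simp]: "of_bits [] r = r" "of_bits (b # bs) r = of_bits bs (of_bool b + 2 * r)"
  by (auto simp: of_bits_def)

lemma dsize_enc_nat_shift: "dsize (enc_nat (of_bool b + 2 * r)) \<le> dsize (enc_nat r) + 4"
  using dsize_enc_bool[of b] by (cases "of_bool b + 2 * r = 0") (auto simp: enc_nat_pos)

lemma polytime_of_bits [polytime_intros]:
  assumes "polytime a (enc_list enc_bool) f" "polytime a enc_nat g"
  shows "polytime a enc_nat (\<lambda>x. of_bits (f x) (g x))"
  unfolding of_bits_def
proof (rule polytime_fold_linear[where K = 4])
  show "dsize (enc_nat (of_bool b + 2 * r)) \<le> dsize (enc_nat r) + 4 * dsize (enc_bool b) + 4" for b r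
    using dsize_enc_nat_shift[of b r] by linarith
qed (rule assms polytime_intros)+

lemma polytime_Suc [polytime_intros]:
  assumes "polytime a enc_nat f"
  shows "polytime a enc_nat (\<lambda>x. Suc (f x))"
proof -
  \<comment> \<open>The state is the carry and the digits of the result in reverse. A carry left at
    the end becomes the leading digit through the second argument of \<open>of_bits\<close>.\<close>
  let ?step = "\<lambda>b u. (fst u \<and> b, (fst u \<noteq> b) # snd u)"
  let ?r = "\<lambda>n. fold ?step (bits n) (True, [])"
  have r: "polytime a (enc_prod enc_bool (enc_list enc_bool)) (\<lambda>x. ?r (f x))"
  proof (rule polytime_fold_linear[where K = 6])
    fix b and u :: "bool \<times> bool list"
    show "dsize (enc_prod enc_bool (enc_list enc_bool) (?step b u))
        \<le> dsize (enc_prod enc_bool (enc_list enc_bool) u) + 6 * dsize (enc_bool b) + 6"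
      using dsize_enc_bool[of "fst u \<and> b"] dsize_enc_bool[of "fst u \<noteq> b"] dsize_pos[of "enc_bool b"]
      by (simp add: enc_prod_eq)
  qed (rule assms polytime_intros)+
  have "polytime a enc_nat (\<lambda>x. of_bits (snd (?r (f x))) (if fst (?r (f x)) then 1 else 0))"
    by (rule r polytime_intros)+
  moreover have "of_bits (snd (fold ?step (bits n) (c, st))) (if fst (fold ?step (bits n) (c, st)) then 1 else 0)
      = of_bits st (n + of_bool c)" for n c st
  proof (induction n arbitrary: c st rule: bits.induct)
    case (1 n)
    show ?case
    proof (cases "n = 0")
      case True
      then show ?thesis by simp
    next
      case False
      have "of_bool (c \<noteq> odd n) + 2 * (n div 2 + of_bool (c \<and> odd n)) = n + of_bool c"
        by (cases "odd n"; cases c) (auto elim!: oddE evenE)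
      then show ?thesis using 1[OF False, of "c \<and> odd n" "(c \<noteq> odd n) # st"] False
        by (simp add: bits_pos)
    qed
  qed
  ultimately show ?thesis by simp
qed

lemma dsize_enc_nat_Suc: "dsize (enc_nat (Suc n)) \<le> dsize (enc_nat n) + 4"
proof (induction n rule: bits.induct)
  case (1 n)
  show ?case
  proof (cases "n = 0")
    case False
    then show ?thesis using 1[OF False]
      by (cases "odd n") (auto simp: enc_nat_pos elim!: oddE evenE)
  qed (simp add: enc_nat_pos)
qed

lemma dsize_enc_nat_le: "dsize (enc_nat n) \<le> 4 * n + 1"
proof (induction n)
  case (Suc n)
  then show ?case using dsize_enc_nat_Suc[of n] by simp
qed simp

lemma polytime_le [polytime_intros]:
  assumes "polytime a enc_nat f" "polytime a enc_nat g"
  shows "polytime a enc_bool (\<lambda>x. f x \<le> g x)"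
proof -
  \<comment> \<open>Both numbers are halved in parallel, and the verdict is overwritten whenever the
    current digits differ, so the most significant difference decides. The concatenated digit lists
    serve as a counter long enough for both numbers.\<close>
  let ?step = "\<lambda>b u. ((fst (fst u) div 2, snd (fst u) div 2),
    if odd (fst (fst u)) = odd (snd (fst u)) then snd u else odd (snd (fst u)))"
  let ?r = "\<lambda>x. fold ?step (bits (f x) @ bits (g x)) ((f x, g x), True)"
  have half: "dsize (enc_nat (n div 2)) \<le> dsize (enc_nat n)" for n
    by (cases "n = 0") (auto simp: enc_nat_pos)
  have r: "polytime a (enc_prod (enc_prod enc_nat enc_nat) enc_bool) ?r"
  proof (rule polytime_fold_linear[where K = 3])
    fix b and u :: "(nat \<times> nat) \<times> bool"
    show "dsize (enc_prod (enc_prod enc_nat enc_nat) enc_bool (?step b u))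
        \<le> dsize (enc_prod (enc_prod enc_nat enc_nat) enc_bool u) + 3 * dsize (enc_bool b) + 3"
      using half[of "fst (fst u)"] half[of "snd (fst u)"] dsize_enc_bool[of "snd (?step b u)"]
      by (simp add: enc_prod_eq)
  qed (rule assms polytime_intros)+
  have "polytime a enc_bool (\<lambda>x. snd (?r x))"
    by (rule r polytime_intros)+
  moreover have le: "snd (fold ?step bs ((m, n), c)) \<longleftrightarrow> (if m = n then c else m < n)"
    if "m < 2 ^ length bs" "n < 2 ^ length bs" for bs c and m n :: nat
    using that
  proof (induction bs arbitrary: m n c)
    case (Cons b bs)
    have half: "m div 2 < 2 ^ length bs" "n div 2 < 2 ^ length bs"
      using Cons.prems by auto
    have "m div 2 = n div 2 \<Longrightarrow> (odd m = odd n) = (m = n)" "m div 2 \<noteq> n div 2 \<Longrightarrow> (m < n) = (m div 2 < n div 2)"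
      "m div 2 = n div 2 \<Longrightarrow> odd m \<noteq> odd n \<Longrightarrow> (m < n) = odd n"
      by presburger+
    then show ?case using Cons.IH[OF half] by auto
  qed simp
  moreover have "m < 2 ^ length (bits m @ bits n)" "n < 2 ^ length (bits m @ bits n)" for m n
    using less_2_power_length_bits[of m] less_2_power_length_bits[of n]
    by (auto simp: power_add intro: less_le_trans)
  then have "snd (?r x) \<longleftrightarrow> (if f x = g x then True else f x < g x)" for x
    by (intro le)
  ultimately have "polytime a enc_bool (\<lambda>x. if f x = g x then True else f x < g x)"
    by (simp only:)
  moreover have "(\<lambda>x. if f x = g x then True else f x < g x) = (\<lambda>x. f x \<le> g x)" by auto
  ultimately show ?thesis by simp
qed

lemma polytime_less [polytime_intros]:
  assumes "polytime a enc_nat f" "polytime a enc_nat g"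
  shows "polytime a enc_bool (\<lambda>x. f x < g x)"
  using polytime_not[OF polytime_le[OF assms(2,1)]] by (simp add: not_le)

lemma polytime_length [polytime_intros]:
  assumes "polytime a (enc_list b) f"
  shows "polytime a enc_nat (\<lambda>x. length (f x))"
proof -
  have "polytime a enc_nat (\<lambda>x. fold (\<lambda>_ n. Suc n) (f x) 0)"
  proof (rule polytime_fold_linear[where K = 4])
    show "dsize (enc_nat (Suc n)) \<le> dsize (enc_nat n) + 4 * dsize (b y) + 4" for n y
      using dsize_enc_nat_Suc[of n] by linarith
  qed (rule assms polytime_intros)+
  moreover have "fold (\<lambda>_ n. Suc n) ys n = length ys + n" for ys :: "'b list" and n
    by (induction ys arbitrary: n) auto
  ultimately show ?thesis by simp
qed

text \<open>A counter that wraps around at \<open>k\<close> divides a length without arithmetic on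
  binary numbers. For \<open>k = 0\<close> it never wraps, which agrees with
  \<open>n div 0 = 0\<close> and \<open>n mod 0 = n\<close>.\<close>

lemma fold_div_mod:
  "fold (\<lambda>_ u. if Suc (fst u) = k then (0, Suc (snd u)) else (Suc (fst u), snd u)) xs (0, 0)
    = (length xs mod k, length xs div k)"
proof (induction xs rule: rev_induct)
  case (snoc x xs)
  then show ?case by (auto simp: mod_Suc div_Suc)
qed simp

lemma polytime_length_div_mod:
  assumes "polytime a (enc_list b) f" "polytime a enc_nat k"
  shows "polytime a (enc_prod enc_nat enc_nat) (\<lambda>x. (length (f x) mod k x, length (f x) div k x))"
  unfolding fold_div_mod[symmetric]
proof (rule polytime_fold_linear[where K = 8])
  fix k y and u :: "nat \<times> nat"
  show "dsize (enc_prod enc_nat enc_nat (if Suc (fst u) = k then (0, Suc (snd u)) else (Suc (fst u), snd u)))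
        \<le> dsize (enc_prod enc_nat enc_nat u) + 8 * dsize (b y) + 8"
    using dsize_enc_nat_Suc[of "fst u"] dsize_enc_nat_Suc[of "snd u"] dsize_pos[of "enc_nat (fst u)"]
    by (auto simp: enc_prod_eq)
qed (rule assms polytime_comp[OF assms(2)] polytime_intros)+

lemma polytime_length_mod [polytime_intros]:
  assumes "polytime a (enc_list b) f" "polytime a enc_nat k"
  shows "polytime a enc_nat (\<lambda>x. length (f x) mod k x)"
  using polytime_fst[OF polytime_length_div_mod[OF assms]] by simp

lemma polytime_length_div [polytime_intros]:
  assumes "polytime a (enc_list b) f" "polytime a enc_nat k"
  shows "polytime a enc_nat (\<lambda>x. length (f x) div k x)"
  using polytime_snd[OF polytime_length_div_mod[OF assms]] by simp

lemma polytime_enumerate [polytime_intros]: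
  assumes "polytime a (enc_list b) f"
  shows "polytime a (enc_list (enc_prod enc_nat b)) (\<lambda>x. List.enumerate 0 (f x))"
proof -
  \<comment> \<open>The guard holds throughout the actual run. It is there because the growth
    condition of the fold speaks about arbitrary accumulators, whose index could be huge.\<close>
  let ?step = "\<lambda>x y u. if fst u \<le> length (f x) then (Suc (fst u), (fst u, y) # snd u) else u"
  let ?c = "enc_prod enc_nat (enc_list (enc_prod enc_nat b))"
  obtain q where q: "\<And>x n. dsize (a x) \<le> n \<Longrightarrow> dsize (enc_list b (f x)) \<le> poly q n"
    using polytime_size[OF assms] by blast
  have r: "polytime a ?c (\<lambda>x. fold (?step x) (f x) (0, []))"
  proof (rule polytime_fold[OF assms])
    fix x y and u :: "nat \<times> (nat \<times> 'b) list"
    have "dsize (enc_nat (fst u)) \<le> 4 * poly q (dsize (a x) + dsize (b y)) + 1" if "fst u \<le> length (f x)"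
      using dsize_enc_nat_le[of "fst u"] that length_le_dsize[of "f x" b] q[of x "dsize (a x) + dsize (b y)"]
      by simp
    then show "dsize (?c (?step x y u)) \<le> dsize (?c u) + poly (4 * q + [:7, 1:]) (dsize (a x) + dsize (b y))"
      using dsize_enc_nat_Suc[of "fst u"] by (auto simp: enc_prod_eq)
  qed (rule polytime_comp[OF assms] polytime_intros)+
  have "polytime a (enc_list (enc_prod enc_nat b)) (\<lambda>x. rev (snd (fold (?step x) (f x) (0, []))))"
    by (rule r polytime_intros)+
  moreover have "rev (snd (fold (?step x) ys (i, us))) = rev us @ List.enumerate i ys"
    if "i + length ys \<le> length (f x)" for x i us and ys :: "'b list"
    using that by (induction ys arbitrary: i us) (auto simp: le_Suc_eq)
  ultimately show ?thesis by simp
qed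

section \<open>Integers as sign and absolute value\<close>

lemma polytime_int_sgn [polytime_intros]:
  "polytime a enc_int f \<Longrightarrow> polytime a enc_bool (\<lambda>x. f x < 0)"
  by (rule polytime_comp[OF polytime_Left]) (auto simp: enc_int_def)

lemma polytime_nat_abs [polytime_intros]:
  "polytime a enc_int f \<Longrightarrow> polytime a enc_nat (\<lambda>x. nat \<bar>f x\<bar>)"
  by (rule polytime_comp[OF polytime_Right]) (auto simp: enc_int_def)

lemma polytime_int_minus [polytime_intros]:
  assumes "polytime a enc_bool p" "polytime a enc_nat f"
  shows "polytime a enc_int (\<lambda>x. if p x then - int (f x) else int (f x))"
proof -
  have "polytime (enc_prod enc_bool enc_nat) (\<lambda>v. v) (\<lambda>z. Pair (enc_bool (fst z)) (enc_nat (snd z)))"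
    by (rule polytime_cast) (simp add: enc_prod_eq)
  \<comment> \<open>Zero has the sign bit of a nonnegative number, hence the test
    \<open>f x \<noteq> 0\<close>.\<close>
  moreover have "polytime a (enc_prod enc_bool enc_nat) (\<lambda>x. (p x \<and> f x \<noteq> 0, f x))"
    by (rule assms polytime_intros)+
  ultimately have "polytime a (\<lambda>v. v) (\<lambda>x. (\<lambda>z. Pair (enc_bool (fst z)) (enc_nat (snd z))) (p x \<and> f x \<noteq> 0, f x))"
    by (rule polytime_comp)
  then have "polytime a (\<lambda>v. v) (\<lambda>x. Pair (enc_bool (p x \<and> f x \<noteq> 0)) (enc_nat (f x)))"
    by (simp only: fst_conv snd_conv)
  moreover have "enc_int (if p x then - int (f x) else int (f x))
      = Pair (enc_bool (p x \<and> f x \<noteq> 0)) (enc_nat (f x))" for x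
    by (auto simp: enc_int_def)
  ultimately show ?thesis by (simp add: polytime_on_def)
qed

lemma eq_polytime_int [polytime_intros]: "eq_polytime enc_int"
proof -
  have "polytime (enc_prod enc_int enc_int) enc_bool
      (\<lambda>z. (fst z < 0) = (snd z < 0) \<and> nat \<bar>fst z\<bar> = nat \<bar>snd z\<bar>)"
    by (rule polytime_intros)+
  moreover have "((x < 0) = (y < 0) \<and> nat \<bar>x\<bar> = nat \<bar>y\<bar>) = (x = y)" for x y :: int
    by auto
  ultimately show ?thesis unfolding eq_polytime_def by simp
qed

subsection \<open>Transversals of regular bipartite multigraphs\<close>

text \<open>The induction of Halmos and Vaughan. If some nonempty proper subfamily is tight, it is
  matched on its own and the condition persists for the rest outside its neighbors. Otherwise every
  such subfamily has an element to spare, and any choice for one index can be made.\<close>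

lemma Hall_marriage:
  assumes "finite I" "\<And>i. i \<in> I \<Longrightarrow> finite (N i)"
    and "\<And>J. J \<subseteq> I \<Longrightarrow> card J \<le> card (\<Union>i\<in>J. N i)"
  shows "\<exists>f. inj_on f I \<and> (\<forall>i\<in>I. f i \<in> N i)"
  using assms
proof (induction I arbitrary: N rule: finite_psubset_induct)
  case (psubset I)
  note finN = psubset.prems(1) and hall = psubset.prems(2)
  consider "I = {}" | J where "J \<subset> I" "J \<noteq> {}" "card J = card (\<Union>i\<in>J. N i)"
    | "I \<noteq> {}" "\<And>J. J \<subset> I \<Longrightarrow> J \<noteq> {} \<Longrightarrow> card J \<noteq> card (\<Union>i\<in>J. N i)"
    by blast
  then show ?case
  proof cases
    case 1
    then show ?thesis by simp
  next
    case (2 J)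
    let ?NJ = "\<Union>i\<in>J. N i"
    have finJ: "finite J" using 2 psubset.hyps finite_subset by blast
    have finNJ: "finite ?NJ" using finJ finN 2 by blast
    have "\<exists>f. inj_on f J \<and> (\<forall>i\<in>J. f i \<in> N i)"
      by (rule psubset.IH[OF 2(1)]) (use 2(1) finN hall in auto)
    then obtain f where f: "inj_on f J" "\<forall>i\<in>J. f i \<in> N i" by blast
    have "\<exists>g. inj_on g (I - J) \<and> (\<forall>i\<in>I - J. g i \<in> N i - ?NJ)"
    proof (rule psubset.IH)
      show "I - J \<subset> I" using 2 by blast
      show "finite (N i - ?NJ)" if "i \<in> I - J" for i using finN that by auto
      show "card L \<le> card (\<Union>i\<in>L. N i - ?NJ)" if L: "L \<subseteq> I - J" for L
      proof -
        have finL: "finite L" using L psubset.hyps finite_subset by blast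
        have "card L + card J = card (L \<union> J)"
          using L finL finJ by (subst card_Un_disjoint) auto
        also have "\<dots> \<le> card (\<Union>i\<in>L \<union> J. N i)"
          using L 2 by (intro hall) auto
        also have "(\<Union>i\<in>L \<union> J. N i) = (\<Union>i\<in>L. N i - ?NJ) \<union> ?NJ" by auto
        also have "card \<dots> \<le> card (\<Union>i\<in>L. N i - ?NJ) + card ?NJ"
          by (rule card_Un_le)
        finally show ?thesis using 2 by simp
      qed
    qed
    then obtain g where g: "inj_on g (I - J)" "\<And>i. i \<in> I - J \<Longrightarrow> g i \<in> N i - ?NJ" by blast
    let ?h = "\<lambda>i. if i \<in> J then f i else g i"
    have "inj_on ?h I"
    proof (rule inj_onI)
      fix i j assume ij: "i \<in> I" "j \<in> I" "?h i = ?h j"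
      then show "i = j"
        using f g(2)[of i] g(2)[of j] inj_onD[OF f(1), of i j] inj_onD[OF g(1), of i j]
        by (auto split: if_splits)
    qed
    moreover have "\<forall>i\<in>I. ?h i \<in> N i" using f g(2) by auto
    ultimately show ?thesis by blast
  next
    case 3
    then obtain i where i: "i \<in> I" by blast
    have "card {i} \<le> card (\<Union>j\<in>{i}. N j)" using i by (intro hall) auto
    then obtain x where x: "x \<in> N i" by fastforce
    have "\<exists>g. inj_on g (I - {i}) \<and> (\<forall>j\<in>I - {i}. g j \<in> N j - {x})"
    proof (rule psubset.IH)
      show "I - {i} \<subset> I" using i by blast
      show "finite (N j - {x})" if "j \<in> I - {i}" for j using finN that by auto
      show "card L \<le> card (\<Union>j\<in>L. N j - {x})" if L: "L \<subseteq> I - {i}" for L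
      proof (cases "L = {}")
        case False
        have finL: "finite L" using L psubset.hyps finite_subset by blast
        have "card L < card (\<Union>j\<in>L. N j)"
        proof -
          have "L \<subset> I" using L i by auto
          then show ?thesis
            using hall[of L] 3(2)[of L] False by (simp add: le_neq_implies_less)
        qed
        moreover have "card (\<Union>j\<in>L. N j) \<le> card (\<Union>j\<in>L. N j - {x}) + card {x}"
          by (rule order_trans[OF card_mono card_Un_le]) (use L finL finN in auto)
        ultimately show ?thesis by simp
      qed simp
    qed
    then obtain g where g: "inj_on g (I - {i})" "\<And>j. j \<in> I - {i} \<Longrightarrow> g j \<in> N j - {x}" by blast
    have "inj_on (g(i := x)) I"
    proof (rule inj_onI)
      fix j l assume "j \<in> I" "l \<in> I" "(g(i := x)) j = (g(i := x)) l"
      then show "j = l"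
        using g(2)[of j] g(2)[of l] inj_onD[OF g(1), of j l] by (auto split: if_splits)
    qed
    moreover have "\<forall>j\<in>I. (g(i := x)) j \<in> N j" using g(2) x by auto
    ultimately show ?thesis by blast
  qed
qed

lemma card_fibres:
  assumes "finite P" "finite J" "\<And>j. j \<in> J \<Longrightarrow> card {u \<in> P. g u = j} = s"
  shows "card {u \<in> P. g u \<in> J} = card J * s"
proof -
  have "{u \<in> P. g u \<in> J} = (\<Union>j\<in>J. {u \<in> P. g u = j})" by auto
  also have "card \<dots> = (\<Sum>j\<in>J. card {u \<in> P. g u = j})"
    using assms(1,2) by (intro card_UN_disjoint) auto
  finally show ?thesis using assms(3) by simp
qed

text \<open>The elements of \<open>P\<close> are edges with ends \<open>r u\<close> and
  \<open>a u\<close>, and all degrees are \<open>s\<close>. The edges at \<open>J\<close> are among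
  the edges at its neighbors, so counting edges gives the condition of Hall; counting all edges
  shows that both sides are equally large.\<close>

lemma regular_perfect_matching:
  assumes "finite P" "finite I" "finite K" and ra: "r ` P \<subseteq> I" "a ` P \<subseteq> K"
    and "\<And>i. i \<in> I \<Longrightarrow> card {u \<in> P. r u = i} = s" "\<And>k. k \<in> K \<Longrightarrow> card {u \<in> P. a u = k} = s"
    and "s > 0"
  obtains S where "S \<subseteq> P" "bij_betw r S I" "bij_betw a S K"
proof -
  let ?N = "\<lambda>i. a ` {u \<in> P. r u = i}"
  have "\<exists>f. inj_on f I \<and> (\<forall>i\<in>I. f i \<in> ?N i)"
  proof (rule Hall_marriage)
    fix J assume J: "J \<subseteq> I"
    let ?M = "\<Union>i\<in>J. ?N i"
    have MK: "?M \<subseteq> K" using ra by auto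
    have "card J * s = card {u \<in> P. r u \<in> J}"
      using J assms by (intro card_fibres[symmetric]) (auto intro: finite_subset)
    also have "\<dots> \<le> card {u \<in> P. a u \<in> ?M}"
      using assms(1) by (intro card_mono) auto
    also have "\<dots> = card ?M * s"
      using MK assms by (intro card_fibres) (auto intro: finite_subset)
    finally show "card J \<le> card ?M" using \<open>s > 0\<close> by simp
  qed (use assms in auto)
  then obtain f where f: "inj_on f I" "\<And>i. i \<in> I \<Longrightarrow> f i \<in> ?N i" by blast
  have "{u \<in> P. r u \<in> I} = P" "{u \<in> P. a u \<in> K} = P" using ra by auto
  then have "card I * s = card K * s"
    using card_fibres[of P I r s] card_fibres[of P K a s] assms by simp
  then have "card I = card K" using \<open>s > 0\<close> by simp
  moreover have "f ` I \<subseteq> K" using f ra by auto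
  ultimately have fI: "f ` I = K"
    using f(1) \<open>finite K\<close> by (simp add: card_image card_subset_eq)
  have "\<forall>i\<in>I. \<exists>u. u \<in> P \<and> r u = i \<and> a u = f i" using f(2) by fastforce
  then obtain v where v: "\<And>i. i \<in> I \<Longrightarrow> v i \<in> P \<and> r (v i) = i \<and> a (v i) = f i" by metis
  show ?thesis
  proof
    show "v ` I \<subseteq> P" using v by auto
    show "bij_betw r (v ` I) I"
      using v by (auto simp: bij_betw_def inj_on_def image_image)
    have "inj_on a (v ` I)"
      using v f(1) by (auto simp: inj_on_def)
    moreover have "a ` v ` I = K" using v fI by (force simp: image_image)
    ultimately show "bij_betw a (v ` I) K" by (simp add: bij_betw_def)
  qed
qed

text \<open>A regular multigraph splits into perfect matchings, and the lightest of them weighs at most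
  the average.\<close>

lemma regular_light_matching:
  fixes w :: "'u \<Rightarrow> real"
  assumes "finite P" "finite I" "finite K" and "r ` P \<subseteq> I" "a ` P \<subseteq> K"
    and "\<And>i. i \<in> I \<Longrightarrow> card {u \<in> P. r u = i} = s" "\<And>k. k \<in> K \<Longrightarrow> card {u \<in> P. a u = k} = s"
    and "s > 0"
  shows "\<exists>S\<subseteq>P. bij_betw r S I \<and> bij_betw a S K \<and> real s * sum w S \<le> sum w P"
  using assms
proof (induction s arbitrary: P)
  case (Suc s)
  obtain S where S: "S \<subseteq> P" "bij_betw r S I" "bij_betw a S K"
    using regular_perfect_matching[OF Suc.prems] by blast
  have split: "sum w P = sum w S + sum w (P - S)"
    using Suc.prems(1) S(1) by (metis add.commute sum.subset_diff)
  \<comment> \<open>A perfect matching has exactly one edge at each vertex, so what remains is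
    regular of degree one less.\<close>
  have fib: "card {u \<in> P - S. g u = i} = s"
    if "bij_betw g S L" "i \<in> L" "card {u \<in> P. g u = i} = Suc s" for g :: "'u \<Rightarrow> 'v" and L i
  proof -
    have "i \<in> g ` S" using that by (simp add: bij_betw_def)
    then obtain u where u: "u \<in> S" "g u = i" by blast
    have "{v \<in> P - S. g v = i} = {v \<in> P. g v = i} - {u}"
      using u that(1) S(1) by (auto simp: bij_betw_def inj_on_def)
    moreover have "u \<in> {v \<in> P. g v = i}" using u S(1) by blast
    ultimately show ?thesis using that(3) by simp
  qed
  show ?case
  proof (cases "s = 0")
    case True
    have "P - S = {}"
    proof (rule ccontr)
      assume "P - S \<noteq> {}"
      then obtain u where u: "u \<in> P - S" by blast
      then have "card {v \<in> P - S. r v = r u} = 0"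
        using fib[OF S(2), of "r u"] Suc.prems True by blast
      then show False using u Suc.prems(1) by auto
    qed
    then show ?thesis using S True split by auto
  next
    case False
    have "\<exists>S'\<subseteq>P - S. bij_betw r S' I \<and> bij_betw a S' K \<and> real s * sum w S' \<le> sum w (P - S)"
    proof (rule Suc.IH)
      show "card {u \<in> P - S. r u = i} = s" if "i \<in> I" for i
        using fib[OF S(2) that] Suc.prems that by blast
      show "card {u \<in> P - S. a u = k} = s" if "k \<in> K" for k
        using fib[OF S(3) that] Suc.prems that by blast
    qed (use Suc.prems False in auto)
    then obtain S' where S': "S' \<subseteq> P - S" "bij_betw r S' I" "bij_betw a S' K"
      "real s * sum w S' \<le> sum w (P - S)" by blast
    show ?thesis
    proof (cases "sum w S \<le> sum w S'")
      case True
      then have "real s * sum w S \<le> real s * sum w S'" by (intro mult_left_mono) auto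
      then have "real (Suc s) * sum w S \<le> sum w P"
        using S'(4) split by (simp add: algebra_simps)
      then show ?thesis using S by blast
    next
      case False
      then have "real (Suc s) * sum w S' \<le> sum w P"
        using S'(4) split by (simp add: algebra_simps)
      then show ?thesis using S' by blast
    qed
  qed
qed simp

subsection \<open>The distances\<close>

definition pdist :: "nat \<Rightarrow> real list \<Rightarrow> int list \<Rightarrow> real" where
  "pdist p c x = lp_norm p (map2 (-) c (map real_of_int x))"

abbreviation real_point :: "int list \<Rightarrow> real list" where
  "real_point \<equiv> map real_of_int"

lemma pdist_0:
  assumes "length c = d" "length x = d"
  shows "pdist 0 c x = real (card {i. i < d \<and> c ! i \<noteq> real_of_int (x ! i)})"
proof -
  have "{i. i < length (map2 (-) c (map real_of_int x)) \<and> map2 (-) c (map real_of_int x) ! i \<noteq> 0}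
      = {i. i < d \<and> c ! i \<noteq> real_of_int (x ! i)}"
    using assms by auto
  then show ?thesis by (simp add: pdist_def lp_norm_def)
qed

lemma pdist_pos:
  assumes "length c = d" "length x = d" "p > 0"
  shows "pdist p c x = root p (\<Sum>i<d. \<bar>c ! i - real_of_int (x ! i)\<bar> ^ p)"
proof -
  have "(\<Sum>i<length (map2 (-) c (map real_of_int x)). \<bar>map2 (-) c (map real_of_int x) ! i\<bar> ^ p)
      = (\<Sum>i<d. \<bar>c ! i - real_of_int (x ! i)\<bar> ^ p)"
    using assms by (intro sum.cong) auto
  then show ?thesis using assms by (simp add: pdist_def lp_norm_def)
qed

lemma convex_on_power: "convex_on {0::real..} (\<lambda>x. x ^ p)"
  by (cases "even p") (auto intro: convex_power_odd convex_on_subset[OF convex_power_even])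

text \<open>After division by the norms \<open>a\<close> and \<open>b\<close> of the two families,
  this is convexity of the power function with weights \<open>a / (a + b)\<close> and
  \<open>b / (a + b)\<close>, summed over \<open>A\<close>.\<close>

lemma Minkowski_root:
  fixes f g :: "'i \<Rightarrow> real"
  assumes "p > 0" "finite A" and f: "\<And>i. i \<in> A \<Longrightarrow> 0 \<le> f i" and g: "\<And>i. i \<in> A \<Longrightarrow> 0 \<le> g i"
  shows "root p (\<Sum>i\<in>A. (f i + g i) ^ p) \<le> root p (\<Sum>i\<in>A. f i ^ p) + root p (\<Sum>i\<in>A. g i ^ p)"
proof -
  let ?F = "\<Sum>i\<in>A. f i ^ p" and ?G = "\<Sum>i\<in>A. g i ^ p"
  define a where "a = root p ?F"
  define b where "b = root p ?G"
  have F0: "0 \<le> ?F" and G0: "0 \<le> ?G" using f g by (auto intro!: sum_nonneg)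
  then have ab: "0 \<le> a" "0 \<le> b" and ap: "a ^ p = ?F" and bp: "b ^ p = ?G"
    using assms(1) by (auto simp: a_def b_def)
  show ?thesis
  proof (cases "a = 0 \<or> b = 0")
    case True
    then have "?F = 0 \<or> ?G = 0" using ap bp assms(1) by (metis zero_power)
    then have "(\<forall>i\<in>A. f i = 0) \<or> (\<forall>i\<in>A. g i = 0)"
      using assms by (auto simp: sum_nonneg_eq_0_iff)
    then show ?thesis
    proof
      assume "\<forall>i\<in>A. f i = 0"
      then show ?thesis using assms(1) by (simp cong: sum.cong)
    next
      assume "\<forall>i\<in>A. g i = 0"
      then show ?thesis using assms(1) by (simp cong: sum.cong)
    qed
  next
    case False
    with ab have pos: "a > 0" "b > 0" by auto
    let ?t = "b / (a + b)"
    have t: "0 \<le> ?t" "?t \<le> 1" "1 - ?t = a / (a + b)" using pos by (auto simp: field_simps)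
    have "(f i + g i) ^ p \<le> (a + b) ^ p * ((a / (a + b)) * (f i / a) ^ p + ?t * (g i / b) ^ p)"
      if "i \<in> A" for i
    proof -
      have "((1 - ?t) *\<^sub>R (f i / a) + ?t *\<^sub>R (g i / b)) ^ p \<le> (1 - ?t) * (f i / a) ^ p + ?t * (g i / b) ^ p"
        using f[OF that] g[OF that] pos t(1,2) by (intro convex_onD[OF convex_on_power]) auto
      moreover have "(1 - ?t) *\<^sub>R (f i / a) + ?t *\<^sub>R (g i / b) = (f i + g i) / (a + b)"
        unfolding t(3) using pos by (simp add: add_divide_distrib)
      ultimately have "((f i + g i) / (a + b)) ^ p \<le> (a / (a + b)) * (f i / a) ^ p + ?t * (g i / b) ^ p"
        using t(3) by simp
      then show ?thesis using pos by (simp add: power_divide field_simps)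
    qed
    then have "(\<Sum>i\<in>A. (f i + g i) ^ p)
        \<le> (\<Sum>i\<in>A. (a + b) ^ p * ((a / (a + b)) * (f i / a) ^ p + ?t * (g i / b) ^ p))"
      by (rule sum_mono)
    also have "\<dots> = (a + b) ^ p * ((a / (a + b)) * (?F / a ^ p) + ?t * (?G / b ^ p))"
      by (simp only: sum.distrib sum_distrib_left sum_divide_distrib power_divide distrib_left)
    also have "\<dots> = (a + b) ^ p"
      using pos ap[symmetric] bp[symmetric] by (simp add: add_divide_distrib[symmetric])
    finally have "root p (\<Sum>i\<in>A. (f i + g i) ^ p) \<le> root p ((a + b) ^ p)"
      using assms(1) by simp
    also have "\<dots> = a + b" using assms(1) pos by (simp add: real_root_power_cancel)
    finally show ?thesis by (simp add: a_def b_def)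
  qed
qed

lemma pdist_nonneg:
  assumes "length c = d" "length x = d"
  shows "0 \<le> pdist p c x"
proof (cases "p = 0")
  case True
  then show ?thesis using pdist_0[OF assms] by simp
next
  case False
  then show ?thesis using pdist_pos[OF assms, of p]
    by (auto intro!: real_root_ge_zero sum_nonneg)
qed

text \<open>\<open>pdist\<close> has a real and an integral argument, so there is no single triangle
  inequality. The coordinatewise hypothesis covers both forms that occur, the detour through a point
  and the one through a center.\<close>

lemma pdist_triangle_real:
  assumes "length c = d" "length x = d" "length y = d" "length c' = d"
    and "\<And>i. i < d \<Longrightarrow> \<bar>c' ! i - real_of_int (x ! i)\<bar>
      \<le> \<bar>u ! i - real_of_int (v ! i)\<bar> + \<bar>c ! i - real_of_int (y ! i)\<bar>"
    and "length u = d" "length v = d"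
  shows "pdist p c' x \<le> pdist p u v + pdist p c y"
proof (cases "p = 0")
  case True
  have "{i. i < d \<and> c' ! i \<noteq> real_of_int (x ! i)}
      \<subseteq> {i. i < d \<and> u ! i \<noteq> real_of_int (v ! i)} \<union> {i. i < d \<and> c ! i \<noteq> real_of_int (y ! i)}"
  proof safe
    fix i assume "i < d" "c' ! i \<noteq> real_of_int (x ! i)"
      "c ! i = real_of_int (y ! i)" "u ! i = real_of_int (v ! i)"
    then show False using assms(5)[of i] by simp
  qed
  then have "card {i. i < d \<and> c' ! i \<noteq> real_of_int (x ! i)}
      \<le> card {i. i < d \<and> u ! i \<noteq> real_of_int (v ! i)} + card {i. i < d \<and> c ! i \<noteq> real_of_int (y ! i)}"
    by (intro order_trans[OF card_mono card_Un_le]) auto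
  then show ?thesis
    using True assms by (simp add: pdist_0)
next
  case False
  then have p: "p > 0" by simp
  have "pdist p c' x \<le> root p (\<Sum>i<d. (\<bar>u ! i - real_of_int (v ! i)\<bar> + \<bar>c ! i - real_of_int (y ! i)\<bar>) ^ p)"
    using assms p by (subst pdist_pos[where d = d]) (auto intro!: sum_mono power_mono)
  also have "\<dots> \<le> pdist p u v + pdist p c y"
    using Minkowski_root[OF p, of "{..<d}" "\<lambda>i. \<bar>u ! i - real_of_int (v ! i)\<bar>" "\<lambda>i. \<bar>c ! i - real_of_int (y ! i)\<bar>"]
      assms p by (simp add: pdist_pos)
  finally show ?thesis .
qed

lemma pdist_self:
  assumes "length x = d"
  shows "pdist p (real_point x) x = 0"
proof (cases "p = 0")
  case True
  have "{i. i < d \<and> real_point x ! i \<noteq> real_of_int (x ! i)} = {}" using assms by auto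
  then show ?thesis using True assms by (simp only: pdist_0[of "real_point x" d x] length_map) simp
next
  case False
  then show ?thesis using assms by (simp add: pdist_pos[of _ d])
qed

lemma pdist_ge_1:
  assumes "length x = d" "length y = d" "x \<noteq> y"
  shows "1 \<le> pdist p (real_point x) y"
proof -
  obtain j where j: "j < d" "x ! j \<noteq> y ! j" using assms by (metis nth_equalityI)
  show ?thesis
  proof (cases "p = 0")
    case True
    have "card {j} \<le> card {i. i < d \<and> real_point x ! i \<noteq> real_of_int (y ! i)}"
      using j assms by (intro card_mono) auto
    then show ?thesis using True assms by (simp add: pdist_0[of _ d])
  next
    case False
    have "1 \<le> \<bar>x ! j - y ! j\<bar>" using j by simp
    then have "1 \<le> \<bar>real_point x ! j - real_of_int (y ! j)\<bar>" using j assms by simp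
    then have "1 \<le> \<bar>real_point x ! j - real_of_int (y ! j)\<bar> ^ p" by (rule one_le_power)
    also have "\<dots> \<le> (\<Sum>i<d. \<bar>real_point x ! i - real_of_int (y ! i)\<bar> ^ p)"
      using j by (intro member_le_sum) auto
    finally have "root p 1 \<le> root p (\<Sum>i<d. \<bar>real_point x ! i - real_of_int (y ! i)\<bar> ^ p)"
      using False by simp
    then show ?thesis using False assms by (simp add: pdist_pos[of _ d])
  qed
qed

subsection \<open>The cost of a cluster\<close>

text \<open>Centers are real and points integral vectors, so the axioms of a metric appear in mixed
  form; the instance is \<open>pdist p\<close>, with \<open>p = 0\<close> included. Integrality
  enters through \<open>D_ge_1\<close>. No minimizing center is assumed, and costs are handled as
  infima.\<close>

locale integral_metric =
  fixes D :: "'c \<Rightarrow> 'x \<Rightarrow> real" and centers :: "'c set" and points :: "'x set"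
    and emb :: "'x \<Rightarrow> 'c"
  assumes emb_center [simp]: "x \<in> points \<Longrightarrow> emb x \<in> centers"
    and centers_nonempty: "centers \<noteq> {}"
    and D_nonneg: "c \<in> centers \<Longrightarrow> x \<in> points \<Longrightarrow> 0 \<le> D c x"
    and D_triangle: "c \<in> centers \<Longrightarrow> x \<in> points \<Longrightarrow> y \<in> points \<Longrightarrow> D c x \<le> D c y + D (emb y) x"
    and D_triangle': "c \<in> centers \<Longrightarrow> x \<in> points \<Longrightarrow> y \<in> points \<Longrightarrow> D (emb x) y \<le> D c x + D c y"
    and D_self [simp]: "x \<in> points \<Longrightarrow> D (emb x) x = 0"
    and D_ge_1: "x \<in> points \<Longrightarrow> y \<in> points \<Longrightarrow> x \<noteq> y \<Longrightarrow> 1 \<le> D (emb x) y"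
begin

definition cost :: "('i \<Rightarrow> 'x) \<Rightarrow> 'i set \<Rightarrow> real" where
  "cost X A = (INF c\<in>centers. \<Sum>i\<in>A. D c (X i))"

context
  fixes X :: "'i \<Rightarrow> 'x" and A :: "'i set"
  assumes X: "X ` A \<subseteq> points"
begin

lemma point [simp]: "i \<in> A \<Longrightarrow> X i \<in> points"
  using X by auto

lemma cost_le:
  assumes "c \<in> centers"
  shows "cost X A \<le> (\<Sum>i\<in>A. D c (X i))"
  unfolding cost_def
  by (intro cINF_lower bdd_belowI2[where m = 0] assms) (auto intro!: sum_nonneg D_nonneg)

lemma cost_ge: "(\<And>c. c \<in> centers \<Longrightarrow> m \<le> (\<Sum>i\<in>A. D c (X i))) \<Longrightarrow> m \<le> cost X A"
  unfolding cost_def by (intro cINF_greatest centers_nonempty)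

lemma cost_nonneg: "0 \<le> cost X A"
  by (intro cost_ge sum_nonneg D_nonneg) auto

lemma cost_approx:
  assumes "cost X A < m"
  obtains c where "c \<in> centers" "(\<Sum>i\<in>A. D c (X i)) < m"
  using cost_ge[of m] assms by (meson not_le)

lemma D_le_cost:
  assumes "finite A" "i \<in> A" "j \<in> A"
  shows "D (emb (X i)) (X j) \<le> cost X A"
proof (cases "i = j")
  case True
  then show ?thesis using cost_nonneg assms by simp
next
  case False
  show ?thesis
  proof (rule cost_ge)
    fix c assume c: "c \<in> centers"
    have "D (emb (X i)) (X j) \<le> D c (X i) + D c (X j)"
      using c assms by (intro D_triangle') auto
    also have "\<dots> = (\<Sum>l\<in>{i, j}. D c (X l))" using False by simp
    also have "\<dots> \<le> (\<Sum>l\<in>A. D c (X l))"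
      using assms c by (intro sum_mono2) (auto intro: D_nonneg)
    finally show "D (emb (X i)) (X j) \<le> (\<Sum>l\<in>A. D c (X l))" .
  qed
qed

lemma cost_const:
  assumes "\<And>i. i \<in> A \<Longrightarrow> X i = y"
  shows "cost X A = 0"
proof (cases "A = {}")
  case True
  then show ?thesis using centers_nonempty by (simp add: cost_def)
next
  case False
  then have y: "y \<in> points" using assms X by auto
  then have "cost X A \<le> (\<Sum>i\<in>A. D (emb y) (X i))" by (intro cost_le) simp
  also have "\<dots> = 0" using assms y by (intro sum.neutral) simp
  finally show ?thesis using cost_nonneg by simp
qed

lemma sum_if_split:
  fixes g :: "'i \<Rightarrow> real"
  assumes "finite A"
  shows "(\<Sum>i\<in>A. if X i = y then b else g i)
    = real (card {i \<in> A. X i = y}) * b + (\<Sum>i | i \<in> A \<and> X i \<noteq> y. g i)"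
proof -
  have "A \<inter> - {i. X i = y} = {i. i \<in> A \<and> X i \<noteq> y}" "A \<inter> {i. X i = y} = {i \<in> A. X i = y}" by auto
  then show ?thesis using assms by (simp add: sum.If_cases)
qed

lemma card_split:
  assumes "finite A"
  shows "card {i. i \<in> A \<and> X i \<noteq> y} + card {i \<in> A. X i = y} = card A"
proof -
  have "A = {i. i \<in> A \<and> X i \<noteq> y} \<union> {i \<in> A. X i = y}" by auto
  then show ?thesis using assms
    by (metis (no_types, lifting) Collect_disj_eq card_Un_disjoint disjoint_iff finite_Un mem_Collect_eq)
qed

text \<open>Against the center \<open>y\<close>, another center \<open>c\<close> pays
  \<open>D c y\<close> at each copy of \<open>y\<close> and by the triangle inequality saves at most
  that much at each other point. The copies are at least as many as the others.\<close>

lemma cost_majority: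
  assumes "finite A" "y \<in> points" "card A \<le> 2 * card {i \<in> A. X i = y}"
  shows "cost X A = (\<Sum>i\<in>A. D (emb y) (X i))"
proof (rule antisym)
  show "cost X A \<le> (\<Sum>i\<in>A. D (emb y) (X i))" using assms by (intro cost_le) simp
  show "(\<Sum>i\<in>A. D (emb y) (X i)) \<le> cost X A"
  proof (rule cost_ge)
    fix c assume c: "c \<in> centers"
    let ?N = "{i. i \<in> A \<and> X i \<noteq> y}"
    have "(\<Sum>i\<in>A. D (emb y) (X i)) = (\<Sum>i\<in>A. if X i = y then 0 else D (emb y) (X i))"
      using assms by (intro sum.cong) auto
    also have "\<dots> = (\<Sum>i\<in>?N. D (emb y) (X i))"
      using assms by (subst sum_if_split) auto
    also have "\<dots> \<le> (\<Sum>i\<in>?N. D c y + D c (X i))"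
      using assms c by (intro sum_mono D_triangle') auto
    also have "\<dots> = card ?N * D c y + (\<Sum>i\<in>?N. D c (X i))"
      by (simp add: sum.distrib)
    also have "real (card ?N) * D c y \<le> card {i \<in> A. X i = y} * D c y"
      using card_split[OF assms(1), of y] assms c by (intro mult_right_mono D_nonneg) auto
    also have "real (card {i \<in> A. X i = y}) * D c y + (\<Sum>i\<in>?N. D c (X i))
        = (\<Sum>i\<in>A. if X i = y then D c y else D c (X i))"
      using assms by (simp add: sum_if_split)
    also have "\<dots> = (\<Sum>i\<in>A. D c (X i))" by (intro sum.cong) auto
    finally show "(\<Sum>i\<in>A. D (emb y) (X i)) \<le> (\<Sum>i\<in>A. D c (X i))" by simp
  qed
qed

lemma cost_majority_ge:
  assumes "finite A" "y \<in> points" "card A \<le> 2 * card {i \<in> A. X i = y}"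
  shows "real (card A) \<le> card {i \<in> A. X i = y} + cost X A"
proof -
  let ?N = "{i. i \<in> A \<and> X i \<noteq> y}"
  have "real (card ?N) = (\<Sum>i\<in>?N. 1)" by simp
  also have "\<dots> \<le> (\<Sum>i\<in>?N. D (emb y) (X i))"
    using assms by (intro sum_mono D_ge_1) auto
  also have "\<dots> \<le> (\<Sum>i\<in>A. D (emb y) (X i))"
    using assms by (intro sum_mono2) (auto intro: D_nonneg)
  also have "\<dots> = cost X A" using cost_majority[OF assms] by simp
  finally show ?thesis using card_split[OF assms(1), of y] by linarith
qed

text \<open>At most one point lies within distance \<open>1/2\<close> of a given center.\<close>

lemma cost_less_majority:
  assumes "finite A" "2 * cost X A < card A"
  obtains y where "y \<in> points" "card A < 2 * card {i \<in> A. X i = y}"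
proof -
  obtain c where c: "c \<in> centers" "(\<Sum>i\<in>A. D c (X i)) < card A / 2"
    using cost_approx[of "card A / 2"] assms by auto
  have "\<exists>i\<in>A. D c (X i) < 1 / 2"
  proof (rule ccontr)
    assume "\<not> ?thesis"
    then have "(\<Sum>i\<in>A. 1 / 2) \<le> (\<Sum>i\<in>A. D c (X i))" by (intro sum_mono) auto
    then show False using c by simp
  qed
  then obtain j where j: "j \<in> A" "D c (X j) < 1 / 2" by blast
  let ?y = "X j" and ?e = "D c (X j)" and ?a = "real (card {i \<in> A. X i = X j})"
  have "card A < 2 * card {i \<in> A. X i = ?y}"
  proof (rule ccontr)
    assume *: "\<not> ?thesis"
    have "?a * ?e + (real (card A) - ?a) * (1 - ?e) = (\<Sum>i\<in>A. if X i = ?y then ?e else 1 - ?e)"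
      using card_split[OF assms(1), of ?y] assms(1) by (simp add: sum_if_split)
    also have "\<dots> \<le> (\<Sum>i\<in>A. D c (X i))"
    proof (rule sum_mono)
      fix i assume i: "i \<in> A"
      have "1 \<le> D c ?y + D c (X i)" if "X i \<noteq> ?y"
        using D_ge_1[of ?y "X i"] D_triangle'[of c ?y "X i"] c i j that by force
      then show "(if X i = ?y then ?e else 1 - ?e) \<le> D c (X i)" by auto
    qed
    finally have 1: "?a * ?e + (real (card A) - ?a) * (1 - ?e) < card A / 2" using c by simp
    \<comment> \<open>The lower bound just obtained is \<open>card A / 2\<close> plus this
      product.\<close>
    have "0 \<le> (real (card A) - 2 * ?a) * (1 / 2 - ?e)"
      using * j by (intro mult_nonneg_nonneg) auto
    then show False using 1 by (simp add: algebra_simps)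
  qed
  then show ?thesis using that[of ?y] j by simp
qed

text \<open>One representative per value suffices. If all are at distance at least 1/2 from the
  center, the bound is clear. If one has distance \<open>e < 1/2\<close>, the others have at least
  \<open>1 - e\<close>, and since there are at least two values this makes up for the loss.\<close>

lemma card_values_le:
  assumes "finite A" "i \<in> A" "j \<in> A" "X i \<noteq> X j"
  shows "card (X ` A) \<le> 2 * cost X A"
proof -
  obtain R where R: "R \<subseteq> A" "inj_on X R" "X ` R = X ` A"
    by (metis subset_image_inj order_refl)
  have finR: "finite R" using R assms finite_subset by blast
  let ?t = "card R"
  have t: "?t = card (X ` A)" using R by (metis card_image)
  have "card {X i, X j} \<le> card (X ` A)" using assms by (intro card_mono) auto
  then have t2: "2 \<le> ?t" using assms t by simp
  have "?t / 2 \<le> cost X A"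
  proof (rule cost_ge)
    fix c assume c: "c \<in> centers"
    have "?t / 2 \<le> (\<Sum>l\<in>R. D c (X l))"
    proof (cases "\<exists>l\<in>R. D c (X l) < 1 / 2")
      case False
      then have "(\<Sum>l\<in>R. 1 / 2) \<le> (\<Sum>l\<in>R. D c (X l))" by (intro sum_mono) auto
      then show ?thesis by simp
    next
      case True
      then obtain l where l: "l \<in> R" "D c (X l) < 1 / 2" by blast
      let ?e = "D c (X l)"
      have "(\<Sum>m\<in>R - {l}. 1 - ?e) \<le> (\<Sum>m\<in>R - {l}. D c (X m))"
      proof (rule sum_mono)
        fix m assume m: "m \<in> R - {l}"
        then have "X m \<noteq> X l" using R(2) l by (auto simp: inj_on_def)
        then show "1 - ?e \<le> D c (X m)"
          using D_ge_1[of "X l" "X m"] D_triangle'[of c "X l" "X m"] c R m l by force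
      qed
      then have 1: "(real ?t - 1) * (1 - ?e) + ?e \<le> (\<Sum>m\<in>R. D c (X m))"
        using l finR t2 by (simp add: sum.remove[OF finR l(1)] of_nat_diff)
      have "0 \<le> (real ?t - 2) * (1 / 2 - ?e)"
        using t2 l by (intro mult_nonneg_nonneg) auto
      then show ?thesis using 1 by (simp add: algebra_simps)
    qed
    also have "\<dots> \<le> (\<Sum>l\<in>A. D c (X l))"
      using R assms c by (intro sum_mono2) (auto intro!: D_nonneg)
    finally show "?t / 2 \<le> (\<Sum>l\<in>A. D c (X l))" .
  qed
  then show ?thesis using t by simp
qed

end

end

lemma integral_metric_pdist:
  "integral_metric (pdist p) {c. length c = d} {x. length x = d} real_point"
proof
  show "{c :: real list. length c = d} \<noteq> {}" using Ex_list_of_length by auto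
next
  fix c :: "real list" and x y :: "int list"
  assume cxy: "c \<in> {c. length c = d}" "x \<in> {x. length x = d}" "y \<in> {x. length x = d}"
  show "pdist p c x \<le> pdist p c y + pdist p (real_point y) x"
    by (rule pdist_triangle_real[where d = d]) (use cxy in auto)
  show "pdist p (real_point x) y \<le> pdist p c x + pdist p c y"
    by (rule pdist_triangle_real[where d = d]) (use cxy in auto)
qed (auto intro: pdist_nonneg pdist_self pdist_ge_1)

subsection \<open>Splitting off uniform clusters\<close>

text \<open>Elements outside the clusters of \<open>J\<close> get weight 0, so the lightest matching
  pays for \<open>J\<close> only. \<open>M j\<close> is the cluster given up for the uniform cluster
  \<open>j\<close>; the common element of the two is what later improves the factor 2.\<close>

lemma light_representatives:
  fixes v :: "'i \<Rightarrow> 'k \<Rightarrow> real"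
  assumes "finite P" "finite I" "finite K" and "r ` P \<subseteq> I" "a ` P \<subseteq> K"
    and "\<And>i. i \<in> I \<Longrightarrow> card {u \<in> P. r u = i} = s" "\<And>k. k \<in> K \<Longrightarrow> card {u \<in> P. a u = k} = s"
    and "s > 0" "J \<subseteq> I"
  obtains M where "inj_on M J" "M ` J \<subseteq> K" "\<And>j. j \<in> J \<Longrightarrow> \<exists>u\<in>P. r u = j \<and> a u = M j"
    "real s * (\<Sum>j\<in>J. v j (M j)) \<le> (\<Sum>u | u \<in> P \<and> r u \<in> J. v (r u) (a u))"
proof -
  let ?w = "\<lambda>u. if r u \<in> J then v (r u) (a u) else 0"
  obtain S where S: "S \<subseteq> P" "bij_betw r S I" "bij_betw a S K" "real s * sum ?w S \<le> sum ?w P"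
    using regular_light_matching[OF assms(1-8), of ?w] by blast
  define g where "g = the_inv_into S r"
  have g: "g j \<in> S" "r (g j) = j" if "j \<in> I" for j
    using that S(2) the_inv_into_into[of r S j S] f_the_inv_into_f[of r S j]
    by (auto simp: g_def bij_betw_def)
  have inj_g: "inj_on g J" by (rule inj_on_inverseI[of _ r]) (use g(2) assms(9) in auto)
  have gJ: "g ` J = {u \<in> S. r u \<in> J}"
  proof safe
    fix u assume u: "u \<in> S" "r u \<in> J"
    then have "g (r u) = u"
      using S(2) by (simp add: g_def bij_betw_def the_inv_into_f_f)
    then show "u \<in> g ` J" using u(2) by (metis imageI)
  qed (use g assms(9) in auto)
  have finS: "finite S" using S(1) assms(1) finite_subset by blast
  show ?thesis
  proof (rule that[of "a \<circ> g"])
    have "g ` J \<subseteq> S" using gJ by auto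
    then show "inj_on (a \<circ> g) J"
      by (intro comp_inj_on inj_g inj_on_subset[OF bij_betw_imp_inj_on[OF S(3)]])
    have "g ` J \<subseteq> P" using gJ S(1) by auto
    then show "(a \<circ> g) ` J \<subseteq> K" unfolding image_comp[symmetric] using assms(5) by blast
    show "\<exists>u\<in>P. r u = j \<and> a u = (a \<circ> g) j" if "j \<in> J" for j
      using g[of j] S(1) assms(9) that by auto
    have "(\<Sum>j\<in>J. v j ((a \<circ> g) j)) = (\<Sum>j\<in>J. ?w (g j))"
      using g(2) assms(9) by (intro sum.cong) auto
    also have "\<dots> = sum ?w (g ` J)" using inj_g by (simp add: sum.reindex)
    also have "\<dots> = sum ?w S" using gJ finS by (intro sum.mono_neutral_left) auto
    finally have "real s * (\<Sum>j\<in>J. v j ((a \<circ> g) j)) \<le> sum ?w P" using S(4) by simp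
    also have "\<dots> = (\<Sum>u | u \<in> P \<and> r u \<in> J. v (r u) (a u))"
      using assms(1) by (simp add: sum.inter_filter)
    finally show "real s * (\<Sum>j\<in>J. v j ((a \<circ> g) j)) \<le> (\<Sum>u | u \<in> P \<and> r u \<in> J. v (r u) (a u))" .
  qed
qed

context integral_metric
begin

text \<open>The points of \<open>R\<close>, all equal to \<open>x\<close>, move into the cluster \<open>k\<close>, and the points displaced
  from \<open>k\<close> take the places that became free; their detour leads through \<open>x\<close>.\<close>

lemma settle:
  assumes "finite P" and X: "X ` P \<subseteq> points" and c: "c ` K \<subseteq> centers" and a: "a ` P \<subseteq> K"
    and fib: "\<And>k. k \<in> K \<Longrightarrow> card {u \<in> P. a u = k} = s" and k: "k \<in> K"
    and R: "R \<subseteq> P" "card R = s" "\<And>u. u \<in> R \<Longrightarrow> X u = x" and x: "x \<in> points"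
  shows "\<exists>a'. a' ` (P - R) \<subseteq> K - {k} \<and> (\<forall>l\<in>K - {k}. card {u \<in> P - R. a' u = l} = s)
    \<and> (\<forall>u\<in>P - R. a u \<noteq> k \<longrightarrow> a' u = a u)
    \<and> (\<Sum>u\<in>P - R. D (c (a' u)) (X u)) \<le> (\<Sum>u\<in>P. D (c (a u)) (X u))
        + (real s - 2 * real (card {u \<in> R. a u = k})) * D (c k) x"
proof -
  let ?A = "{u \<in> P. a u = k}"
  have finR: "finite R" using R(1) assms(1) finite_subset by blast
  have cards: "card (?A - R) = s - card {u \<in> R. a u = k}" "card (R - ?A) = s - card {u \<in> R. a u = k}"
  proof -
    have "?A \<inter> R = {u \<in> R. a u = k}" "R \<inter> ?A = {u \<in> R. a u = k}" using R(1) by auto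
    then show "card (?A - R) = s - card {u \<in> R. a u = k}" "card (R - ?A) = s - card {u \<in> R. a u = k}"
      using card_Diff_subset_Int[of ?A R] card_Diff_subset_Int[of R ?A] fib[OF k] R(2) finR assms(1)
      by simp_all
  qed
  then have "card (?A - R) = card (R - ?A)" by simp
  \<comment> \<open>Points of \<open>k\<close> outside \<open>R\<close> and points of
    \<open>R\<close> outside \<open>k\<close> are equally many; \<open>h\<close> sends a displaced
    point to the point of \<open>R\<close> whose place it takes over.\<close>
  then obtain h where h: "bij_betw h (?A - R) (R - ?A)"
    using finite_same_card_bij[of "?A - R" "R - ?A"] finR assms(1) by auto
  then have hR: "h u \<in> R" "h u \<in> P" "a (h u) \<noteq> k" if "u \<in> ?A - R" for u
    using bij_betwE[OF h] that R(1) by auto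
  define a' where "a' = (\<lambda>u. if u \<in> ?A then a (h u) else a u)"
  have 1: "a' ` (P - R) \<subseteq> K - {k}"
    using hR a R(1) by (auto simp: a'_def)
  have 2: "card {u \<in> P - R. a' u = l} = s" if l: "l \<in> K - {k}" for l
  proof -
    let ?B = "{u \<in> P - R. a u = l}" and ?C = "{u \<in> ?A - R. a (h u) = l}"
    have "{u \<in> P - R. a' u = l} = ?B \<union> ?C" using l by (auto simp: a'_def)
    moreover have "?B \<inter> ?C = {}" using l by auto
    ultimately have "card {u \<in> P - R. a' u = l} = card ?B + card ?C"
      using assms(1) by (simp add: card_Un_disjoint)
    also have "bij_betw h ?C {u \<in> R. a u = l}"
    proof -
      have "h ` ?C = {u \<in> R. a u = l}"
      proof (intro equalityI subsetI)
        fix v assume "v \<in> h ` ?C"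
        then show "v \<in> {u \<in> R. a u = l}" using hR by auto
      next
        fix v assume v: "v \<in> {u \<in> R. a u = l}"
        then have "v \<in> h ` (?A - R)" using bij_betw_imp_surj_on[OF h] l by auto
        then show "v \<in> h ` ?C" using v by blast
      qed
      moreover have "inj_on h ?C"
        using bij_betw_imp_inj_on[OF h] by (rule inj_on_subset) auto
      ultimately show ?thesis by (simp add: bij_betw_def)
    qed
    then have "card ?C = card {u \<in> R. a u = l}" by (rule bij_betw_same_card)
    also have "card ?B + card {u \<in> R. a u = l} = card (?B \<union> {u \<in> R. a u = l})"
      using assms(1) finR by (intro card_Un_disjoint[symmetric]) auto
    also have "?B \<union> {u \<in> R. a u = l} = {u \<in> P. a u = l}" using R(1) by auto
    finally show ?thesis using fib l by simp
  qed
  have 3: "\<forall>u\<in>P - R. a u \<noteq> k \<longrightarrow> a' u = a u" by (simp add: a'_def)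
  let ?f = "\<lambda>u. D (c (a u)) (X u)" and ?d = "D (c k) x" and ?m = "card {u \<in> R. a u = k}"
  have "(\<Sum>u\<in>P - R. D (c (a' u)) (X u))
      = (\<Sum>u\<in>P - R - ?A. D (c (a' u)) (X u)) + (\<Sum>u\<in>?A - R. D (c (a' u)) (X u))"
  proof -
    have "P - R = (P - R - ?A) \<union> (?A - R)" by auto
    then have "(\<Sum>u\<in>P - R. D (c (a' u)) (X u)) = (\<Sum>u\<in>(P - R - ?A) \<union> (?A - R). D (c (a' u)) (X u))"
      by simp
    also have "\<dots> = (\<Sum>u\<in>P - R - ?A. D (c (a' u)) (X u)) + (\<Sum>u\<in>?A - R. D (c (a' u)) (X u))"
      using assms(1) by (intro sum.union_disjoint) auto
    finally show ?thesis .
  qed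
  also have "(\<Sum>u\<in>P - R - ?A. D (c (a' u)) (X u)) = (\<Sum>u\<in>P - R - ?A. ?f u)"
    by (intro sum.cong) (auto simp: a'_def)
  also have "(\<Sum>u\<in>?A - R. D (c (a' u)) (X u)) \<le> (\<Sum>u\<in>?A - R. ?f (h u) + (?d + ?f u))"
  proof (rule sum_mono)
    fix u assume u: "u \<in> ?A - R"
    have in_c: "c (a (h u)) \<in> centers" "c k \<in> centers" and Xu: "X u \<in> points"
      using hR[OF u] u a c k X by auto
    have "D (c (a (h u))) (X u) \<le> D (c (a (h u))) x + D (emb x) (X u)"
      using in_c Xu x by (intro D_triangle) auto
    also have "D (emb x) (X u) \<le> ?d + D (c k) (X u)"
      using in_c Xu x by (intro D_triangle') auto
    finally show "D (c (a' u)) (X u) \<le> ?f (h u) + (?d + ?f u)"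
      using u hR[OF u] R(3) by (simp add: a'_def)
  qed
  also have "\<dots> = (\<Sum>u\<in>R - ?A. ?f u) + (card (?A - R) * ?d + (\<Sum>u\<in>?A - R. ?f u))"
    using sum.reindex_bij_betw[OF h, of ?f] by (simp add: sum.distrib)
  also have "(\<Sum>u\<in>P. ?f u) = (\<Sum>u\<in>P - R - ?A. ?f u) + ((\<Sum>u\<in>?A - R. ?f u) + ((\<Sum>u\<in>R - ?A. ?f u) + (\<Sum>u | u \<in> R \<and> a u = k. ?f u)))"
  proof -
    have "P = (P - R - ?A) \<union> ((?A - R) \<union> ((R - ?A) \<union> {u. u \<in> R \<and> a u = k}))" using R(1) by auto
    then have "(\<Sum>u\<in>P. ?f u) = (\<Sum>u\<in>(P - R - ?A) \<union> ((?A - R) \<union> ((R - ?A) \<union> {u. u \<in> R \<and> a u = k})). ?f u)"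
      by simp
    also have "\<dots> = (\<Sum>u\<in>P - R - ?A. ?f u) + (\<Sum>u\<in>(?A - R) \<union> ((R - ?A) \<union> {u. u \<in> R \<and> a u = k}). ?f u)"
      using assms(1) finR by (intro sum.union_disjoint) auto
    also have "(\<Sum>u\<in>(?A - R) \<union> ((R - ?A) \<union> {u. u \<in> R \<and> a u = k}). ?f u)
        = (\<Sum>u\<in>?A - R. ?f u) + (\<Sum>u\<in>(R - ?A) \<union> {u. u \<in> R \<and> a u = k}. ?f u)"
      using assms(1) finR by (intro sum.union_disjoint) auto
    also have "(\<Sum>u\<in>(R - ?A) \<union> {u. u \<in> R \<and> a u = k}. ?f u) = (\<Sum>u\<in>R - ?A. ?f u) + (\<Sum>u | u \<in> R \<and> a u = k. ?f u)"
      using assms(1) finR R(1) by (intro sum.union_disjoint) auto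
    finally show ?thesis .
  qed
  moreover have "(\<Sum>u | u \<in> R \<and> a u = k. ?f u) = ?m * ?d"
    using R(3) by simp
  moreover have "real (card (?A - R)) = real s - ?m"
  proof -
    have "?m \<le> card R" using finR by (intro card_mono) auto
    then show ?thesis using cards R(2) by simp
  qed
  \<comment> \<open>With \<open>m\<close> points of \<open>R\<close> already in \<open>k\<close>,
    the \<open>s - m\<close> displaced points pay \<open>?d\<close> once more, while these
    \<open>m\<close> points no longer pay it.\<close>
  ultimately have 4: "(\<Sum>u\<in>P - R. D (c (a' u)) (X u)) \<le> (\<Sum>u\<in>P. ?f u) + (real s - 2 * real ?m) * ?d"
    by (simp add: algebra_simps)
  show ?thesis using 1 2 3 4 by blast
qed

text \<open>The uniform clusters are settled one after the other. A point keeps its cluster until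
  that cluster is given up, so the points of a later \<open>j\<close> that lie in \<open>M j\<close>
  are still there when its turn comes, and the saving of \<open>settle\<close> is not lost.\<close>

lemma settle_all:
  assumes "finite P" and X: "X ` P \<subseteq> points" and c: "c ` K \<subseteq> centers" and a: "a ` P \<subseteq> K"
    and fib: "\<And>k. k \<in> K \<Longrightarrow> card {u \<in> P. a u = k} = s"
    and "finite J" "inj_on M J" "M ` J \<subseteq> K"
    and "\<And>j. j \<in> J \<Longrightarrow> card {u \<in> P. r u = j} = s"
    and "\<And>u. u \<in> P \<Longrightarrow> r u \<in> J \<Longrightarrow> X u = x (r u)" and "x ` J \<subseteq> points"
  shows "\<exists>a'. a' ` {u \<in> P. r u \<notin> J} \<subseteq> K - M ` J
    \<and> (\<forall>l\<in>K - M ` J. card {u \<in> P. r u \<notin> J \<and> a' u = l} = s)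
    \<and> (\<forall>u\<in>P. r u \<notin> J \<longrightarrow> a u \<notin> M ` J \<longrightarrow> a' u = a u)
    \<and> (\<Sum>u | u \<in> P \<and> r u \<notin> J. D (c (a' u)) (X u)) \<le> (\<Sum>u\<in>P. D (c (a u)) (X u))
        + (\<Sum>j\<in>J. (real s - 2 * real (card {u \<in> P. r u = j \<and> a u = M j})) * D (c (M j)) (x j))"
  using assms(6-)
proof (induction J)
  case empty
  then show ?case using a fib by (intro exI[of _ a]) auto
next
  case (insert j J)
  let ?P = "{u \<in> P. r u \<notin> J}" and ?K = "K - M ` J" and ?R = "{u \<in> P. r u = j}"
  obtain b where b: "b ` ?P \<subseteq> ?K" "\<And>l. l \<in> ?K \<Longrightarrow> card {u \<in> ?P. b u = l} = s"
    "\<And>u. u \<in> P \<Longrightarrow> r u \<notin> J \<Longrightarrow> a u \<notin> M ` J \<Longrightarrow> b u = a u"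
    "(\<Sum>u\<in>?P. D (c (b u)) (X u)) \<le> (\<Sum>u\<in>P. D (c (a u)) (X u))
        + (\<Sum>j\<in>J. (real s - 2 * real (card {u \<in> P. r u = j \<and> a u = M j})) * D (c (M j)) (x j))"
  proof -
    have "inj_on M J" "M ` J \<subseteq> K" "x ` J \<subseteq> points"
      "\<And>j. j \<in> J \<Longrightarrow> card {u \<in> P. r u = j} = s" "\<And>u. u \<in> P \<Longrightarrow> r u \<in> J \<Longrightarrow> X u = x (r u)"
      using insert.prems by auto
    note facts = this
    have eq: "{u \<in> ?P. b u = l} = {u \<in> P. r u \<notin> J \<and> b u = l}" for b l
      by auto
    have "\<exists>a'. a' ` ?P \<subseteq> ?K \<and> (\<forall>l\<in>?K. card {u \<in> ?P. a' u = l} = s)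
      \<and> (\<forall>u\<in>P. r u \<notin> J \<longrightarrow> a u \<notin> M ` J \<longrightarrow> a' u = a u)
      \<and> (\<Sum>u\<in>?P. D (c (a' u)) (X u)) \<le> (\<Sum>u\<in>P. D (c (a u)) (X u))
        + (\<Sum>j\<in>J. (real s - 2 * real (card {u \<in> P. r u = j \<and> a u = M j})) * D (c (M j)) (x j))"
      unfolding eq by (rule insert.IH) (fact facts | rule facts, assumption+)+
    then show thesis by (elim exE conjE) (rule that, blast+)
  qed
  have Mj: "M j \<in> ?K" using insert by auto
  have xj: "x j \<in> points" using insert.prems by auto
  have "\<exists>a'. a' ` (?P - ?R) \<subseteq> ?K - {M j} \<and> (\<forall>l\<in>?K - {M j}. card {u \<in> ?P - ?R. a' u = l} = s)
    \<and> (\<forall>u\<in>?P - ?R. b u \<noteq> M j \<longrightarrow> a' u = b u)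
    \<and> (\<Sum>u\<in>?P - ?R. D (c (a' u)) (X u)) \<le> (\<Sum>u\<in>?P. D (c (b u)) (X u))
        + (real s - 2 * real (card {u \<in> ?R. b u = M j})) * D (c (M j)) (x j)"
    by (rule settle) (use b Mj xj insert.prems insert.hyps assms(1) X c in auto)
  then obtain a' where a': "a' ` (?P - ?R) \<subseteq> ?K - {M j}"
    "\<And>l. l \<in> ?K - {M j} \<Longrightarrow> card {u \<in> ?P - ?R. a' u = l} = s"
    "\<And>u. u \<in> ?P - ?R \<Longrightarrow> b u \<noteq> M j \<Longrightarrow> a' u = b u"
    "(\<Sum>u\<in>?P - ?R. D (c (a' u)) (X u)) \<le> (\<Sum>u\<in>?P. D (c (b u)) (X u))
        + (real s - 2 * real (card {u \<in> ?R. b u = M j})) * D (c (M j)) (x j)" by blast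
  have eq: "?P - ?R = {u \<in> P. r u \<notin> insert j J}" "?K - {M j} = K - M ` insert j J" by auto
  have "{u \<in> P. r u = j \<and> a u = M j} \<subseteq> {u \<in> ?R. b u = M j}"
    using b(3) Mj insert.hyps by auto
  then have "card {u \<in> P. r u = j \<and> a u = M j} \<le> card {u \<in> ?R. b u = M j}"
    using assms(1) by (intro card_mono) auto
  moreover have "0 \<le> D (c (M j)) (x j)" using Mj c xj by (intro D_nonneg) auto
  ultimately have "(real s - 2 * real (card {u \<in> ?R. b u = M j})) * D (c (M j)) (x j)
      \<le> (real s - 2 * real (card {u \<in> P. r u = j \<and> a u = M j})) * D (c (M j)) (x j)"
    by (intro mult_right_mono) auto
  then have "(\<Sum>u | u \<in> P \<and> r u \<notin> insert j J. D (c (a' u)) (X u)) \<le> (\<Sum>u\<in>P. D (c (a u)) (X u))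
        + (\<Sum>j\<in>insert j J. (real s - 2 * real (card {u \<in> P. r u = j \<and> a u = M j})) * D (c (M j)) (x j))"
    using a'(4) b(4) insert.hyps unfolding eq by simp
  moreover have "{u \<in> ?P - ?R. a' u = l} = {u \<in> P. r u \<notin> insert j J \<and> a' u = l}" for l by auto
  ultimately show ?case
    using a'(1-3) b(3) unfolding eq by (intro exI[of _ a']) auto
qed

end

context integral_metric
begin

text \<open>\<open>r\<close> describes a clustering that contains the uniform clusters
  \<open>J\<close>, and \<open>a\<close> the given one. The second alternative for \<open>m\<close>
  is strict since its centers are only nearly optimal and the slack has to absorb the error. In the
  first one, majority points are exact optimal centers, so equality is allowed.\<close>

lemma split_uniform:
  assumes "finite P" "finite I" "finite K" and r: "r ` P \<subseteq> I" and a: "a ` P \<subseteq> K"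
    and ri: "\<And>i. i \<in> I \<Longrightarrow> card {u \<in> P. r u = i} = s" and ak: "\<And>k. k \<in> K \<Longrightarrow> card {u \<in> P. a u = k} = s"
    and "J \<subseteq> I" and X: "X ` P \<subseteq> points"
    and x: "\<And>u. u \<in> P \<Longrightarrow> r u \<in> J \<Longrightarrow> X u = x (r u)" and xJ: "x ` J \<subseteq> points" and s: "2 \<le> s"
  defines "V \<equiv> \<Sum>k\<in>K. cost X {u \<in> P. a u = k}"
  assumes m: "(2 * V < s \<and> V \<le> m) \<or> (2 - 2 / s) * V < m"
  shows "\<exists>L a'. L \<subseteq> K \<and> card L = card K - card J \<and> a' ` {u \<in> P. r u \<notin> J} \<subseteq> L
    \<and> (\<forall>l\<in>L. card {u \<in> P. r u \<notin> J \<and> a' u = l} = s)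
    \<and> (\<Sum>l\<in>L. cost X {u \<in> P. r u \<notin> J \<and> a' u = l}) \<le> m"
proof -
  have finJ: "finite J" using assms(2,8) finite_subset by blast
  have fibX: "X ` {u \<in> P. a u = k} \<subseteq> points" for k using X by auto
  have cost0: "0 \<le> cost X {u \<in> P. a u = k}" for k using cost_nonneg[OF fibX] .
  have sum_fib: "(\<Sum>k\<in>K. \<Sum>u | u \<in> P \<and> a u = k. f u (a u)) = (\<Sum>u\<in>P. f u (a u))"
    for f :: "_ \<Rightarrow> _ \<Rightarrow> real"
    using sum.group[OF assms(1) assms(3) a, of "\<lambda>u. f u (a u)"] by simp
  have "\<exists>c M. c ` K \<subseteq> centers \<and> inj_on M J \<and> M ` J \<subseteq> K \<and> (\<forall>j\<in>J. \<exists>u\<in>P. r u = j \<and> a u = M j)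
    \<and> (\<Sum>u\<in>P. D (c (a u)) (X u)) + (real s - 2) * (\<Sum>j\<in>J. D (c (M j)) (x j)) \<le> m"
    using m
  proof
    assume V: "2 * V < s \<and> V \<le> m"
    have "\<exists>y. y \<in> points \<and> cost X {u \<in> P. a u = k} = (\<Sum>u | u \<in> P \<and> a u = k. D (emb y) (X u))" if k: "k \<in> K" for k
    proof -
      have "cost X {u \<in> P. a u = k} \<le> V"
        unfolding V_def using k assms(3) cost0 by (intro member_le_sum) auto
      then have "2 * cost X {u \<in> P. a u = k} < card {u \<in> P. a u = k}" using V ak[OF k] by simp
      then obtain y where y: "y \<in> points" "card {u \<in> P. a u = k} < 2 * card {i \<in> {u \<in> P. a u = k}. X i = y}"
        using cost_less_majority[OF fibX, of k] assms(1) by auto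
      then show ?thesis
        using cost_majority[OF fibX _ y(1) less_imp_le[OF y(2)]] assms(1) by auto
    qed
    then have "\<forall>k\<in>K. \<exists>y. y \<in> points \<and> cost X {u \<in> P. a u = k} = (\<Sum>u | u \<in> P \<and> a u = k. D (emb y) (X u))"
      by blast
    from bchoice[OF this] obtain y where y: "\<And>k. k \<in> K \<Longrightarrow> y k \<in> points"
      "\<And>k. k \<in> K \<Longrightarrow> cost X {u \<in> P. a u = k} = (\<Sum>u | u \<in> P \<and> a u = k. D (emb (y k)) (X u))"
      by blast
    let ?c = "\<lambda>k. emb (y k)"
    have "V = (\<Sum>k\<in>K. \<Sum>u | u \<in> P \<and> a u = k. D (?c (a u)) (X u))"
      unfolding V_def using y(2) by (intro sum.cong) auto
    also have "\<dots> = (\<Sum>u\<in>P. D (?c (a u)) (X u))"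
      by (rule sum_fib[of "\<lambda>u k. D (?c k) (X u)"])
    finally have Veq: "V = (\<Sum>u\<in>P. D (?c (a u)) (X u))" .
    \<comment> \<open>Weighing by 0 and 1 loses nothing, as positive distances between points are at
      least 1. The lightest matching has integral weight below 1, hence weight 0.\<close>
    define v where "v = (\<lambda>j k. of_bool (D (?c k) (x j) \<noteq> 0) :: real)"
    obtain M where M: "inj_on M J" "M ` J \<subseteq> K" "\<And>j. j \<in> J \<Longrightarrow> \<exists>u\<in>P. r u = j \<and> a u = M j"
      "real s * (\<Sum>j\<in>J. v j (M j)) \<le> (\<Sum>u | u \<in> P \<and> r u \<in> J. v (r u) (a u))"
      by (rule light_representatives[OF assms(1-3) r a, where v = v and J = J]) (use ri ak s assms(8) in auto)
    have one: "D (?c k) z \<noteq> 0 \<Longrightarrow> 1 \<le> D (?c k) z" if "k \<in> K" "z \<in> points" for k z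
      using D_ge_1[of "y k" z] y(1)[OF that(1)] that(2) by (cases "y k = z") auto
    have "(\<Sum>u | u \<in> P \<and> r u \<in> J. v (r u) (a u)) \<le> (\<Sum>u | u \<in> P \<and> r u \<in> J. D (?c (a u)) (X u))"
    proof (rule sum_mono)
      fix u assume u: "u \<in> {u. u \<in> P \<and> r u \<in> J}"
      then have "a u \<in> K" "X u \<in> points" "X u = x (r u)" using a X x by auto
      then show "v (r u) (a u) \<le> D (?c (a u)) (X u)"
        using one[of "a u" "X u"] by (cases "D (?c (a u)) (X u) = 0") (simp_all add: v_def)
    qed
    also have "\<dots> \<le> V" unfolding Veq
      using assms(1) a X y(1) by (intro sum_mono2) (auto intro!: D_nonneg)
    finally have "(\<Sum>u | u \<in> P \<and> r u \<in> J. v (r u) (a u)) \<le> V" .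
    moreover have "0 \<le> V" unfolding V_def using cost0 by (intro sum_nonneg)
    ultimately have "real s * (\<Sum>j\<in>J. v j (M j)) < real s * 1" using M(4) V by linarith
    then have lt1: "(\<Sum>j\<in>J. v j (M j)) < 1" by (rule mult_left_less_imp_less) simp
    have "D (?c (M j)) (x j) = 0" if "j \<in> J" for j
    proof (rule ccontr)
      assume "D (?c (M j)) (x j) \<noteq> 0"
      then have "1 = v j (M j)" by (simp add: v_def)
      also have "\<dots> \<le> (\<Sum>j\<in>J. v j (M j))" using that finJ by (intro member_le_sum) (auto simp: v_def)
      finally show False using lt1 by simp
    qed
    then show ?thesis
      using V Veq M(1-3) y(1) by (intro exI[of _ ?c] exI[of _ M] conjI ballI) auto
  next
    assume V: "(2 - 2 / s) * V < m"
    \<comment> \<open>The slack is shared among the clusters. The factor 2 bounds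
      \<open>2 - 2 / s\<close>, and adding 1 to \<open>card K\<close> keeps the denominator
      positive.\<close>
    define e where "e = (m - (2 - 2 / s) * V) / (2 * (card K + 1))"
    have e: "e > 0" unfolding e_def using V by (intro divide_pos_pos) auto
    have "\<forall>k. \<exists>c. c \<in> centers \<and> (\<Sum>u | u \<in> P \<and> a u = k. D c (X u)) < cost X {u \<in> P. a u = k} + e"
    proof
      fix k
      have "cost X {u \<in> P. a u = k} < cost X {u \<in> P. a u = k} + e" using e by simp
      from cost_approx[OF fibX this]
      show "\<exists>c. c \<in> centers \<and> (\<Sum>u | u \<in> P \<and> a u = k. D c (X u)) < cost X {u \<in> P. a u = k} + e"
        by blast
    qed
    from choice[OF this] obtain c where c: "\<And>k. c k \<in> centers"
      "\<And>k. (\<Sum>u | u \<in> P \<and> a u = k. D (c k) (X u)) < cost X {u \<in> P. a u = k} + e" by blast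
    let ?V = "\<Sum>u\<in>P. D (c (a u)) (X u)"
    have "?V = (\<Sum>k\<in>K. \<Sum>u | u \<in> P \<and> a u = k. D (c (a u)) (X u))"
      by (rule sum_fib[of "\<lambda>u k. D (c k) (X u)", symmetric])
    also have "\<dots> = (\<Sum>k\<in>K. \<Sum>u | u \<in> P \<and> a u = k. D (c k) (X u))"
      by (intro sum.cong) auto
    also have "\<dots> \<le> (\<Sum>k\<in>K. cost X {u \<in> P. a u = k} + e)"
      using c(2) by (intro sum_mono less_imp_le) auto
    also have "\<dots> = V + card K * e" by (simp add: V_def sum.distrib)
    finally have V': "?V \<le> V + card K * e" .
    define v where "v = (\<lambda>j k. D (c k) (x j))"
    obtain M where M: "inj_on M J" "M ` J \<subseteq> K" "\<And>j. j \<in> J \<Longrightarrow> \<exists>u\<in>P. r u = j \<and> a u = M j"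
      "real s * (\<Sum>j\<in>J. v j (M j)) \<le> (\<Sum>u | u \<in> P \<and> r u \<in> J. v (r u) (a u))"
      by (rule light_representatives[OF assms(1-3) r a, where v = v and J = J]) (use ri ak s assms(8) in auto)
    note M(4)
    also have "(\<Sum>u | u \<in> P \<and> r u \<in> J. v (r u) (a u)) = (\<Sum>u | u \<in> P \<and> r u \<in> J. D (c (a u)) (X u))"
      using x by (intro sum.cong) (auto simp: v_def)
    also have "\<dots> \<le> ?V"
      using assms(1) a X c(1) by (intro sum_mono2) (auto intro!: D_nonneg)
    finally have "(1 - 2 / real s) * (real s * (\<Sum>j\<in>J. v j (M j))) \<le> (1 - 2 / real s) * ?V"
      using s by (intro mult_left_mono) (auto simp: divide_le_eq)
    moreover have "(1 - 2 / real s) * real s = real s - 2"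
      using s by (simp add: left_diff_distrib)
    ultimately have "(real s - 2) * (\<Sum>j\<in>J. v j (M j)) \<le> (1 - 2 / real s) * ?V"
      by (simp only: mult.assoc[symmetric])
    then have "?V + (real s - 2) * (\<Sum>j\<in>J. v j (M j)) \<le> (2 - 2 / s) * ?V"
      by (simp only: left_diff_distrib)
    also have "\<dots> \<le> (2 - 2 / s) * (V + card K * e)"
      using V' s by (intro mult_left_mono) (auto simp: divide_le_eq)
    also have "\<dots> \<le> (2 - 2 / s) * V + 2 * (card K + 1) * e"
    proof -
      have "(2 - 2 / s) * (card K * e) \<le> 2 * (card K * e)"
        using e by (intro mult_right_mono) auto
      also have "\<dots> \<le> 2 * (card K + 1) * e" using e by (simp add: distrib_right distrib_left)
      finally show ?thesis by (simp only: distrib_left)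
    qed
    also have "\<dots> = m"
    proof -
      have "0 < 2 * (real (card K) + 1)" by (simp add: add_nonneg_pos)
      then show ?thesis by (simp add: e_def)
    qed
    finally show ?thesis
      using c(1) M(1-3) unfolding v_def by (intro exI[of _ c] exI[of _ M]) blast
  qed
  then obtain c M where c: "c ` K \<subseteq> centers" and M: "inj_on M J" "M ` J \<subseteq> K"
    "\<And>j. j \<in> J \<Longrightarrow> \<exists>u\<in>P. r u = j \<and> a u = M j"
    and le_m: "(\<Sum>u\<in>P. D (c (a u)) (X u)) + (real s - 2) * (\<Sum>j\<in>J. D (c (M j)) (x j)) \<le> m"
    by (elim exE conjE) (rule that, blast+)
  have rj: "card {u \<in> P. r u = j} = s" if "j \<in> J" for j using ri assms(8) that by blast
  let ?Q = "{u \<in> P. r u \<notin> J}"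
  have "\<exists>a'. a' ` ?Q \<subseteq> K - M ` J
    \<and> (\<forall>l\<in>K - M ` J. card {u \<in> P. r u \<notin> J \<and> a' u = l} = s)
    \<and> (\<forall>u\<in>P. r u \<notin> J \<longrightarrow> a u \<notin> M ` J \<longrightarrow> a' u = a u)
    \<and> (\<Sum>u\<in>?Q. D (c (a' u)) (X u)) \<le> (\<Sum>u\<in>P. D (c (a u)) (X u))
        + (\<Sum>j\<in>J. (real s - 2 * real (card {u \<in> P. r u = j \<and> a u = M j})) * D (c (M j)) (x j))"
    by (rule settle_all) (fact assms(1) X c a finJ M(1,2) xJ | rule ak rj x, assumption+)+
  then obtain a' where a': "a' ` ?Q \<subseteq> K - M ` J" "\<And>l. l \<in> K - M ` J \<Longrightarrow> card {u \<in> P. r u \<notin> J \<and> a' u = l} = s"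
    "(\<Sum>u\<in>?Q. D (c (a' u)) (X u)) \<le> (\<Sum>u\<in>P. D (c (a u)) (X u))
        + (\<Sum>j\<in>J. (real s - 2 * real (card {u \<in> P. r u = j \<and> a u = M j})) * D (c (M j)) (x j))"
    by (elim exE conjE) (rule that, blast+)
  have "(real s - 2 * real (card {u \<in> P. r u = j \<and> a u = M j})) * D (c (M j)) (x j)
      \<le> (real s - 2) * D (c (M j)) (x j)" if j: "j \<in> J" for j
  proof -
    have "{u \<in> P. r u = j \<and> a u = M j} \<noteq> {}" using M(3)[OF j] by auto
    then have "1 \<le> card {u \<in> P. r u = j \<and> a u = M j}" using assms(1) by (simp add: Suc_le_eq card_gt_0_iff)
    moreover have "0 \<le> D (c (M j)) (x j)" using j c M(2) xJ by (intro D_nonneg) auto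
    ultimately show ?thesis by (intro mult_right_mono) auto
  qed
  then have "(\<Sum>j\<in>J. (real s - 2 * real (card {u \<in> P. r u = j \<and> a u = M j})) * D (c (M j)) (x j))
      \<le> (\<Sum>j\<in>J. (real s - 2) * D (c (M j)) (x j))" by (rule sum_mono)
  then have le: "(\<Sum>u\<in>?Q. D (c (a' u)) (X u)) \<le> m"
    using a'(3) le_m by (simp add: sum_distrib_left)
  let ?L = "K - M ` J"
  have "(\<Sum>l\<in>?L. cost X {u \<in> P. r u \<notin> J \<and> a' u = l}) \<le> (\<Sum>l\<in>?L. \<Sum>u | u \<in> ?Q \<and> a' u = l. D (c (a' u)) (X u))"
  proof (rule sum_mono)
    fix l assume l: "l \<in> ?L"
    have "cost X {u \<in> P. r u \<notin> J \<and> a' u = l} \<le> (\<Sum>u | u \<in> P \<and> r u \<notin> J \<and> a' u = l. D (c l) (X u))"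
      using l c X by (intro cost_le) auto
    also have "\<dots> = (\<Sum>u | u \<in> ?Q \<and> a' u = l. D (c (a' u)) (X u))"
      by (intro sum.cong) auto
    finally show "cost X {u \<in> P. r u \<notin> J \<and> a' u = l} \<le> (\<Sum>u | u \<in> ?Q \<and> a' u = l. D (c (a' u)) (X u))" .
  qed
  also have "\<dots> = (\<Sum>u\<in>?Q. D (c (a' u)) (X u))"
    using assms(1,3) a'(1) by (intro sum.group) auto
  also note le
  finally have "(\<Sum>l\<in>?L. cost X {u \<in> P. r u \<notin> J \<and> a' u = l}) \<le> m" .
  moreover have "card ?L = card K - card J"
    using M(1,2) assms(3) finJ by (simp add: card_Diff_subset card_image)
  ultimately show ?thesis using a'(1,2) by (intro exI[of _ ?L] exI[of _ a']) auto
qed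

end

subsection \<open>Clusters with a majority point\<close>

text \<open>Only the number of copies of each point matters: this exchanges the copies that the
  reduction removes for those that the analysis would remove.\<close>

lemma bij_betw_same_values:
  assumes "finite P" "finite Q" "\<And>y. card {u \<in> P. X u = y} = card {u \<in> Q. X u = y}"
  shows "\<exists>h. bij_betw h P Q \<and> (\<forall>u\<in>P. X (h u) = X u)"
proof -
  have "\<exists>h. bij_betw h {u \<in> P. X u = y} {u \<in> Q. X u = y}" for y
    using assms by (intro finite_same_card_bij) auto
  then have "\<forall>y. \<exists>h. bij_betw h {u \<in> P. X u = y} {u \<in> Q. X u = y}" by blast
  from choice[OF this] obtain h where h: "\<And>y. bij_betw (h y) {u \<in> P. X u = y} {u \<in> Q. X u = y}"
    by blast
  have hQ: "h (X u) u \<in> Q" "X (h (X u) u) = X u" if "u \<in> P" for u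
    using bij_betwE[OF h[of "X u"]] that by auto
  let ?h = "\<lambda>u. h (X u) u"
  have "inj_on ?h P"
  proof (rule inj_onI)
    fix u v assume uv: "u \<in> P" "v \<in> P" "?h u = ?h v"
    then have "X u = X v" using hQ[of u] hQ[of v] by simp
    then show "u = v"
      using uv inj_onD[OF bij_betw_imp_inj_on[OF h[of "X u"]], of u v] by simp
  qed
  moreover have "?h ` P = Q"
  proof (intro equalityI subsetI)
    fix v assume v: "v \<in> Q"
    then have "v \<in> h (X v) ` {u \<in> P. X u = X v}"
      using bij_betw_imp_surj_on[OF h[of "X v"]] by simp
    then obtain u where "u \<in> P" "X u = X v" "v = h (X v) u" by blast
    then show "v \<in> ?h ` P" by (intro image_eqI[of _ _ u]) simp_all
  qed (use hQ in auto)
  ultimately show ?thesis using hQ by (intro exI[of _ ?h]) (simp add: bij_betw_def)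
qed

context integral_metric
begin

lemma cost_reindex:
  assumes "bij_betw h A B" "\<And>u. u \<in> A \<Longrightarrow> X (h u) = Y u"
  shows "cost Y A = cost X B"
proof -
  have "(\<Sum>i\<in>A. D c (Y i)) = (\<Sum>i\<in>B. D c (X i))" for c
    using sum.reindex_bij_betw[OF assms(1), of "\<lambda>i. D c (X i)"] assms(2) by simp
  then show ?thesis by (simp add: cost_def)
qed

text \<open>No point has enough copies to fill a cluster, so each cluster contains two different
  points and \<open>card_values_le\<close> applies to it.\<close>

lemma card_values_total:
  assumes "finite P" "finite K" and X: "X ` P \<subseteq> points" and a: "a ` P \<subseteq> K"
    and ak: "\<And>k. k \<in> K \<Longrightarrow> card {u \<in> P. a u = k} = s"
    and small: "\<And>y. card {u \<in> P. X u = y} < s"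
  shows "card (X ` P) \<le> 2 * (\<Sum>k\<in>K. cost X {u \<in> P. a u = k})"
proof -
  have "card (X ` {u \<in> P. a u = k}) \<le> 2 * cost X {u \<in> P. a u = k}" if k: "k \<in> K" for k
  proof -
    let ?A = "{u \<in> P. a u = k}"
    have "s > 0" using small[of undefined] by simp
    then have "card ?A \<noteq> 0" using ak[OF k] by simp
    then have "?A \<noteq> {}" by (metis card.empty)
    then obtain u where u: "u \<in> ?A" by blast
    have "\<exists>v\<in>?A. X v \<noteq> X u"
    proof (rule ccontr)
      assume "\<not> ?thesis"
      then have "?A \<subseteq> {v \<in> P. X v = X u}" by auto
      then have "card ?A \<le> card {v \<in> P. X v = X u}"
        using assms(1) by (intro card_mono) auto
      then show False using small[of "X u"] ak[OF k] by simp
    qed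
    then obtain v where "v \<in> ?A" "X v \<noteq> X u" by blast
    then show ?thesis using X u assms(1) by (intro card_values_le) auto
  qed
  then have "(\<Sum>k\<in>K. real (card (X ` {u \<in> P. a u = k}))) \<le> (\<Sum>k\<in>K. 2 * cost X {u \<in> P. a u = k})"
    by (intro sum_mono) simp
  moreover have eq: "X ` P = (\<Union>k\<in>K. X ` {u \<in> P. a u = k})" using a by auto
  have "card (X ` P) \<le> (\<Sum>k\<in>K. card (X ` {u \<in> P. a u = k}))"
    by (subst eq) (rule card_UN_le[OF assms(2)])
  then have "real (card (X ` P)) \<le> (\<Sum>k\<in>K. real (card (X ` {u \<in> P. a u = k})))"
    by (simp flip: of_nat_sum)
  ultimately show ?thesis by (simp add: sum_distrib_left)
qed

lemma majority:
  assumes "finite A" "X ` A \<subseteq> points" "cost X A \<le> real b" "2 * b < card A"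
  obtains y where "y \<in> points" "card A < 2 * card {u \<in> A. X u = y}"
    "card A \<le> card {u \<in> A. X u = y} + b"
    "real (card A) \<le> card {u \<in> A. X u = y} + cost X A"
proof -
  have "2 * cost X A < card A" using assms by linarith
  then obtain y where y: "y \<in> points" "card A < 2 * card {u \<in> A. X u = y}"
    using cost_less_majority[OF assms(2,1)] by blast
  then have "real (card A) \<le> card {u \<in> A. X u = y} + cost X A"
    using cost_majority_ge[OF assms(2,1)] by simp
  then show ?thesis using that[OF y] assms(3) by linarith
qed

text \<open>The majority point stays a majority point and hence an optimal center, at which the
  added copies cost nothing. Lifting puts removed copies back in this way.\<close>

lemma cost_Un_majority:
  assumes "finite A" "finite E" "A \<inter> E = {}" "X ` A \<subseteq> points" "y \<in> points"
    and "\<And>u. u \<in> E \<Longrightarrow> X u = y" "card A \<le> 2 * card {u \<in> A. X u = y}"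
  shows "cost X (A \<union> E) = cost X A"
proof -
  have "{u \<in> A \<union> E. X u = y} = {u \<in> A. X u = y} \<union> E" using assms(6) by auto
  moreover have "card ({u \<in> A. X u = y} \<union> E) = card {u \<in> A. X u = y} + card E"
    using assms by (intro card_Un_disjoint) auto
  moreover have "card (A \<union> E) = card A + card E" using assms by (intro card_Un_disjoint) auto
  ultimately have "card (A \<union> E) \<le> 2 * card {u \<in> A \<union> E. X u = y}" using assms(7) by simp
  moreover have "X ` (A \<union> E) \<subseteq> points" using assms by auto
  ultimately have "cost X (A \<union> E) = (\<Sum>u\<in>A \<union> E. D (emb y) (X u))"
    using assms by (intro cost_majority) auto
  also have "\<dots> = (\<Sum>u\<in>A. D (emb y) (X u)) + (\<Sum>u\<in>E. D (emb y) (X u))"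
    using assms by (intro sum.union_disjoint) auto
  also have "(\<Sum>u\<in>E. D (emb y) (X u)) = 0" using assms by (intro sum.neutral) simp
  finally show ?thesis using assms by (simp add: cost_majority)
qed

text \<open>The reduction does not know the clusters, but the number of copies reveals the majority
  points: these have at least \<open>s - b > b\<close> copies, and all other points have at most
  \<open>b\<close>. Each of the \<open>card K\<close> majority points belongs to one cluster, which
  can spare \<open>t \<le> s - b\<close> copies of it.\<close>

lemma shrink_clusters:
  assumes "finite P" "finite K" and X: "X ` P \<subseteq> points" and a: "a ` P \<subseteq> K"
    and ak: "\<And>k. k \<in> K \<Longrightarrow> card {u \<in> P. a u = k} = s"
    and small: "\<And>y. card {u \<in> P. X u = y} < s"
    and V: "(\<Sum>k\<in>K. cost X {u \<in> P. a u = k}) \<le> real b" and s: "2 * b < s" and t: "t + b \<le> s"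
    and E: "E \<subseteq> P" "\<And>y. card {u \<in> E. X u = y}
      = (if b < card {u \<in> P. X u = y} then min t (card {u \<in> P. X u = y}) else 0)"
  shows "\<And>y. b < card {u \<in> P. X u = y} \<Longrightarrow> t \<le> card {u \<in> P. X u = y}"
    and "card E = card K * t"
    and "\<exists>a'. a' ` (P - E) \<subseteq> K \<and> (\<forall>k\<in>K. card {u \<in> P - E. a' u = k} = s - t)
      \<and> (\<Sum>k\<in>K. cost X {u \<in> P - E. a' u = k}) \<le> (\<Sum>k\<in>K. cost X {u \<in> P. a u = k})"
proof -
  let ?A = "\<lambda>k. {u \<in> P. a u = k}" and ?n = "\<lambda>y. card {u \<in> P. X u = y}"
  let ?m = "\<lambda>k y. card {u \<in> ?A k. X u = y}"
  have AX: "X ` ?A k \<subseteq> points" and finA: "finite (?A k)" for k using X assms(1) by auto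
  have cost_b: "cost X (?A k) \<le> b" if "k \<in> K" for k
    by (rule order_trans[OF member_le_sum[OF that, of "\<lambda>k. cost X (?A k)"] V])
      (use cost_nonneg[OF AX] assms(2) in auto)
  have "\<exists>y. y \<in> points \<and> s < 2 * ?m k y \<and> s \<le> ?m k y + b \<and> real s \<le> ?m k y + cost X (?A k)"
    if k: "k \<in> K" for k
    by (rule majority[OF finA AX cost_b[OF k]]) (use s ak[OF k] in auto)
  then have "\<forall>k\<in>K. \<exists>y. y \<in> points \<and> s < 2 * ?m k y \<and> s \<le> ?m k y + b \<and> real s \<le> ?m k y + cost X (?A k)"
    by blast
  from bchoice[OF this] obtain y where y: "\<forall>k\<in>K. y k \<in> points \<and> s < 2 * ?m k (y k)
      \<and> s \<le> ?m k (y k) + b \<and> real s \<le> ?m k (y k) + cost X (?A k)" ..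
  have sub: "?m k z \<le> ?n z" for k z using assms(1) by (intro card_mono) auto
  \<comment> \<open>Two clusters with the same majority point would contain more than
    \<open>s\<close> copies of it together.\<close>
  have inj: "inj_on y K"
  proof (rule inj_onI, rule ccontr)
    fix k l assume kl: "k \<in> K" "l \<in> K" "y k = y l" "k \<noteq> l"
    have "?m k (y k) + ?m l (y k) = card ({u \<in> ?A k. X u = y k} \<union> {u \<in> ?A l. X u = y k})"
      using kl assms(1) by (intro card_Un_disjoint[symmetric]) auto
    also have "\<dots> \<le> ?n (y k)" using assms(1) by (intro card_mono) auto
    finally have "?m k (y k) + ?m l (y l) < s" using small[of "y k"] kl(3) by simp
    moreover have "s < 2 * ?m k (y k)" "s < 2 * ?m l (y l)" using y kl(1,2) by blast+
    ultimately show False by linarith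
  qed
  have big: "b < ?n (y k)" "t \<le> ?n (y k)" if "k \<in> K" for k
  proof -
    have "s \<le> ?m k (y k) + b" using y that by blast
    then show "b < ?n (y k)" "t \<le> ?n (y k)" using sub[of k "y k"] s t by linarith+
  qed
  \<comment> \<open>Each copy of any other point adds at least 1 to the cost of its cluster.\<close>
  have other: "?n z \<le> b" if z: "z \<notin> y ` K" for z
  proof -
    have "real (?m k z) \<le> cost X (?A k)" if k: "k \<in> K" for k
    proof -
      have "?m k z + ?m k (y k) = card ({u \<in> ?A k. X u = z} \<union> {u \<in> ?A k. X u = y k})"
        using z k assms(1) by (intro card_Un_disjoint[symmetric]) auto
      also have "\<dots> \<le> card (?A k)" using assms(1) by (intro card_mono) auto
      finally have "?m k z + ?m k (y k) \<le> s" using ak[OF k] by simp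
      then have "real (?m k z) + real (?m k (y k)) \<le> real s" by linarith
      moreover have "real s \<le> ?m k (y k) + cost X (?A k)" using y k by blast
      ultimately show ?thesis by linarith
    qed
    then have "(\<Sum>k\<in>K. real (?m k z)) \<le> (\<Sum>k\<in>K. cost X (?A k))" by (rule sum_mono)
    then have "(\<Sum>k\<in>K. real (?m k z)) \<le> b" using V by linarith
    moreover have eq: "{u \<in> P. X u = z} = (\<Union>k\<in>K. {u \<in> ?A k. X u = z})" using a by auto
    have "?n z \<le> (\<Sum>k\<in>K. ?m k z)" by (subst eq) (rule card_UN_le[OF assms(2)])
    then have "real (?n z) \<le> (\<Sum>k\<in>K. real (?m k z))" by (simp flip: of_nat_sum)
    ultimately show ?thesis by linarith
  qed
  show tn: "t \<le> ?n z" if "b < ?n z" for z using that other[of z] big(2) by force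
  have Ey: "card {u \<in> E. X u = y k} = t" if "k \<in> K" for k using E(2) big[OF that] by simp
  have finE: "finite E" using E(1) assms(1) finite_subset by blast
  have E0: "{u \<in> E. X u = z} = {}" if "z \<notin> y ` K" for z
    using E(2)[of z] other[OF that] finE by (simp add: card_eq_0_iff)
  have "E = {u \<in> E. X u \<in> y ` K}" using E0 by auto
  moreover have "card {u \<in> E. X u \<in> y ` K} = card (y ` K) * t"
    using finE assms(2) Ey by (intro card_fibres) auto
  ultimately show "card E = card K * t" using card_image[OF inj] by simp
  \<comment> \<open>The analysis takes \<open>t\<close> copies of the majority point out of each
    cluster. \<open>E\<close> consists of possibly different copies of the same points, and the
    bijection \<open>h\<close> below identifies the two remainders.\<close>
  have "\<exists>T. T \<subseteq> {u \<in> ?A k. X u = y k} \<and> card T = t" if "k \<in> K" for k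
  proof -
    have "t \<le> ?m k (y k)" using y that t by fastforce
    then show ?thesis by (rule obtain_subset_with_card_n) auto
  qed
  then have "\<forall>k\<in>K. \<exists>T. T \<subseteq> {u \<in> ?A k. X u = y k} \<and> card T = t" by blast
  from bchoice[OF this] obtain T where T: "\<forall>k\<in>K. T k \<subseteq> {u \<in> ?A k. X u = y k} \<and> card (T k) = t" ..
  have TD: "u \<in> P" "a u = k" "X u = y k" if "k \<in> K" "u \<in> T k" for k u
  proof -
    have "T k \<subseteq> {u \<in> ?A k. X u = y k}" using bspec[OF T that(1)] by (rule conjunct1)
    then show "u \<in> P" "a u = k" "X u = y k" using that(2) by auto
  qed
  let ?F = "\<Union>k\<in>K. T k"
  have FP: "?F \<subseteq> P" using TD(1) by blast
  have finF: "finite ?F" using FP assms(1) finite_subset by blast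
  have Fy: "{u \<in> ?F. X u = y k} = T k" if "k \<in> K" for k
  proof (intro equalityI subsetI)
    fix u assume "u \<in> {u \<in> ?F. X u = y k}"
    then obtain l where l: "l \<in> K" "u \<in> T l" "X u = y k" by blast
    then have "X u = y l" using TD(3) by simp
    then show "u \<in> T k" using l inj_onD[OF inj, of k l] that by simp
  next
    fix u assume "u \<in> T k"
    then show "u \<in> {u \<in> ?F. X u = y k}" using TD(3)[OF that] that by auto
  qed
  have F0: "{u \<in> ?F. X u = z} = {}" if "z \<notin> y ` K" for z using TD(3) that by auto
  have diff: "card {u \<in> P - G. X u = z} = ?n z - card {u \<in> G. X u = z}" if "G \<subseteq> P" for G z
  proof -
    have "{u \<in> P - G. X u = z} = {u \<in> P. X u = z} - {u \<in> G. X u = z}" by auto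
    moreover have "{u \<in> G. X u = z} \<subseteq> {u \<in> P. X u = z}" using that by blast
    moreover have "finite {u \<in> G. X u = z}" using finite_subset[OF that assms(1)] by simp
    ultimately show ?thesis by (simp only: card_Diff_subset)
  qed
  have same: "card {u \<in> P - E. X u = z} = card {u \<in> P - ?F. X u = z}" for z
  proof (cases "z \<in> y ` K")
    case True
    then obtain k where k: "k \<in> K" "z = y k" by blast
    then have "card {u \<in> ?F. X u = z} = t" using Fy[OF k(1)] T by simp
    then show ?thesis unfolding diff[OF E(1)] diff[OF FP] using Ey[OF k(1)] k(2) by simp
  next
    case False
    then show ?thesis unfolding diff[OF E(1)] diff[OF FP] E0[OF False] F0[OF False] by simp
  qed
  have "\<exists>h. bij_betw h (P - E) (P - ?F) \<and> (\<forall>u\<in>P - E. X (h u) = X u)"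
    by (rule bij_betw_same_values[OF _ _ same]) (use assms(1) in simp_all)
  then obtain h where h: "bij_betw h (P - E) (P - ?F)" "\<forall>u\<in>P - E. X (h u) = X u"
    by (elim exE conjE)
  have bij: "bij_betw h {u \<in> P - E. a (h u) = k} (?A k - T k)" if k: "k \<in> K" for k
  proof -
    have "h ` {u \<in> P - E. a (h u) = k} = {v \<in> h ` (P - E). a v = k}" by auto
    also have "\<dots> = {u \<in> P - ?F. a u = k}" by (simp only: bij_betw_imp_surj_on[OF h(1)])
    also have "\<dots> = ?A k - T k"
    proof -
      have "u \<notin> T l" if "a u = k" "u \<notin> T k" "l \<in> K" for u l
        using TD(2)[OF that(3), of u] that by auto
      then show ?thesis using k by auto
    qed
    finally have "h ` {u \<in> P - E. a (h u) = k} = ?A k - T k" .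
    moreover have "inj_on h {u \<in> P - E. a (h u) = k}"
      by (rule inj_on_subset[OF bij_betw_imp_inj_on[OF h(1)]]) auto
    ultimately show ?thesis by (simp add: bij_betw_def)
  qed
  have Tk: "T k \<subseteq> ?A k" "card (T k) = t" "finite (T k)" if "k \<in> K" for k
  proof -
    show "T k \<subseteq> ?A k" using TD[OF that] by auto
    then show "finite (T k)" using finA finite_subset by blast
    show "card (T k) = t" using T that by blast
  qed
  have "a (h u) \<in> K" if "u \<in> P - E" for u
  proof -
    have "h u \<in> P" using bij_betw_apply[OF h(1) that] by simp
    then show ?thesis using a by auto
  qed
  moreover have "card {u \<in> P - E. a (h u) = k} = s - t" if k: "k \<in> K" for k
    using bij_betw_same_card[OF bij[OF k]] card_Diff_subset[OF Tk(3)[OF k] Tk(1)[OF k]] Tk(2)[OF k] ak[OF k]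
    by simp
  moreover have "cost X {u \<in> P - E. a (h u) = k} \<le> cost X (?A k)" if k: "k \<in> K" for k
  proof -
    have "cost X {u \<in> P - E. a (h u) = k} = cost X (?A k - T k)"
      by (rule cost_reindex[OF bij[OF k]]) (use h(2) in simp)
    also have "\<dots> \<le> (\<Sum>u\<in>?A k - T k. D (emb (y k)) (X u))"
      using y k AX[of k] by (intro cost_le) auto
    also have "\<dots> \<le> (\<Sum>u\<in>?A k. D (emb (y k)) (X u))"
      using y k AX[of k] assms(1) by (intro sum_mono2) (auto intro!: D_nonneg)
    also have "\<dots> = cost X (?A k)"
      using y k ak[OF k] by (intro cost_majority[OF AX finA, symmetric]) auto
    finally show ?thesis .
  qed
  then have "(\<Sum>k\<in>K. cost X {u \<in> P - E. a (h u) = k}) \<le> (\<Sum>k\<in>K. cost X (?A k))"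
    by (rule sum_mono)
  ultimately show "\<exists>a'. a' ` (P - E) \<subseteq> K \<and> (\<forall>k\<in>K. card {u \<in> P - E. a' u = k} = s - t)
      \<and> (\<Sum>k\<in>K. cost X {u \<in> P - E. a' u = k}) \<le> (\<Sum>k\<in>K. cost X (?A k))"
    by (intro exI[of _ "\<lambda>u. a (h u)"]) auto
qed

end

subsection \<open>Isometric changes of coordinates\<close>

text \<open>Only coordinates in which the new pair differs need a counterpart. The Hamming distance
  ignores the size of a difference, so absolute values are compared for positive \<open>p\<close>
  only.\<close>

lemma pdist_le_coordwise:
  assumes "length c = d" "length x = d" "length c' = d'" "length x' = d'"
    and S: "S = {j. j < d' \<and> c' ! j \<noteq> real_of_int (x' ! j)}"
    and "inj_on g S" "g ` S \<subseteq> {..<d}"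
    and ne: "\<And>j. j \<in> S \<Longrightarrow> c ! g j \<noteq> real_of_int (x ! g j)"
    and le: "\<And>j. j \<in> S \<Longrightarrow> p > 0 \<Longrightarrow>
      \<bar>c' ! j - real_of_int (x' ! j)\<bar> \<le> \<bar>c ! g j - real_of_int (x ! g j)\<bar>"
  shows "pdist p c' x' \<le> pdist p c x"
proof -
  have finS: "finite S" unfolding S by simp
  show ?thesis
  proof (cases "p = 0")
    case True
    have "g ` S \<subseteq> {i. i < d \<and> c ! i \<noteq> real_of_int (x ! i)}" using assms(7) ne by auto
    then have "card (g ` S) \<le> card {i. i < d \<and> c ! i \<noteq> real_of_int (x ! i)}"
      by (intro card_mono) auto
    then show ?thesis
      using True card_image[OF assms(6)] pdist_0[OF assms(1,2)] pdist_0[OF assms(3,4)] S by simp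
  next
    case False
    then have p: "p > 0" by simp
    let ?e = "\<lambda>i. \<bar>c ! i - real_of_int (x ! i)\<bar> ^ p"
    have "(\<Sum>j<d'. \<bar>c' ! j - real_of_int (x' ! j)\<bar> ^ p) = (\<Sum>j\<in>S. \<bar>c' ! j - real_of_int (x' ! j)\<bar> ^ p)"
      using p by (intro sum.mono_neutral_right) (auto simp: S)
    also have "\<dots> \<le> (\<Sum>j\<in>S. ?e (g j))"
      using le p by (intro sum_mono power_mono) auto
    also have "\<dots> = (\<Sum>i\<in>g ` S. ?e i)" using assms(6) by (simp add: sum.reindex)
    also have "\<dots> \<le> (\<Sum>i<d. ?e i)" using assms(7) by (intro sum_mono2) auto
    finally show ?thesis
      using p by (simp add: pdist_pos[OF assms(1,2)] pdist_pos[OF assms(3,4)])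
  qed
qed

definition lp_cost :: "nat \<Rightarrow> nat \<Rightarrow> ('i \<Rightarrow> int list) \<Rightarrow> 'i set \<Rightarrow> real" where
  "lp_cost p d X A = (INF c \<in> {c. length c = d}. \<Sum>i\<in>A. pdist p c (X i))"

lemma lp_cost_eq: "integral_metric.cost (pdist p) {c. length c = d} = lp_cost p d"
  by (intro ext) (simp add: integral_metric.cost_def[OF integral_metric_pdist] lp_cost_def)

lemma lp_cost_map_le:
  assumes "\<And>c. length c = d \<Longrightarrow> length (g c) = d'"
    and "\<And>i c. i \<in> A \<Longrightarrow> length c = d \<Longrightarrow> pdist p (g c) (Y i) \<le> pdist p c (X i)"
    and "\<And>i. i \<in> A \<Longrightarrow> length (Y i) = d'"
  shows "lp_cost p d' Y A \<le> lp_cost p d X A"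
proof -
  interpret integral_metric "pdist p" "{c. length c = d'}" "{x. length x = d'}" real_point
    by (rule integral_metric_pdist)
  have "lp_cost p d' Y A \<le> (\<Sum>i\<in>A. pdist p c (X i))" if c: "length c = d" for c
  proof -
    have "cost Y A \<le> (\<Sum>i\<in>A. pdist p (g c) (Y i))"
      using assms(1)[OF c] assms(3) by (intro cost_le) auto
    also have "\<dots> \<le> (\<Sum>i\<in>A. pdist p c (X i))"
      using assms(2) c by (intro sum_mono) auto
    finally show ?thesis by (simp add: lp_cost_eq)
  qed
  moreover have "{c :: real list. length c = d} \<noteq> {}" using Ex_list_of_length by auto
  ultimately show ?thesis unfolding lp_cost_def[of p d X]
    by (intro cINF_greatest) auto
qed

lemma lp_cost_transform:
  fixes f :: "nat \<Rightarrow> int \<Rightarrow> int"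
  assumes K: "distinct K" "set K \<subseteq> {..<d}" and X: "\<And>i. i \<in> A \<Longrightarrow> length (X i) = d"
    and const: "\<And>l i j. l < d \<Longrightarrow> l \<notin> set K \<Longrightarrow> i \<in> A \<Longrightarrow> j \<in> A \<Longrightarrow> X i ! l = X j ! l"
    and diff: "\<And>l i j. p > 0 \<Longrightarrow> l \<in> set K \<Longrightarrow> i \<in> A \<Longrightarrow> j \<in> A
      \<Longrightarrow> f l (X i ! l) - f l (X j ! l) = X i ! l - X j ! l"
    and inj: "\<And>l i j. l \<in> set K \<Longrightarrow> i \<in> A \<Longrightarrow> j \<in> A
      \<Longrightarrow> f l (X i ! l) = f l (X j ! l) \<Longrightarrow> X i ! l = X j ! l"
  shows "lp_cost p (length K) (\<lambda>i. map (\<lambda>l. f l (X i ! l)) K) A = lp_cost p d X A"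
proof (cases "A = {}")
  case True
  have "{c :: real list. length c = n} \<noteq> {}" for n using Ex_list_of_length by auto
  then show ?thesis using True by (simp add: lp_cost_def)
next
  case False
  then obtain a where a: "a \<in> A" by blast
  let ?Y = "\<lambda>i. map (\<lambda>l. f l (X i ! l)) K"
  define sh where "sh = (\<lambda>l. f l (X a ! l) - X a ! l)"
  have sh: "f l (X i ! l) = X i ! l + sh l" if "p > 0" "l \<in> set K" "i \<in> A" for l i
    using diff[OF that a] by (simp add: sh_def)
  have Kd: "K ! j < d" if "j < length K" for j using K(2) nth_mem[OF that] by auto
  have "lp_cost p (length K) ?Y A \<le> lp_cost p d X A"
  proof (rule lp_cost_map_le)
    \<comment> \<open>For \<open>p = 0\<close> a non-integral coordinate of the center differs from
      every point anyway, so rounding it down before applying \<open>f\<close> can only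
      help.\<close>
    let ?g = "\<lambda>c :: real list. map (\<lambda>l. if p > 0 then c ! l + sh l else real_of_int (f l \<lfloor>c ! l\<rfloor>)) K"
    fix i and c :: "real list" assume i: "i \<in> A" and c: "length c = d"
    have "c ! (K ! j) \<noteq> real_of_int (X i ! (K ! j)) \<and> (p > 0 \<longrightarrow> \<bar>?g c ! j - real_of_int (?Y i ! j)\<bar>
        \<le> \<bar>c ! (K ! j) - real_of_int (X i ! (K ! j))\<bar>)"
      if "j < length K" "?g c ! j \<noteq> real_of_int (?Y i ! j)" for j
      using that sh[of "K ! j" i] i nth_mem[OF that(1)] by (auto split: if_splits)
    then show "pdist p (?g c) (?Y i) \<le> pdist p c (X i)"
      using c X[OF i] K(1) Kd
      by (intro pdist_le_coordwise[where g = "\<lambda>j. K ! j" and d = d and d' = "length K", OF _ _ _ _ refl])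
        (auto simp: inj_on_def nth_eq_iff_index_eq)
  qed auto
  moreover have "lp_cost p d X A \<le> lp_cost p (length K) ?Y A"
  proof (rule lp_cost_map_le)
    define ix where "ix = (\<lambda>l. SOME j. j < length K \<and> K ! j = l)"
    have ix: "ix l < length K" "K ! ix l = l" if "l \<in> set K" for l
    proof -
      have "\<exists>j. j < length K \<and> K ! j = l" using that by (simp add: in_set_conv_nth)
      from someI_ex[OF this] show "ix l < length K" "K ! ix l = l" by (simp_all add: ix_def)
    qed
    \<comment> \<open>Inverts \<open>f\<close> on the values that occur in the cluster. Other
      coordinates of a center already differ from all the points, so any value will do
      there.\<close>
    define inv where "inv = (\<lambda>l r. SOME v. \<exists>i\<in>A. v = X i ! l \<and> r = real_of_int (f l v))"
    have inv: "inv l (real_of_int (f l (X i ! l))) = X i ! l" if "l \<in> set K" "i \<in> A" for l i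
      unfolding inv_def by (rule some_equality) (use that inj[OF that(1)] in auto)
    let ?g = "\<lambda>c :: real list. map (\<lambda>l. if l \<notin> set K then real_of_int (X a ! l)
      else if p > 0 then c ! ix l - sh l else real_of_int (inv l (c ! ix l))) [0..<d]"
    fix i and c :: "real list" assume i: "i \<in> A" and c: "length c = length K"
    have *: "l \<in> set K \<and> c ! ix l \<noteq> real_of_int (?Y i ! ix l) \<and> (p > 0 \<longrightarrow> \<bar>?g c ! l - real_of_int (X i ! l)\<bar>
        \<le> \<bar>c ! ix l - real_of_int (?Y i ! ix l)\<bar>)"
      if l: "l < d" "?g c ! l \<noteq> real_of_int (X i ! l)" for l
    proof (cases "l \<in> set K")
      case True
      then have Yi: "?Y i ! ix l = f l (X i ! l)" using ix[OF True] by simp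
      show ?thesis
        using True l i sh[OF _ True i] inv[OF True i] unfolding Yi by (auto split: if_splits)
    next
      case False
      then show ?thesis using l const[OF l(1) False a i] by simp
    qed
    have "inj_on ix (set K)" using ix(2) by (metis inj_onI)
    show "pdist p (?g c) (X i) \<le> pdist p c (?Y i)"
    proof (rule pdist_le_coordwise[where g = ix and d = "length K" and d' = d, OF _ _ _ _ refl])
      let ?S = "{l. l < d \<and> ?g c ! l \<noteq> real_of_int (X i ! l)}"
      show "inj_on ix ?S" by (rule inj_on_subset[OF \<open>inj_on ix (set K)\<close>]) (use * in blast)
      show "ix ` ?S \<subseteq> {..<length K}"
      proof
        fix m assume "m \<in> ix ` ?S"
        then obtain l where "l \<in> ?S" "m = ix l" by blast
        then show "m \<in> {..<length K}" using *[of l] ix(1)[of l] by blast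
      qed
      show "c ! ix l \<noteq> real_of_int (?Y i ! ix l)" if "l \<in> ?S" for l using *[of l] that by blast
      show "\<bar>?g c ! l - real_of_int (X i ! l)\<bar> \<le> \<bar>c ! ix l - real_of_int (?Y i ! ix l)\<bar>"
        if "l \<in> ?S" "p > 0" for l using *[of l] that by blast
    qed (use c X[OF i] in simp_all)
  qed (use X in auto)
  ultimately show ?thesis by (rule antisym)
qed

subsection \<open>Distances and the number of differing coordinates\<close>

text \<open>Different integers contribute at least 1 to the sum of powers; \<open>max p 1\<close>
  lets the Hamming distance count as exponent 1. Bounding by \<open>d\<close> as well keeps the
  threshold polynomial in the size of an instance even if \<open>b\<close> is exponential in
  it.\<close>

lemma card_diff_le_pdist:
  assumes "length x = d" "length y = d" "pdist p (real_point x) y \<le> real b"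
  shows "card {i. i < d \<and> x ! i \<noteq> y ! i} \<le> (min b d) ^ max p 1"
proof -
  let ?S = "{i. i < d \<and> x ! i \<noteq> y ! i}"
  have Sd: "card ?S \<le> d" using card_mono[of "{..<d}" ?S] by auto
  have Sb: "card ?S \<le> b ^ max p 1"
  proof (cases "p = 0")
    case True
    have "{i. i < d \<and> real_point x ! i \<noteq> real_of_int (y ! i)} = ?S" using assms by auto
    then show ?thesis using True assms pdist_0[of "real_point x" d y] by simp
  next
    case False
    then have p: "p > 0" by simp
    let ?e = "\<lambda>i. \<bar>real_point x ! i - real_of_int (y ! i)\<bar> ^ p"
    have "real (card ?S) = (\<Sum>i\<in>?S. 1)" by simp
    also have "\<dots> \<le> (\<Sum>i\<in>?S. ?e i)"
    proof (rule sum_mono)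
      fix i assume i: "i \<in> ?S"
      then have "1 \<le> \<bar>x ! i - y ! i\<bar>" by auto
      then have "1 \<le> \<bar>real_point x ! i - real_of_int (y ! i)\<bar>" using i assms by simp
      then show "1 \<le> ?e i" by (rule one_le_power)
    qed
    also have "\<dots> \<le> (\<Sum>i<d. ?e i)" by (intro sum_mono2) auto
    also have "\<dots> = pdist p (real_point x) y ^ p"
      using assms p by (simp add: pdist_pos[of _ d] sum_nonneg)
    also have "\<dots> \<le> real b ^ p"
      using assms by (intro power_mono pdist_nonneg[where d = d]) auto
    finally have "real (card ?S) \<le> real (b ^ p)" by simp
    then have "card ?S \<le> b ^ p" by (simp only: of_nat_le_iff)
    moreover have "max p 1 = p" using p by simp
    ultimately show ?thesis by simp
  qed
  show ?thesis
  proof (cases "b \<le> d")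
    case True
    then show ?thesis using Sb by (simp add: min_def)
  next
    case False
    have "d \<le> d ^ max p 1" by (cases "d = 0") (auto intro: self_le_power)
    then show ?thesis using Sd False by (simp add: min_def)
  qed
qed

lemma coord_le_pdist:
  assumes "length x = d" "length y = d" "p > 0" "i < d"
  shows "real_of_int \<bar>x ! i - y ! i\<bar> \<le> pdist p (real_point x) y"
proof -
  let ?e = "\<lambda>i. \<bar>real_point x ! i - real_of_int (y ! i)\<bar>"
  have "?e i ^ p \<le> (\<Sum>i<d. ?e i ^ p)" using assms by (intro member_le_sum) auto
  then have "root p (?e i ^ p) \<le> root p (\<Sum>i<d. ?e i ^ p)" using assms by simp
  then show ?thesis using assms by (simp add: pdist_pos[of _ d] real_root_power_cancel)
qed

text \<open>A budget on either side is enough, so the lemma serves both for building a cheap kernel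
  clustering and for lifting one. In a cheap cluster all pairwise distances are at most
  \<open>b\<close>. Such pairs differ in few selected columns, hence by \<open>keep\<close> in
  selected columns only, and there \<open>near\<close> and \<open>far\<close> control what
  \<open>f\<close> does to the differences.\<close>

lemma lp_cost_transform_bounded:
  fixes f :: "nat \<Rightarrow> int \<Rightarrow> int" and b :: nat
  assumes K: "distinct K" "set K \<subseteq> {..<d}" and X: "\<And>i. i \<in> A \<Longrightarrow> length (X i) = d" and "finite A"
    and keep: "\<And>i j l. i \<in> A \<Longrightarrow> j \<in> A \<Longrightarrow> l < d \<Longrightarrow> X i ! l \<noteq> X j ! l
      \<Longrightarrow> card {l \<in> set K. X i ! l \<noteq> X j ! l} \<le> (min b d) ^ max p 1 \<Longrightarrow> l \<in> set K"
    and near: "\<And>l i j. l < d \<Longrightarrow> i \<in> A \<Longrightarrow> j \<in> A \<Longrightarrow> \<bar>X i ! l - X j ! l\<bar> \<le> int b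
      \<Longrightarrow> f l (X i ! l) - f l (X j ! l) = X i ! l - X j ! l"
    and far: "\<And>l i j. l < d \<Longrightarrow> i \<in> A \<Longrightarrow> j \<in> A \<Longrightarrow> \<bar>X i ! l - X j ! l\<bar> > int b
      \<Longrightarrow> \<bar>f l (X i ! l) - f l (X j ! l)\<bar> > int b"
    and cost: "lp_cost p d X A \<le> real b \<or> lp_cost p (length K) (\<lambda>i. map (\<lambda>l. f l (X i ! l)) K) A \<le> real b"
  shows "lp_cost p (length K) (\<lambda>i. map (\<lambda>l. f l (X i ! l)) K) A = lp_cost p d X A"
proof -
  let ?Y = "\<lambda>i. map (\<lambda>l. f l (X i ! l)) K"
  have inj: "X i ! l = X j ! l" if "l < d" "i \<in> A" "j \<in> A" "f l (X i ! l) = f l (X j ! l)" for l i j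
    using near[OF that(1-3)] far[OF that(1-3)] that(4) by linarith
  have Kd: "l < d" if "l \<in> set K" for l using K(2) that by auto
  have close_d: "{l. l < d \<and> X i ! l \<noteq> X j ! l} \<subseteq> set K \<and> (p > 0 \<longrightarrow> (\<forall>l<d. \<bar>X i ! l - X j ! l\<bar> \<le> int b))"
    if ij: "i \<in> A" "j \<in> A" and le: "pdist p (real_point (X i)) (X j) \<le> real b" for i j
  proof -
    have "card {l \<in> set K. X i ! l \<noteq> X j ! l} \<le> card {l. l < d \<and> X i ! l \<noteq> X j ! l}"
      using Kd by (intro card_mono) auto
    also have "\<dots> \<le> (min b d) ^ max p 1"
      using X ij le by (intro card_diff_le_pdist) auto
    finally have "l \<in> set K" if "l < d" "X i ! l \<noteq> X j ! l" for l
      using keep[OF ij that] by simp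
    moreover have "\<bar>X i ! l - X j ! l\<bar> \<le> int b" if "p > 0" "l < d" for l
    proof -
      have "real_of_int \<bar>X i ! l - X j ! l\<bar> \<le> real b"
        using coord_le_pdist[OF X[OF ij(1)] X[OF ij(2)] that] le by linarith
      then show ?thesis by linarith
    qed
    ultimately show ?thesis by auto
  qed
  \<comment> \<open>The converse direction: by \<open>far\<close>, a small difference of images
    comes from a small difference, which \<open>near\<close> then shows to be the same.\<close>
  have close_K: "pdist p (real_point (X i)) (X j) \<le> real b"
    if ij: "i \<in> A" "j \<in> A" and le: "pdist p (real_point (?Y i)) (?Y j) \<le> real b" for i j
  proof -
    have lenY: "length (?Y i) = length K" "length (?Y j) = length K" by auto
    have Kl: "length K \<le> d"
      using card_mono[OF _ K(2)] K(1) by (simp add: distinct_card)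
    have "{l \<in> set K. X i ! l \<noteq> X j ! l} \<subseteq> (!) K ` {l. l < length K \<and> ?Y i ! l \<noteq> ?Y j ! l}"
    proof
      fix l assume l: "l \<in> {l \<in> set K. X i ! l \<noteq> X j ! l}"
      then obtain m where m: "m < length K" "K ! m = l" by (auto simp: in_set_conv_nth)
      then have "?Y i ! m \<noteq> ?Y j ! m" using l inj[of l i j] ij Kd[of l] by auto
      then show "l \<in> (!) K ` {l. l < length K \<and> ?Y i ! l \<noteq> ?Y j ! l}" using m by blast
    qed
    then have "card {l \<in> set K. X i ! l \<noteq> X j ! l} \<le> card {l. l < length K \<and> ?Y i ! l \<noteq> ?Y j ! l}"
      by (rule surj_card_le[rotated]) simp
    also have "\<dots> \<le> (min b (length K)) ^ max p 1"
      by (rule card_diff_le_pdist[OF lenY le])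
    also have "\<dots> \<le> (min b d) ^ max p 1" using Kl by (intro power_mono) auto
    finally have inK: "l \<in> set K" if "l < d" "X i ! l \<noteq> X j ! l" for l
      using keep[OF ij that] by simp
    define ix where "ix = (\<lambda>l. SOME m. m < length K \<and> K ! m = l)"
    have ix: "ix l < length K" "K ! ix l = l" if "l \<in> set K" for l
    proof -
      have "\<exists>m. m < length K \<and> K ! m = l" using that by (simp add: in_set_conv_nth)
      from someI_ex[OF this] show "ix l < length K" "K ! ix l = l" by (simp_all add: ix_def)
    qed
    have diff: "f l (X i ! l) - f l (X j ! l) = X i ! l - X j ! l" if l: "l \<in> set K" "p > 0" for l
    proof -
      have "real_of_int \<bar>?Y i ! ix l - ?Y j ! ix l\<bar> \<le> real b"
        using coord_le_pdist[OF lenY l(2) ix(1)[OF l(1)]] le by linarith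
      then have "\<bar>f l (X i ! l) - f l (X j ! l)\<bar> \<le> int b" using ix[OF l(1)] by simp
      then show ?thesis using near[OF Kd[OF l(1)] ij] far[OF Kd[OF l(1)] ij] by linarith
    qed
    have "inj_on ix (set K)" using ix(2) by (metis inj_onI)
    then have "pdist p (real_point (X i)) (X j) \<le> pdist p (real_point (?Y i)) (?Y j)"
    proof (intro pdist_le_coordwise[where g = ix and d = "length K" and d' = d, OF _ _ _ _ refl])
      let ?S = "{l. l < d \<and> real_point (X i) ! l \<noteq> real_of_int (X j ! l)}"
      have S: "l \<in> set K \<and> X i ! l \<noteq> X j ! l" if "l \<in> ?S" for l
        using that inK[of l] X[OF ij(1)] by auto
      then show "inj_on ix ?S" using \<open>inj_on ix (set K)\<close> by (meson inj_on_subset subsetI)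
      show "ix ` ?S \<subseteq> {..<length K}" using S ix(1) by auto
      show "real_point (?Y i) ! ix l \<noteq> real_of_int (?Y j ! ix l)" if "l \<in> ?S" for l
        using S[OF that] ix[of l] inj[of l i j] ij Kd[of l] by auto
      show "\<bar>real_point (X i) ! l - real_of_int (X j ! l)\<bar> \<le> \<bar>real_point (?Y i) ! ix l - real_of_int (?Y j ! ix l)\<bar>"
        if "l \<in> ?S" "p > 0" for l
      proof -
        have "l < d" using that by simp
        have "real_point (?Y i) ! ix l - real_of_int (?Y j ! ix l) = real_of_int (f l (X i ! l) - f l (X j ! l))"
          using S[OF that(1)] ix[of l] by simp
        also have "\<dots> = real_point (X i) ! l - real_of_int (X j ! l)"
          using diff[of l] S[OF that(1)] that X[OF ij(1)] \<open>l < d\<close> by simp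
        finally show ?thesis by simp
      qed
    qed (use X ij in auto)
    then show ?thesis using le by linarith
  qed
  have close: "pdist p (real_point (X i)) (X j) \<le> real b" if ij: "i \<in> A" "j \<in> A" for i j
    using cost
  proof
    assume *: "lp_cost p d X A \<le> real b"
    interpret integral_metric "pdist p" "{c. length c = d}" "{x. length x = d}" real_point
      by (rule integral_metric_pdist)
    have "pdist p (real_point (X i)) (X j) \<le> cost X A"
      using X assms(4) ij by (intro D_le_cost) auto
    then show ?thesis using * by (simp add: lp_cost_eq)
  next
    assume *: "lp_cost p (length K) ?Y A \<le> real b"
    interpret integral_metric "pdist p" "{c. length c = length K}" "{x. length x = length K}" real_point
      by (rule integral_metric_pdist)
    have "pdist p (real_point (?Y i)) (?Y j) \<le> cost ?Y A"
      using assms(4) ij by (intro D_le_cost[of ?Y A i j]) auto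
    then show ?thesis using * by (intro close_K ij) (simp add: lp_cost_eq)
  qed
  show ?thesis
  proof (rule lp_cost_transform[OF K X])
    show "X i ! l = X j ! l" if "l < d" "l \<notin> set K" "i \<in> A" "j \<in> A" for l i j
      using close_d[OF that(3,4) close[OF that(3,4)]] that(1,2) by blast
    show "f l (X i ! l) - f l (X j ! l) = X i ! l - X j ! l"
      if "p > 0" "l \<in> set K" "i \<in> A" "j \<in> A" for l i j
      using close_d[OF that(3,4) close[OF that(3,4)]] that(1) Kd[OF that(2)] near[OF Kd[OF that(2)] that(3,4)]
      by blast
    show "X i ! l = X j ! l"
      if "l \<in> set K" "i \<in> A" "j \<in> A" "f l (X i ! l) = f l (X j ! l)" for l i j
      using inj[OF Kd[OF that(1)] that(2-4)] .
  qed
qed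

subsection \<open>The number of greedily selected coordinates\<close>

text \<open>Polynomials are a convenient vector space without a fixed dimension: the monomials
  \<open>monom 1 i\<close> play the role of unit vectors.\<close>

interpretation poly_space: vector_space "smult :: real \<Rightarrow> real poly \<Rightarrow> real poly"
  by standard (auto simp: smult_add_right smult_add_left)

definition separations :: "(nat \<Rightarrow> int) list \<Rightarrow> nat \<Rightarrow> nat \<Rightarrow> nat" where
  "separations K i j = length (filter (\<lambda>f. f i \<noteq> f j) K)"

text \<open>The head is the column selected last; it is judged by the columns selected before it,
  which form the tail.\<close>

fun greedy_columns :: "nat \<Rightarrow> nat \<Rightarrow> (nat \<Rightarrow> int) list \<Rightarrow> bool" where
  "greedy_columns T m [] \<longleftrightarrow> True"
| "greedy_columns T m (f # K) \<longleftrightarrow>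
    (\<exists>i<m. \<exists>j<m. f i \<noteq> f j \<and> separations K i j \<le> T) \<and> greedy_columns T m K"

text \<open>The pair of rows \<open>i\<close>, \<open>j\<close> is represented by the vector \<open>e\<^sub>i - e\<^sub>j\<close>, a column by a linear form.
  At each time the vectors of the pairs with few separations have a basis among themselves, and a
  selected column does not vanish on this basis.  Going back in time the bases can be chosen
  increasing, so each vector of the last one is hit by at most \<open>T + 1\<close> columns.\<close>

lemma length_greedy_columns:
  assumes "greedy_columns T m K"
  shows "length K \<le> m * (T + 1)"
proof -
  define e :: "nat \<Rightarrow> nat \<Rightarrow> real poly" where "e = (\<lambda>i j. monom 1 i - monom 1 j)"
  define \<phi> :: "(nat \<Rightarrow> int) \<Rightarrow> real poly \<Rightarrow> real"
    where "\<phi> = (\<lambda>f q. \<Sum>i<m. real_of_int (f i) * coeff q i)"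
  define V where "V = {e i j | i j. i < m \<and> j < m}"
  define cnt where "cnt = (\<lambda>K q. length (filter (\<lambda>f. \<phi> f q \<noteq> 0) K))"
  define C where "C = (\<lambda>K. {q \<in> V. cnt K q \<le> T})"
  have \<phi>_e: "\<phi> f (e i j) = real_of_int (f i - f j)" if "i < m" "j < m" for f i j
  proof -
    have "\<phi> f (e i j) = (\<Sum>l<m. (if l = i then real_of_int (f l) else 0) - (if l = j then real_of_int (f l) else 0))"
      unfolding \<phi>_def e_def by (intro sum.cong) (auto simp: right_diff_distrib)
    then show ?thesis using that by (simp add: sum_subtractf)
  qed
  have \<phi>_span: "\<phi> f q = 0" if q: "q \<in> poly_space.span E" and E: "\<And>q. q \<in> E \<Longrightarrow> \<phi> f q = 0" for f q E
    using q
  proof (induction rule: poly_space.span_induct)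
    case base
    show ?case
    proof (rule poly_space.subspaceI)
      show "0 \<in> Collect (\<lambda>q. \<phi> f q = 0)" by (simp add: \<phi>_def)
      show "q + r \<in> Collect (\<lambda>q. \<phi> f q = 0)" if "q \<in> Collect (\<lambda>q. \<phi> f q = 0)" "r \<in> Collect (\<lambda>q. \<phi> f q = 0)"
        for q r using that by (simp add: \<phi>_def distrib_left sum.distrib)
      have "\<phi> f (smult c q) = c * \<phi> f q" for c q
        by (simp add: \<phi>_def sum_distrib_left mult.left_commute)
      then show "smult c q \<in> Collect (\<lambda>q. \<phi> f q = 0)" if "q \<in> Collect (\<lambda>q. \<phi> f q = 0)" for c q
        using that by simp
    qed
  qed (rule E)
  have cnt_e: "cnt K (e i j) = separations K i j" if "i < m" "j < m" for K i j
    using \<phi>_e[OF that] by (simp add: cnt_def separations_def)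
  have finite_card: "finite E \<and> card E \<le> m" if "poly_space.independent E" "E \<subseteq> V" for E
  proof -
    let ?U = "(\<lambda>i. monom 1 i :: real poly) ` {..<m}"
    note EV = that(2)
    have "E \<subseteq> poly_space.span ?U"
    proof
      fix q assume "q \<in> E"
      then obtain i j where "i < m" "j < m" "q = e i j" using EV by (auto simp: V_def)
      then show "q \<in> poly_space.span ?U"
        unfolding e_def by (simp add: poly_space.span_diff poly_space.span_base)
    qed
    then have "finite E \<and> card E \<le> card ?U"
      by (intro poly_space.independent_span_bound that(1)) auto
    then show ?thesis using card_image_le[of "{..<m}" "\<lambda>i. monom 1 i :: real poly"] by auto
  qed
  \<comment> \<open>\<open>K1\<close> holds the columns selected up to some time and
    \<open>K2\<close> the later ones. A basis vector \<open>q\<close> can still be hit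
    \<open>Suc T - cnt K1 q\<close> times, and every later column uses up some of this
    capacity.\<close>
  have "\<exists>E\<subseteq>C K1. poly_space.independent E \<and> C K1 \<subseteq> poly_space.span E
      \<and> length K2 \<le> (\<Sum>q\<in>E. Suc T - cnt K1 q)"
    if "greedy_columns T m (K2 @ K1)" for K1 K2
    using that
  proof (induction K2 arbitrary: K1 rule: rev_induct)
    case Nil
    obtain E where "E \<subseteq> C K1" "poly_space.independent E" "C K1 \<subseteq> poly_space.span E"
      by (rule poly_space.maximal_independent_subset)
    then show ?case by auto
  next
    case (snoc f K2)
    obtain E1 where E1: "E1 \<subseteq> C (f # K1)" "poly_space.independent E1"
      "length K2 \<le> (\<Sum>q\<in>E1. Suc T - cnt (f # K1) q)"
      using snoc.IH[of "f # K1"] snoc.prems by auto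
    have mono: "cnt (f # K1) q = cnt K1 q + of_bool (\<phi> f q \<noteq> 0)" for q by (simp add: cnt_def)
    then have "E1 \<subseteq> C K1" using E1(1) by (auto simp: C_def)
    then obtain E where E: "E1 \<subseteq> E" "E \<subseteq> C K1" "poly_space.independent E" "C K1 \<subseteq> poly_space.span E"
      by (rule poly_space.maximal_independent_subset_extend[OF _ E1(2)])
    have "greedy_columns T m (f # K1)"
    proof -
      have "greedy_columns T m (L @ L') \<Longrightarrow> greedy_columns T m L'" for L L' by (induction L) auto
      from this[of K2 "f # K1"] snoc.prems show ?thesis by simp
    qed
    then obtain i j where ij: "i < m" "j < m" "f i \<noteq> f j" "separations K1 i j \<le> T" by auto
    then have "e i j \<in> C K1" using cnt_e by (auto simp: C_def V_def)
    moreover have "\<phi> f (e i j) \<noteq> 0" using \<phi>_e[of i j f] ij by simp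
    ultimately obtain q where q: "q \<in> E" "\<phi> f q \<noteq> 0" using \<phi>_span[of "e i j" E f] E(4) by blast
    have finE: "finite E" using finite_card[OF E(3)] E(2) by (auto simp: C_def)
    \<comment> \<open>The column \<open>f\<close> hits \<open>q\<close>. If \<open>q\<close> is in
      \<open>E1\<close>, its capacity was larger by 1 before \<open>f\<close>; otherwise its
      positive capacity is new in the sum.\<close>
    have "(\<Sum>q\<in>E1. Suc T - cnt (f # K1) q) < (\<Sum>q\<in>E. Suc T - cnt K1 q)"
    proof -
      let ?g = "\<lambda>q. if q \<in> E1 then Suc T - cnt (f # K1) q else 0"
      have "(\<Sum>q\<in>E1. Suc T - cnt (f # K1) q) = sum ?g E"
        using finE E(1) by (intro sum.mono_neutral_cong_left) auto
      also have "\<dots> < (\<Sum>q\<in>E. Suc T - cnt K1 q)"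
      proof (rule sum_strict_mono_ex1[OF finE])
        show "\<forall>q\<in>E. ?g q \<le> Suc T - cnt K1 q" using mono by auto
        have "cnt K1 q \<le> T" using q(1) E(2) by (auto simp: C_def)
        then have "?g q < Suc T - cnt K1 q" using q(2) mono[of q] by auto
        then show "\<exists>q\<in>E. ?g q < Suc T - cnt K1 q" using q(1) by blast
      qed
      finally show ?thesis .
    qed
    then show ?case using E E1(3) by (intro exI[of _ E]) auto
  qed
  from this[of K "[]"] assms obtain E where E: "E \<subseteq> C []" "poly_space.independent E"
    "length K \<le> (\<Sum>q\<in>E. Suc T - cnt [] q)" by auto
  note E(3)
  also have "(\<Sum>q\<in>E. Suc T - cnt [] q) \<le> (\<Sum>q\<in>E. Suc T)" by (intro sum_mono) simp
  also have "\<dots> = card E * Suc T" by simp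
  also have "\<dots> \<le> m * Suc T"
    using finite_card[OF E(2)] E(1) by (intro mult_right_mono) (auto simp: C_def)
  finally show ?thesis by simp
qed

subsection \<open>Compressing the gaps between coordinates\<close>

text \<open>\<open>H\<close> holds the indices of the blocks that contain a value.  Only the two successors of such a
  block raise the new index, so two such blocks stay equal, neighbors or further apart.\<close>

definition cap_rank :: "nat set \<Rightarrow> nat \<Rightarrow> nat" where
  "cap_rank H h = card {g. g \<le> h \<and> (\<exists>x\<in>H. g = Suc x \<or> g = Suc (Suc x))}"

lemma finite_cap_rank: "finite {g. g \<le> h \<and> (\<exists>x\<in>H. g = Suc x \<or> g = Suc (Suc x))}"
  by (rule finite_subset[of _ "{..h}"]) auto

lemma cap_rank_le: "cap_rank H h \<le> h"
proof -
  have "cap_rank H h \<le> card {1..h}"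
    unfolding cap_rank_def by (intro card_mono) auto
  then show ?thesis by simp
qed

lemma cap_rank_le_card:
  assumes "finite H"
  shows "cap_rank H h \<le> 2 * card H"
proof -
  have "cap_rank H h \<le> card (Suc ` H \<union> (\<lambda>x. Suc (Suc x)) ` H)"
    unfolding cap_rank_def using assms by (intro card_mono) auto
  also have "\<dots> \<le> card (Suc ` H) + card ((\<lambda>x. Suc (Suc x)) ` H)" by (rule card_Un_le)
  also have "\<dots> \<le> 2 * card H"
    using card_image_le[OF assms, of Suc] card_image_le[OF assms, of "\<lambda>x. Suc (Suc x)"] by simp
  finally show ?thesis .
qed

lemma cap_rank_0 [simp]: "cap_rank H 0 = 0"
proof -
  have "{g. g \<le> 0 \<and> (\<exists>x\<in>H. g = Suc x \<or> g = Suc (Suc x))} = {}" by auto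
  then show ?thesis by (simp only: cap_rank_def card.empty)
qed

lemma cap_rank_diff:
  assumes "h \<le> h'"
  shows "cap_rank H h' = cap_rank H h + card {g. h < g \<and> g \<le> h' \<and> (\<exists>x\<in>H. g = Suc x \<or> g = Suc (Suc x))}"
proof -
  let ?P = "\<lambda>g. \<exists>x\<in>H. g = Suc x \<or> g = Suc (Suc x)"
  have "{g. g \<le> h' \<and> ?P g} = {g. g \<le> h \<and> ?P g} \<union> {g. h < g \<and> g \<le> h' \<and> ?P g}"
    using assms by auto
  moreover have "finite {g. h < g \<and> g \<le> h' \<and> ?P g}"
    by (rule finite_subset[of _ "{..h'}"]) auto
  moreover have "{g. g \<le> h \<and> ?P g} \<inter> {g. h < g \<and> g \<le> h' \<and> ?P g} = {}" by auto
  ultimately show ?thesis unfolding cap_rank_def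
    using card_Un_disjoint[OF finite_cap_rank, of "{g. h < g \<and> g \<le> h' \<and> ?P g}" h H] by simp
qed

lemma cap_rank_Suc: "h \<in> H \<Longrightarrow> cap_rank H (Suc h) = Suc (cap_rank H h)"
proof -
  assume h: "h \<in> H"
  have "{g. h < g \<and> g \<le> Suc h \<and> (\<exists>x\<in>H. g = Suc x \<or> g = Suc (Suc x))} = {Suc h}"
    using h by (auto simp: le_Suc_eq)
  then show ?thesis using cap_rank_diff[of h "Suc h" H] by simp
qed

lemma cap_rank_ge:
  assumes "h \<in> H" "h + 2 \<le> h'"
  shows "cap_rank H h + 2 \<le> cap_rank H h'"
proof -
  have "{Suc h, Suc (Suc h)} \<subseteq> {g. h < g \<and> g \<le> h' \<and> (\<exists>x\<in>H. g = Suc x \<or> g = Suc (Suc x))}"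
    using assms by auto
  moreover have "finite {g. h < g \<and> g \<le> h' \<and> (\<exists>x\<in>H. g = Suc x \<or> g = Suc (Suc x))}"
    by (rule finite_subset[of _ "{..h'}"]) auto
  ultimately have "card {Suc h, Suc (Suc h)} \<le> card {g. h < g \<and> g \<le> h' \<and> (\<exists>x\<in>H. g = Suc x \<or> g = Suc (Suc x))}"
    by (rule card_mono[rotated])
  then show ?thesis using cap_rank_diff[of h h' H] assms(2) by simp
qed

definition compress_nat :: "nat \<Rightarrow> nat set \<Rightarrow> nat \<Rightarrow> nat" where
  "compress_nat w H a = cap_rank H (a div w) * w + a mod w"

lemma compress_nat_0 [simp]: "compress_nat w H 0 = 0"
  by (simp add: compress_nat_def)

lemma compress_nat_le: "compress_nat w H a \<le> a"
proof -
  have "cap_rank H (a div w) * w + a mod w \<le> a div w * w + a mod w"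
    using cap_rank_le by (intro add_mono mult_right_mono) auto
  then show ?thesis by (simp add: compress_nat_def)
qed

lemma compress_nat_less:
  assumes "finite H" "w > 0"
  shows "compress_nat w H a < (2 * card H + 1) * w"
proof -
  have "cap_rank H (a div w) * w \<le> (2 * card H) * w"
    using cap_rank_le_card[OF assms(1)] by (rule mult_right_mono) simp
  then have "cap_rank H (a div w) * w + a mod w < (2 * card H) * w + w"
    using assms(2) by (intro add_le_less_mono) auto
  then show ?thesis by (simp add: compress_nat_def)
qed

text \<open>Because of \<open>B < w\<close>, values at most \<open>B\<close> apart lie in the same
  block or in neighbors, whose ranks differ exactly as their indices do. Blocks further apart still
  have a whole block between them after compression, and its length exceeds
  \<open>B\<close>.\<close>

lemma compress_nat_diff:
  assumes "a \<le> b" "a div w \<in> H" "B < w"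
  shows "b - a \<le> B \<Longrightarrow> compress_nat w H b = compress_nat w H a + (b - a)"
    and "B < b - a \<Longrightarrow> B < compress_nat w H b - compress_nat w H a"
proof -
  have w: "w > 0" using assms(3) by simp
  define i j r s where "i = a div w" and "j = b div w" and "r = a mod w" and "s = b mod w"
  have ab: "a = i * w + r" "b = j * w + s" "r < w" "s < w"
    using w by (auto simp: i_def j_def r_def s_def)
  have ij: "i \<le> j" using assms(1) by (simp add: i_def j_def div_le_mono)
  have c: "compress_nat w H a = cap_rank H i * w + r" "compress_nat w H b = cap_rank H j * w + s"
    by (simp_all add: compress_nat_def i_def j_def r_def s_def)
  have near: "compress_nat w H b = compress_nat w H a + (b - a)" if "j \<le> Suc i"
  proof (cases "j = i")
    case True
    then have "b - a = s - r" "r \<le> s" using assms(1) ab(1,2) by simp_all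
    then show ?thesis unfolding c using True by simp
  next
    case False
    then have j: "j = Suc i" using that ij by simp
    then have "b - a = w + s - r" using ab by simp
    moreover have "cap_rank H j = Suc (cap_rank H i)"
      using cap_rank_Suc[of i H] assms(2) j by (simp add: i_def)
    ultimately show ?thesis unfolding c using ab(3) by simp
  qed
  have far: "B < b - a \<and> B < compress_nat w H b - compress_nat w H a" if "i + 2 \<le> j"
  proof -
    have *: "m * w + r + B < n * w + s" if "m + 2 \<le> n" for m n
    proof -
      have "(m + 2) * w \<le> n * w" using that by (intro mult_right_mono) auto
      then show ?thesis using ab(3) assms(3) by simp
    qed
    have "cap_rank H i + 2 \<le> cap_rank H j"
      using cap_rank_ge[of i H j] assms(2) that by (simp add: i_def)
    from *[OF this] *[OF that] show ?thesis unfolding c using ab(1,2) by linarith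
  qed
  show "b - a \<le> B \<Longrightarrow> compress_nat w H b = compress_nat w H a + (b - a)"
    using near far by (cases "j \<le> Suc i") auto
  show "B < b - a \<Longrightarrow> B < compress_nat w H b - compress_nat w H a"
    using near far by (cases "j \<le> Suc i") auto
qed

definition compress_int :: "nat \<Rightarrow> nat set \<Rightarrow> int \<Rightarrow> int" where
  "compress_int w H v = (if v < 0 then - int (compress_nat w H (nat \<bar>v\<bar>)) else int (compress_nat w H (nat \<bar>v\<bar>)))"

text \<open>Only absolute values are compressed. Values of opposite sign are compared through zero,
  where the difference is a sum, and this is why block 0 has to belong to \<open>H\<close>.\<close>

lemma compress_int_diff:
  assumes H: "0 \<in> H" "nat \<bar>u\<bar> div w \<in> H" "nat \<bar>v\<bar> div w \<in> H" and B: "B < w"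
  shows "\<bar>u - v\<bar> \<le> int B \<Longrightarrow> compress_int w H u - compress_int w H v = u - v"
    and "int B < \<bar>u - v\<bar> \<Longrightarrow> int B < \<bar>compress_int w H u - compress_int w H v\<bar>"
proof -
  let ?c = "compress_nat w H"
  have from_0: "a \<le> B \<Longrightarrow> ?c a = a" "B < a \<Longrightarrow> B < ?c a" for a
    using compress_nat_diff[of 0 a w H B] H(1) B by auto
  have same: "(\<bar>int a - int b\<bar> \<le> int B \<longrightarrow> int (?c a) - int (?c b) = int a - int b)
      \<and> (int B < \<bar>int a - int b\<bar> \<longrightarrow> int B < \<bar>int (?c a) - int (?c b)\<bar>)"
    if "a div w \<in> H" "b div w \<in> H" for a b
  proof (cases "a \<le> b")
    case True
    have mono: "?c a \<le> ?c b"
      using compress_nat_diff[OF True that(1) B] by (cases "b - a \<le> B") auto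
    have "?c b - ?c a = b - a" if "b - a \<le> B"
      using compress_nat_diff(1)[OF True _ B that] \<open>a div w \<in> H\<close> by simp
    moreover have "B < ?c b - ?c a" if "B < b - a"
      using compress_nat_diff(2)[OF True _ B that] \<open>a div w \<in> H\<close> by simp
    ultimately show ?thesis using True mono by (cases "b - a \<le> B") auto
  next
    case False
    then have ba: "b \<le> a" by simp
    have mono: "?c b \<le> ?c a"
      using compress_nat_diff[OF ba that(2) B] by (cases "a - b \<le> B") auto
    have "?c a - ?c b = a - b" if "a - b \<le> B"
      using compress_nat_diff(1)[OF ba _ B that] \<open>b div w \<in> H\<close> by simp
    moreover have "B < ?c a - ?c b" if "B < a - b"
      using compress_nat_diff(2)[OF ba _ B that] \<open>b div w \<in> H\<close> by simp
    ultimately show ?thesis using ba mono by (cases "a - b \<le> B") auto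
  qed
  have opp: "(int a + int b \<le> int B \<longrightarrow> ?c a = a \<and> ?c b = b) \<and> (int B < int a + int b \<longrightarrow> int B < int (?c a) + int (?c b))"
    for a b
    using from_0[of a] from_0[of b] by (cases "a \<le> B"; cases "b \<le> B") auto
  define a b where "a = nat \<bar>u\<bar>" and "b = nat \<bar>v\<bar>"
  have uv: "u = (if u < 0 then - int a else int a)" "v = (if v < 0 then - int b else int b)"
    by (auto simp: a_def b_def)
  have cuv: "compress_int w H u = (if u < 0 then - int (?c a) else int (?c a))"
    "compress_int w H v = (if v < 0 then - int (?c b) else int (?c b))"
    by (auto simp: compress_int_def a_def b_def)
  have s: "\<bar>int a - int b\<bar> \<le> int B \<Longrightarrow> int (?c a) - int (?c b) = int a - int b"
    "int B < \<bar>int a - int b\<bar> \<Longrightarrow> int B < \<bar>int (?c a) - int (?c b)\<bar>"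
    using same[of a b] H(2,3) by (auto simp: a_def b_def)
  have o: "int a + int b \<le> int B \<Longrightarrow> int (?c a) = int a \<and> int (?c b) = int b"
    "int B < int a + int b \<Longrightarrow> int B < int (?c a) + int (?c b)"
    using opp[of a b] by auto
  have "(\<bar>u - v\<bar> \<le> int B \<longrightarrow> compress_int w H u - compress_int w H v = u - v) \<and>
      (int B < \<bar>u - v\<bar> \<longrightarrow> int B < \<bar>compress_int w H u - compress_int w H v\<bar>)"
  proof (cases "u < 0"; cases "v < 0")
    assume "u < 0" "v < 0"
    then have "u = - int a" "v = - int b" "compress_int w H u = - int (?c a)" "compress_int w H v = - int (?c b)"
      using uv cuv by simp_all
    then show ?thesis using s by linarith
  next
    assume "u < 0" "\<not> v < 0"
    then have "u = - int a" "v = int b" "compress_int w H u = - int (?c a)" "compress_int w H v = int (?c b)"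
      using uv cuv by simp_all
    then show ?thesis using o by linarith
  next
    assume "\<not> u < 0" "v < 0"
    then have "u = int a" "v = - int b" "compress_int w H u = int (?c a)" "compress_int w H v = - int (?c b)"
      using uv cuv by simp_all
    then show ?thesis using o by linarith
  next
    assume "\<not> u < 0" "\<not> v < 0"
    then have "u = int a" "v = int b" "compress_int w H u = int (?c a)" "compress_int w H v = int (?c b)"
      using uv cuv by simp_all
    then show ?thesis using s by linarith
  qed
  then show "\<bar>u - v\<bar> \<le> int B \<Longrightarrow> compress_int w H u - compress_int w H v = u - v"
    "int B < \<bar>u - v\<bar> \<Longrightarrow> int B < \<bar>compress_int w H u - compress_int w H v\<bar>" by blast+
qed

subsection \<open>List operations used by the kernelization\<close>

definition nub :: "'a list \<Rightarrow> 'a list" where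
  "nub xs = fold (\<lambda>y u. if y \<in> set u then u else y # u) xs []"

lemma nub_props: "distinct (nub xs) \<and> set (nub xs) = set xs"
proof -
  have "distinct us \<Longrightarrow> distinct (fold (\<lambda>y u. if y \<in> set u then u else y # u) xs us)
      \<and> set (fold (\<lambda>y u. if y \<in> set u then u else y # u) xs us) = set xs \<union> set us" for us
    by (induction xs arbitrary: us) auto
  from this[of "[]"] show ?thesis by (simp add: nub_def)
qed

lemma distinct_nub [simp]: "distinct (nub xs)" and set_nub [simp]: "set (nub xs) = set xs"
  by (rule nub_props[THEN conjunct1], rule nub_props[THEN conjunct2])

lemma polytime_nub [polytime_intros]:
  assumes "polytime a (enc_list b) l" "eq_polytime b"
  shows "polytime a (enc_list b) (\<lambda>x. nub (l x))"
  unfolding nub_def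
proof (rule polytime_fold_linear[where K = 1])
  show "dsize (enc_list b (if y \<in> set u then u else y # u)) \<le> dsize (enc_list b u) + 1 * dsize (b y) + 1" for u y
    by simp
qed (rule assms polytime_intros)+

text \<open>The first component is the incomplete piece, which is the final remainder; the second
  collects the full pieces of length \<open>s\<close>.\<close>

definition chunks :: "nat \<Rightarrow> 'a list \<Rightarrow> 'a list \<times> 'a list list" where
  "chunks s xs = fold (\<lambda>i u. if Suc (length (fst u)) = s then ([], (i # fst u) # snd u) else (i # fst u, snd u))
    xs ([], [])"

lemma polytime_chunks [polytime_intros]:
  assumes "polytime a enc_nat s" "polytime a (enc_list b) l"
  shows "polytime a (enc_prod (enc_list b) (enc_list (enc_list b))) (\<lambda>x. chunks (s x) (l x))"
  unfolding chunks_def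
proof (rule polytime_fold_linear[where K = 3])
  fix x i and u :: "'b list \<times> 'b list list"
  show "dsize (enc_prod (enc_list b) (enc_list (enc_list b)) (if Suc (length (fst u)) = s x then ([], (i # fst u) # snd u) else (i # fst u, snd u)))
    \<le> dsize (enc_prod (enc_list b) (enc_list (enc_list b)) u) + 3 * dsize (b i) + 3"
    by (simp add: enc_prod_eq)
qed (rule assms polytime_comp[OF assms(1)] polytime_intros)+

lemma enumerate_less: "map snd (filter (\<lambda>u. fst u < i + n) (List.enumerate i xs)) = take n xs"
  and enumerate_not_less: "map snd (filter (\<lambda>u. \<not> fst u < i + n) (List.enumerate i xs)) = drop n xs"
proof (induction xs arbitrary: i n)
  case (Cons x xs)
  {
    case 1
    show ?case
    proof (cases n)
      case 0
      have "\<not> fst u < i" if "u \<in> set (List.enumerate i (x # xs))" for u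
        using that by (auto simp: in_set_enumerate_eq)
      then have "filter (\<lambda>u. fst u < i) (List.enumerate i (x # xs)) = []"
        by (simp only: filter_empty_conv) blast
      then show ?thesis using 0 by (simp only: add_0_right list.map take_0)
    next
      case (Suc m)
      then show ?thesis using Cons.IH(1)[of "Suc i" m] by simp
    qed
  next
    case 2
    show ?case
    proof (cases n)
      case 0
      have "\<not> fst u < i" if "u \<in> set (List.enumerate i (x # xs))" for u
        using that by (auto simp: in_set_enumerate_eq)
      then have "filter (\<lambda>u. \<not> fst u < i) (List.enumerate i (x # xs)) = List.enumerate i (x # xs)"
        by (intro filter_True) blast
      then show ?thesis using 0 by (simp only: add_0_right map_snd_enumerate drop_0)
    next
      case (Suc m)
      then show ?thesis using Cons.IH(2)[of "Suc i" m] by simp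
    qed
  }
qed simp_all

lemma polytime_take [polytime_intros]:
  assumes "polytime a enc_nat t" "polytime a (enc_list b) l"
  shows "polytime a (enc_list b) (\<lambda>x. take (t x) (l x))"
proof -
  have "polytime a (enc_list b) (\<lambda>x. map snd (filter (\<lambda>u. fst u < t x) (List.enumerate 0 (l x))))"
    by (rule assms polytime_comp[OF assms(1)] polytime_intros)+
  then show ?thesis by (simp only: enumerate_less[where i = 0, unfolded add_0])
qed

lemma polytime_drop [polytime_intros]:
  assumes "polytime a enc_nat t" "polytime a (enc_list b) l"
  shows "polytime a (enc_list b) (\<lambda>x. drop (t x) (l x))"
proof -
  have "polytime a (enc_list b) (\<lambda>x. map snd (filter (\<lambda>u. \<not> fst u < t x) (List.enumerate 0 (l x))))"
    by (rule assms polytime_comp[OF assms(1)] polytime_intros)+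
  then show ?thesis by (simp only: enumerate_not_less[where i = 0, unfolded add_0])
qed

lemma map_fst_enumerate_0: "map fst (List.enumerate 0 xs) = [0..<length xs]"
  by (simp add: enumerate_eq_zip)

text \<open>Subtraction by counting the indices in an interval, possible since the minuend is at
  most the length of a list at hand.\<close>

lemma polytime_minus_bounded:
  assumes "polytime a (enc_list b) l" "polytime a enc_nat s" "polytime a enc_nat c"
    and "\<And>x. s x \<le> length (l x)"
  shows "polytime a enc_nat (\<lambda>x. s x - c x)"
proof -
  have "length (filter (\<lambda>i. i < s x \<and> c x \<le> i) (map fst (List.enumerate 0 (l x)))) = s x - c x" for x
  proof -
    have "length (filter (\<lambda>i. i < s x \<and> c x \<le> i) [0..<length (l x)])
        = card (set (filter (\<lambda>i. i < s x \<and> c x \<le> i) [0..<length (l x)]))"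
      by (rule distinct_card[symmetric]) simp
    also have "set (filter (\<lambda>i. i < s x \<and> c x \<le> i) [0..<length (l x)]) = {c x..<s x}"
      using assms(4)[of x] by auto
    finally show ?thesis by (simp only: map_fst_enumerate_0 card_atLeastLessThan)
  qed
  moreover have "polytime a enc_nat (\<lambda>x. length (filter (\<lambda>i. i < s x \<and> c x \<le> i) (map fst (List.enumerate 0 (l x)))))"
    by (rule assms(1,2,3) polytime_comp[OF assms(2)] polytime_comp[OF assms(3)] polytime_intros)+
  ultimately show ?thesis by simp
qed

text \<open>The power is built in unary as the length of a list, multiplying by repeated
  concatenation. For a fixed exponent this is polynomial because the base is at most the length of
  \<open>l x\<close>.\<close>

lemma polytime_power_bounded:
  assumes "polytime a (enc_list b) l" "polytime a enc_nat c"
  shows "polytime a enc_nat (\<lambda>x. min (c x) (length (l x)) ^ n)"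
proof -
  let ?bl = "\<lambda>x. filter (\<lambda>i. i < c x) (map fst (List.enumerate 0 (l x)))"
  have bl: "polytime a (enc_list enc_nat) ?bl"
    by (rule assms polytime_comp[OF assms(2)] polytime_intros)+
  have len: "length (?bl x) = min (c x) (length (l x))" for x
  proof -
    have "length (filter (\<lambda>i. i < c x) [0..<length (l x)]) = card (set (filter (\<lambda>i. i < c x) [0..<length (l x)]))"
      by (rule distinct_card[symmetric]) simp
    also have "set (filter (\<lambda>i. i < c x) [0..<length (l x)]) = {..<min (c x) (length (l x))}" by auto
    finally show ?thesis by (simp only: map_fst_enumerate_0 card_lessThan)
  qed
  have "\<exists>f. polytime a (enc_list (\<lambda>_ :: unit. Atom)) f \<and> (\<forall>x. length (f x) = min (c x) (length (l x)) ^ n)"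
  proof (induction n)
    case 0
    show ?case by (rule exI[of _ "\<lambda>_. [()]"]) (simp add: polytime_const)
  next
    case (Suc n)
    then obtain f where f: "polytime a (enc_list (\<lambda>_ :: unit. Atom)) f"
      "\<And>x. length (f x) = min (c x) (length (l x)) ^ n" by blast
    have "polytime a (enc_list (\<lambda>_ :: unit. Atom)) (\<lambda>x. concat (map (\<lambda>_. f x) (?bl x)))"
      by (rule bl polytime_comp[OF f(1)] polytime_intros)+
    moreover have "length (concat (map (\<lambda>_. f x) (?bl x))) = min (c x) (length (l x)) ^ Suc n" for x
    proof -
      have "length (concat (map (\<lambda>_. f x) ys)) = length ys * length (f x)" for ys :: "nat list"
        by (induction ys) auto
      then show ?thesis using len f(2) by simp
    qed
    ultimately show ?case by (intro exI[of _ "\<lambda>x. concat (map (\<lambda>_. f x) (?bl x))"]) blast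
  qed
  then obtain f where f: "polytime a (enc_list (\<lambda>_ :: unit. Atom)) f"
    "\<And>x. length (f x) = min (c x) (length (l x)) ^ n" by blast
  from polytime_length[OF f(1)] show ?thesis by (simp only: f(2))
qed

subsection \<open>Compression of a column\<close>

text \<open>Division with remainder by \<open>2 ^ length bs\<close>. The digits of the remainder end
  up with the most significant one first, as \<open>of_bits\<close> expects them.\<close>

definition split_low :: "bool list \<Rightarrow> nat \<Rightarrow> nat \<times> bool list" where
  "split_low bs n = fold (\<lambda>_ u. (fst u div 2, odd (fst u) # snd u)) bs (n, [])"

lemma split_low: "fst (split_low bs n) = n div 2 ^ length bs"
  "of_bits (snd (split_low bs n)) r = r * 2 ^ length bs + n mod 2 ^ length bs"
proof -
  have *: "fst (fold (\<lambda>_ u. (fst u div 2, odd (fst u) # snd u)) bs (n, st)) = n div 2 ^ length bs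
    \<and> of_bits (snd (fold (\<lambda>_ u. (fst u div 2, odd (fst u) # snd u)) bs (n, st))) r
      = of_bits st (r * 2 ^ length bs + n mod 2 ^ length bs)" for st
  proof (induction bs arbitrary: n st)
    case (Cons b bs)
    have "n mod (2 * 2 ^ length bs) = 2 * (n div 2 mod 2 ^ length bs) + n mod 2"
      by (rule mod_mult2_eq)
    then have "r * (2 * 2 ^ length bs) + n mod (2 * 2 ^ length bs)
        = of_bool (odd n) + 2 * (r * 2 ^ length bs + n div 2 mod 2 ^ length bs)"
      by (simp add: mod_2_eq_odd)
    then show ?case using Cons.IH[of "n div 2" "odd n # st"]
      by (simp add: div_mult2_eq mult.left_commute)
  qed simp
  from *[of "[]"] show "fst (split_low bs n) = n div 2 ^ length bs"
    "of_bits (snd (split_low bs n)) r = r * 2 ^ length bs + n mod 2 ^ length bs"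
    by (auto simp: split_low_def)
qed

lemma polytime_split_low [polytime_intros]:
  assumes "polytime a (enc_list enc_bool) f" "polytime a enc_nat g"
  shows "polytime a (enc_prod enc_nat (enc_list enc_bool)) (\<lambda>x. split_low (f x) (g x))"
  unfolding split_low_def
proof (rule polytime_fold_linear[where K = 4])
  fix b and u :: "nat \<times> bool list"
  have "dsize (enc_nat (fst u div 2)) \<le> dsize (enc_nat (fst u))"
    by (cases "fst u = 0") (auto simp: enc_nat_pos)
  then show "dsize (enc_prod enc_nat (enc_list enc_bool) (fst u div 2, odd (fst u) # snd u))
      \<le> dsize (enc_prod enc_nat (enc_list enc_bool) u) + 4 * dsize (enc_bool b) + 4"
    using dsize_enc_bool[of "odd (fst u)"] by (simp add: enc_prod_eq)
qed (rule assms polytime_intros)+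

text \<open>The positions counted by \<open>cap_rank\<close>, each listed once; the leading
  \<open>0\<close> makes block 0 one of the occupied blocks.\<close>

definition rank_list :: "nat \<Rightarrow> int list \<Rightarrow> nat list" where
  "rank_list B col = nub (concat (map (\<lambda>x. [Suc x, Suc (Suc x)])
    (0 # map (\<lambda>v. fst (split_low (bits B) (nat \<bar>v\<bar>))) col)))"

definition compress_abs :: "nat \<Rightarrow> int list \<Rightarrow> int \<Rightarrow> nat" where
  "compress_abs B col v = of_bits (snd (split_low (bits B) (nat \<bar>v\<bar>)))
    (length (filter (\<lambda>g. g \<le> fst (split_low (bits B) (nat \<bar>v\<bar>))) (rank_list B col)))"

definition compress :: "nat \<Rightarrow> int list \<Rightarrow> int \<Rightarrow> int" where
  "compress B col v = (if v < 0 then - int (compress_abs B col v) else int (compress_abs B col v))"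

definition high_parts :: "nat \<Rightarrow> int list \<Rightarrow> nat set" where
  "high_parts B col = insert 0 ((\<lambda>v. nat \<bar>v\<bar> div 2 ^ length (bits B)) ` set col)"

lemma compress_eq: "compress B col v = compress_int (2 ^ length (bits B)) (high_parts B col) v"
proof -
  let ?h = "fst (split_low (bits B) (nat \<bar>v\<bar>))"
  have "length (filter (\<lambda>g. g \<le> ?h) (rank_list B col)) = card (set (filter (\<lambda>g. g \<le> ?h) (rank_list B col)))"
    by (rule distinct_card[symmetric]) (simp add: rank_list_def)
  also have "set (filter (\<lambda>g. g \<le> ?h) (rank_list B col))
      = {g. g \<le> ?h \<and> (\<exists>x\<in>high_parts B col. g = Suc x \<or> g = Suc (Suc x))}"
    by (auto simp: rank_list_def high_parts_def split_low(1))
  finally have "length (filter (\<lambda>g. g \<le> ?h) (rank_list B col)) = cap_rank (high_parts B col) ?h"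
    unfolding cap_rank_def .
  then have "compress_abs B col v = compress_nat (2 ^ length (bits B)) (high_parts B col) (nat \<bar>v\<bar>)"
    unfolding compress_abs_def compress_nat_def split_low by (simp only:)
  then show ?thesis unfolding compress_def compress_int_def by (simp only:)
qed

lemma polytime_compress [polytime_intros]:
  assumes "polytime a enc_nat B" "polytime a (enc_list enc_int) col" "polytime a enc_int v"
  shows "polytime a enc_int (\<lambda>x. compress (B x) (col x) (v x))"
  unfolding compress_def compress_abs_def rank_list_def
  by (rule assms polytime_int_minus polytime_comp[OF assms(1)] polytime_comp[OF assms(2)] polytime_comp[OF assms(3)] polytime_intros)+

lemma length_bits_mono: "m \<le> n \<Longrightarrow> length (bits m) \<le> length (bits n)"
proof (induction n arbitrary: m rule: bits.induct)
  case (1 n)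
  show ?case
  proof (cases "m = 0")
    case False
    then show ?thesis using 1(1)[of "m div 2"] 1(2) by (simp add: bits_pos div_le_mono)
  qed simp
qed

lemma dsize_enc_nat_bounds: "2 * length (bits n) < dsize (enc_nat n)"
  "dsize (enc_nat n) \<le> 4 * length (bits n) + 1"
proof -
  have "2 * length bs < dsize (enc_list enc_bool bs) \<and> dsize (enc_list enc_bool bs) \<le> 4 * length bs + 1" for bs
  proof (induction bs)
    case (Cons b bs)
    then show ?case by (cases b) auto
  qed simp
  then show "2 * length (bits n) < dsize (enc_nat n)" "dsize (enc_nat n) \<le> 4 * length (bits n) + 1"
    unfolding enc_nat_bits by auto
qed

text \<open>Compression does not increase absolute values, but the digit 1 has a larger encoding
  than the digit 0, so sizes may still grow; the factor 2 covers this.\<close>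

lemma dsize_compress: "dsize (enc_int (compress B col v)) \<le> 2 * dsize (enc_int v)"
proof -
  let ?c = "compress_nat (2 ^ length (bits B)) (high_parts B col) (nat \<bar>v\<bar>)"
  have "length (bits ?c) \<le> length (bits (nat \<bar>v\<bar>))"
    by (intro length_bits_mono compress_nat_le)
  then have "dsize (enc_nat ?c) \<le> 2 * dsize (enc_nat (nat \<bar>v\<bar>))"
    using dsize_enc_nat_bounds[of "nat \<bar>v\<bar>"] dsize_enc_nat_bounds[of ?c] by linarith
  moreover have "nat \<bar>compress B col v\<bar> = ?c" by (simp add: compress_eq compress_int_def)
  moreover have "dsize (enc_bool (compress B col v < 0)) \<le> dsize (enc_bool (v < 0))"
  proof (cases "v < 0")
    case True
    then show ?thesis using dsize_enc_bool[of "compress B col v < 0"] by simp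
  next
    case False
    then have "\<not> compress B col v < 0" by (simp add: compress_eq compress_int_def)
    then show ?thesis using False by simp
  qed
  ultimately show ?thesis by (simp add: enc_int_def)
qed

subsection \<open>The kernelization\<close>

type_synonym input = "clust_inst \<times> nat"

abbreviation enc_input :: "input \<Rightarrow> data" where
  "enc_input \<equiv> enc_prod (enc_prod enc_nat (enc_prod (enc_list (enc_list enc_int)) enc_nat)) enc_nat"

definition input_points :: "input \<Rightarrow> int list list" where "input_points z = fst (snd (fst z))"
definition input_k :: "input \<Rightarrow> nat" where "input_k z = snd (snd (fst z))"
definition cluster_size :: "input \<Rightarrow> nat" where "cluster_size z = length (input_points z) div input_k z"

lemma polytime_input [polytime_intros]:
  assumes "polytime a enc_input h"
  shows "polytime a (enc_list (enc_list enc_int)) (\<lambda>x. input_points (h x))"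
    and "polytime a enc_nat (\<lambda>x. input_k (h x))"
    and "polytime a enc_nat (\<lambda>x. cluster_size (h x))"
  unfolding input_points_def input_k_def cluster_size_def by (rule assms polytime_intros)+

definition positions :: "input \<Rightarrow> int list \<Rightarrow> nat list" where
  "positions z y = map fst (filter (\<lambda>u. snd u = y) (List.enumerate 0 (input_points z)))"

definition uniform_clusters :: "input \<Rightarrow> nat list list" where
  "uniform_clusters z = concat (map (\<lambda>y. snd (chunks (cluster_size z) (positions z y))) (nub (input_points z)))"

definition residues :: "input \<Rightarrow> (int list \<times> nat list) list" where
  "residues z = filter (\<lambda>g. snd g \<noteq> [])
    (map (\<lambda>y. (y, fst (chunks (cluster_size z) (positions z y)))) (nub (input_points z)))"

lemma polytime_residues [polytime_intros]:
  assumes "polytime a enc_input h"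
  shows "polytime a (enc_list (enc_prod (enc_list enc_int) (enc_list enc_nat))) (\<lambda>x. residues (h x))"
    and "polytime a (enc_list (enc_list enc_nat)) (\<lambda>x. uniform_clusters (h x))"
  unfolding positions_def uniform_clusters_def residues_def
  by (rule assms polytime_comp[OF assms] polytime_intros)+

definition surplus :: "input \<Rightarrow> nat" where
  "surplus z = cluster_size z - Suc (2 * snd z)"

text \<open>With \<open>B = snd z\<close> this is the minimum of \<open>cluster_size z\<close> and
  \<open>2 * B + 1\<close>; more than \<open>2 * B\<close> points are what a cluster of cost at most
  \<open>B\<close> needs to have a majority point.\<close>

definition reduced_size :: "input \<Rightarrow> nat" where
  "reduced_size z = cluster_size z - surplus z"

text \<open>Entries \<open>(y, keep, removed)\<close>: the positions of the point \<open>y\<close> that stay in the instance and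
  those that are removed from it.\<close>

definition groups :: "input \<Rightarrow> (int list \<times> nat list \<times> nat list) list" where
  "groups z = map (\<lambda>g. (fst g, if snd z < length (snd g)
      then (drop (surplus z) (snd g), take (surplus z) (snd g)) else (snd g, []))) (residues z)"

definition kept :: "input \<Rightarrow> nat list" where
  "kept z = concat (map (\<lambda>g. fst (snd g)) (groups z))"

text \<open>These tests succeed whenever the optimum is positive and below
  \<open>(B + 1) / 2\<close>, so that a failure licenses the trivial output. Their success in turn
  gives the size bounds and a legal output instance.\<close>

definition reducible :: "input \<Rightarrow> bool" where
  "reducible z \<longleftrightarrow> kept z \<noteq> [] \<and> length (groups z) \<le> 2 * snd z
    \<and> length (kept z) mod reduced_size z = 0"

abbreviation enc_groups :: "(int list \<times> nat list \<times> nat list) list \<Rightarrow> data" where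
  "enc_groups \<equiv> enc_list (enc_prod (enc_list enc_int) (enc_prod (enc_list enc_nat) (enc_list enc_nat)))"

lemma polytime_surplus [polytime_intros]:
  assumes "polytime a enc_input h"
  shows "polytime a enc_nat (\<lambda>x. surplus (h x))"
  unfolding surplus_def
  by (rule polytime_minus_bounded[of a "enc_list enc_int" "\<lambda>x. input_points (h x)"], (rule assms polytime_intros)+)
    (simp add: cluster_size_def)

lemma polytime_reduced_size [polytime_intros]:
  assumes "polytime a enc_input h"
  shows "polytime a enc_nat (\<lambda>x. reduced_size (h x))"
  unfolding reduced_size_def
  by (rule polytime_minus_bounded[of a "enc_list enc_int" "\<lambda>x. input_points (h x)"], (rule assms polytime_intros)+)
    (simp add: cluster_size_def)

lemma polytime_groups [polytime_intros]:
  assumes "polytime a enc_input h"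
  shows "polytime a enc_groups (\<lambda>x. groups (h x))"
  unfolding groups_def by (rule assms polytime_comp[OF assms] polytime_intros)+

lemma polytime_kept [polytime_intros]:
  assumes "polytime a enc_input h"
  shows "polytime a (enc_list enc_nat) (\<lambda>x. kept (h x))"
    and "polytime a enc_bool (\<lambda>x. reducible (h x))"
  unfolding kept_def reducible_def by (rule assms polytime_comp[OF assms] polytime_intros)+

section \<open>Greedy selection and compression of columns\<close>

type_synonym rows = "(int list \<times> int list) list"

abbreviation enc_rows :: "rows \<Rightarrow> data" where
  "enc_rows \<equiv> enc_list (enc_prod (enc_list enc_int) (enc_list enc_int))"

definition separating :: "nat \<Rightarrow> rows \<Rightarrow> bool" where
  "separating T st \<longleftrightarrow> (\<exists>u\<in>set st. \<exists>v\<in>set st. hd_or 0 (fst u) \<noteq> hd_or 0 (fst v)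
    \<and> length (filter (\<lambda>w. fst w \<noteq> snd w) (zip (snd u) (snd v))) \<le> T)"

text \<open>A row consists of the coordinates still to be read and the selected ones, already
  compressed and in reverse order. Leaving exhausted rows alone keeps the size of arbitrary states
  from growing.\<close>

definition column_step :: "nat \<Rightarrow> nat \<Rightarrow> rows \<Rightarrow> rows" where
  "column_step B T st = (if separating T st
    then map (\<lambda>u. if fst u = [] then u
      else (tl (fst u), compress B (map (\<lambda>v. hd_or 0 (fst v)) st) (hd_or 0 (fst u)) # snd u)) st
    else map (\<lambda>u. (tl (fst u), snd u)) st)"

lemma polytime_column_step [polytime_intros]:
  assumes "polytime a enc_nat B" "polytime a enc_nat T" "polytime a enc_rows st"
  shows "polytime a enc_rows (\<lambda>x. column_step (B x) (T x) (st x))"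
  unfolding column_step_def separating_def
  by (rule assms polytime_comp[OF assms(1)] polytime_comp[OF assms(2)] polytime_comp[OF assms(3)] polytime_intros)+

definition select_columns :: "nat \<Rightarrow> nat \<Rightarrow> int list \<Rightarrow> rows \<Rightarrow> rows" where
  "select_columns B T row st = fold (\<lambda>_. column_step B T) row st"

lemma polytime_select_columns [polytime_intros]:
  assumes "polytime a enc_nat B" "polytime a enc_nat T" "polytime a (enc_list enc_int) row"
    "polytime a enc_rows st"
  shows "polytime a enc_rows (\<lambda>x. select_columns (B x) (T x) (row x) (st x))"
proof -
  \<comment> \<open>Unread coordinates weigh double because compression may double their size when
    they move to the second component; so the measure never increases.\<close>
  let ?w1 = "\<lambda>u. 2 * dsize (enc_list enc_int (fst u)) + dsize (enc_list enc_int (snd u)) + 2"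
  let ?w = "\<lambda>st. 1 + sum_list (map ?w1 st)"
  have w: "dsize (enc_rows st) \<le> ?w st" "?w st \<le> 3 * dsize (enc_rows st)" for st
    by (induction st) (auto simp: enc_prod_eq)
  obtain q where q: "\<And>x n. dsize (a x) \<le> n \<Longrightarrow> dsize (enc_rows (st x)) \<le> poly q n"
    using polytime_size[OF assms(4)] by blast
  show ?thesis unfolding select_columns_def
  proof (rule polytime_fold_measure[where w = ?w and b = enc_int])
    show "?w (st x) \<le> poly (3 * q) (dsize (a x))" for x
      using w(2)[of "st x"] q[OF order_refl, of x] by simp
    show "?w (column_step (B x) (T x) st) \<le> ?w st + poly 0 (dsize (a x) + dsize (enc_int y))" for x y st
    proof -
      have "sum_list (map ?w1 (map f st)) \<le> sum_list (map ?w1 st)" if "\<And>u. ?w1 (f u) \<le> ?w1 u" for f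
        unfolding map_map comp_def by (rule sum_list_mono) (rule that)
      moreover have "?w1 (if fst u = [] then u else (tl (fst u), compress (B x) col (hd_or 0 (fst u)) # snd u)) \<le> ?w1 u"
        for u col
        using dsize_compress[of "B x" col "hd_or 0 (fst u)"] by (cases "fst u") auto
      moreover have "?w1 (tl (fst u), snd u) \<le> ?w1 u" for u :: "int list \<times> int list"
        by (cases "fst u") auto
      ultimately show ?thesis by (simp add: column_step_def)
    qed
  qed (rule w(1) assms polytime_comp[OF assms(1)] polytime_comp[OF assms(2)] polytime_intros)+
qed

text \<open>The threshold is the bound of \<open>card_diff_le_pdist\<close>. The dimension is read
  off a remaining point, whose coordinate list can be counted, instead of the binary number in the
  instance.\<close>

definition final_rows :: "nat \<Rightarrow> input \<Rightarrow> rows" where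
  "final_rows p z = select_columns (snd z)
    (min (snd z) (length (hd_or [] (map fst (groups z)))) ^ max p 1)
    (hd_or [] (map fst (groups z))) (map (\<lambda>g. (fst g, [])) (groups z))"

definition kernel_points :: "nat \<Rightarrow> input \<Rightarrow> int list list" where
  "kernel_points p z = concat (map (\<lambda>w. map (\<lambda>_. snd (fst w)) (fst (snd (snd w)))) (zip (final_rows p z) (groups z)))"

definition reduce :: "nat \<Rightarrow> input \<Rightarrow> input" where
  "reduce p z = (if reducible z
    then ((length (hd_or [] (map snd (final_rows p z))), kernel_points p z, length (kept z) div reduced_size z), snd z)
    else ((1, [[0]], 1), 0))"

lemma polytime_final_rows [polytime_intros]:
  assumes "polytime a enc_input h"
  shows "polytime a enc_rows (\<lambda>x. final_rows p (h x))"
  unfolding final_rows_def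
  by (rule assms polytime_power_bounded polytime_comp[OF assms] polytime_intros)+

lemma polytime_reduce: "polytime enc_input enc_input (reduce p)"
proof -
  have "polytime enc_input enc_input (\<lambda>z. reduce p z)"
    unfolding reduce_def kernel_points_def by (rule polytime_intros)+
  then show ?thesis by simp
qed

section \<open>Lifting of solutions\<close>

definition default_clustering :: "input \<Rightarrow> nat list list" where
  "default_clustering z = snd (chunks (cluster_size z) (map fst (List.enumerate 0 (input_points z))))"

definition original_positions :: "input \<Rightarrow> nat list \<Rightarrow> nat list" where
  "original_positions z C = concat (map (\<lambda>i. map snd (filter (\<lambda>u. fst u = i) (List.enumerate 0 (kept z)))) C)"

text \<open>A point that holds the majority in \<open>C\<close> gets back here the copies that the
  reduction removed; its kept copies are too few to be a majority in two clusters.\<close>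

definition restore :: "input \<Rightarrow> nat list \<Rightarrow> nat list" where
  "restore z C = C @ concat (map (\<lambda>g. if length C < 2 * length (filter (\<lambda>q. q \<in> set (fst (snd g))) C)
    then snd (snd g) else []) (groups z))"

definition lifted :: "input \<Rightarrow> nat list list \<Rightarrow> nat list list" where
  "lifted z Cs = uniform_clusters z @ map (\<lambda>C. restore z (original_positions z C)) Cs"

text \<open>Restoring can fail to produce clusters of the right size. Where the ratio depends on it,
  this happens only for kernel solutions over budget, whose value \<open>B + 1\<close> no clustering
  exceeds.\<close>

definition lift :: "input \<times> input \<times> nat list list \<Rightarrow> nat list list" where
  "lift w = (if reducible (fst w) \<and> length (lifted (fst w) (snd (snd w))) = input_k (fst w)
      \<and> (\<forall>C\<in>set (lifted (fst w) (snd (snd w))). length C = cluster_size (fst w))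
    then lifted (fst w) (snd (snd w)) else default_clustering (fst w))"

lemma polytime_restore [polytime_intros]:
  assumes "polytime a enc_input h" "polytime a (enc_list enc_nat) f"
  shows "polytime a (enc_list enc_nat) (\<lambda>x. original_positions (h x) (f x))"
    and "polytime a (enc_list enc_nat) (\<lambda>x. restore (h x) (f x))"
  unfolding original_positions_def restore_def
  by (rule assms polytime_comp[OF assms(1)] polytime_comp[OF assms(2)] polytime_intros)+

lemma polytime_lifted [polytime_intros]:
  assumes "polytime a enc_input h" "polytime a (enc_list (enc_list enc_nat)) f"
  shows "polytime a (enc_list (enc_list enc_nat)) (\<lambda>x. lifted (h x) (f x))"
  unfolding lifted_def
  by (rule assms polytime_comp[OF assms(1)] polytime_comp[OF assms(2)] polytime_intros)+

lemma polytime_lift: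
  "polytime (enc_prod enc_input (enc_prod enc_input (enc_list (enc_list enc_nat)))) (enc_list (enc_list enc_nat)) lift"
proof -
  have "polytime (enc_prod enc_input (enc_prod enc_input (enc_list (enc_list enc_nat)))) (enc_list (enc_list enc_nat)) (\<lambda>w. lift w)"
    unfolding lift_def default_clustering_def by (rule polytime_intros)+
  then show ?thesis by simp
qed

subsection \<open>Selection of coordinates\<close>

definition column_map :: "nat \<Rightarrow> int list list \<Rightarrow> nat \<Rightarrow> int \<Rightarrow> int" where
  "column_map B Ys l = compress B (map (\<lambda>y. y ! l) Ys)"

lemma budget_less: "B < 2 ^ length (bits B)"
  by (rule less_2_power_length_bits)

lemma two_power_length_bits_le: "2 ^ length (bits B) \<le> 2 * B + 1"
proof -
  have "n > 0 \<longrightarrow> 2 ^ length (bits n) \<le> 2 * n" for n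
  proof (induction n rule: bits.induct)
    case (1 n)
    show ?case
    proof (cases "n div 2 = 0")
      case True
      then show ?thesis by (auto simp: bits_pos)
    next
      case False
      then have "2 ^ length (bits (n div 2)) \<le> 2 * (n div 2)" using 1 by auto
      then show ?thesis by (auto simp: bits_pos)
    qed
  qed
  then show ?thesis by (cases "B = 0") (auto intro: le_SucI)
qed

lemma column_map_diff:
  assumes "x \<in> set Ys" "y \<in> set Ys"
  shows "\<bar>x ! l - y ! l\<bar> \<le> int B \<Longrightarrow> column_map B Ys l (x ! l) - column_map B Ys l (y ! l) = x ! l - y ! l"
    and "int B < \<bar>x ! l - y ! l\<bar> \<Longrightarrow> int B < \<bar>column_map B Ys l (x ! l) - column_map B Ys l (y ! l)\<bar>"
proof -
  have "0 \<in> high_parts B col" and "v \<in> set col \<Longrightarrow> nat \<bar>v\<bar> div 2 ^ length (bits B) \<in> high_parts B col" for col v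
    by (auto simp: high_parts_def)
  then show "\<bar>x ! l - y ! l\<bar> \<le> int B \<Longrightarrow> column_map B Ys l (x ! l) - column_map B Ys l (y ! l) = x ! l - y ! l"
    "int B < \<bar>x ! l - y ! l\<bar> \<Longrightarrow> int B < \<bar>column_map B Ys l (x ! l) - column_map B Ys l (y ! l)\<bar>"
    unfolding column_map_def compress_eq using assms
    by (intro compress_int_diff budget_less; auto)+
qed

lemma column_map_inject:
  assumes "x \<in> set Ys" "y \<in> set Ys"
  shows "column_map B Ys l (x ! l) = column_map B Ys l (y ! l) \<longleftrightarrow> x ! l = y ! l"
  using column_map_diff[OF assms, where l = l and B = B] by (cases "\<bar>x ! l - y ! l\<bar> \<le> int B") auto

text \<open>With block 0 there are at most \<open>length Ys + 1\<close> occupied blocks, so the rank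
  is at most twice that; the offset adds less than one block, and a block has length at most
  \<open>2 * B + 1\<close>.\<close>

lemma abs_column_map_le: "\<bar>column_map B Ys l v\<bar> \<le> int ((2 * length Ys + 3) * (2 * B + 1))"
proof -
  let ?H = "high_parts B (map (\<lambda>y. y ! l) Ys)" and ?w = "2 ^ length (bits B) :: nat"
  let ?c = "compress_nat ?w ?H (nat \<bar>v\<bar>)"
  have "card ?H \<le> Suc (card ((\<lambda>v. nat \<bar>v\<bar> div ?w) ` set (map (\<lambda>y. y ! l) Ys)))"
    unfolding high_parts_def by (rule card_insert_le_m1) (auto simp: card_insert_if)
  also have "card ((\<lambda>v. nat \<bar>v\<bar> div ?w) ` set (map (\<lambda>y. y ! l) Ys)) \<le> card (set (map (\<lambda>y. y ! l) Ys))"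
    by (intro card_image_le) simp
  also have "\<dots> \<le> length Ys" using card_length[of "map (\<lambda>y. y ! l) Ys"] by simp
  finally have H: "card ?H \<le> Suc (length Ys)" by simp
  have "?c < (2 * card ?H + 1) * ?w"
    by (intro compress_nat_less) (auto simp: high_parts_def)
  also have "\<dots> \<le> (2 * length Ys + 3) * (2 * B + 1)"
    using H two_power_length_bits_le[of B] by (intro mult_mono) auto
  finally have "?c \<le> (2 * length Ys + 3) * (2 * B + 1)" by simp
  moreover have "\<bar>column_map B Ys l v\<bar> = int ?c"
    by (simp add: column_map_def compress_eq compress_int_def)
  ultimately show ?thesis by (simp only: of_nat_le_iff)
qed

definition selected_row :: "nat \<Rightarrow> int list list \<Rightarrow> nat list \<Rightarrow> int list \<Rightarrow> int list" where
  "selected_row B Ys K y = map (\<lambda>l. column_map B Ys l (y ! l)) K"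

definition differing :: "nat list \<Rightarrow> int list \<Rightarrow> int list \<Rightarrow> nat" where
  "differing K x y = length (filter (\<lambda>l. x ! l \<noteq> y ! l) K)"

text \<open>Compression is injective on each column, so differences can be counted on the compressed
  rows.\<close>

lemma separating_rows:
  assumes "\<And>y. y \<in> set Ys \<Longrightarrow> length y = d" "j < d"
  shows "separating T (map (\<lambda>y. (drop j y, selected_row B Ys K y)) Ys)
    \<longleftrightarrow> (\<exists>x\<in>set Ys. \<exists>y\<in>set Ys. x ! j \<noteq> y ! j \<and> differing K x y \<le> T)"
proof -
  have hd: "hd_or 0 (drop j y) = y ! j" if "y \<in> set Ys" for y
    using Cons_nth_drop_Suc[of j y] assms that by (metis hd_or_simps(2))
  have len: "length (filter (\<lambda>w. fst w \<noteq> snd w) (zip (selected_row B Ys K x) (selected_row B Ys K y)))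
      = differing K x y" if "x \<in> set Ys" "y \<in> set Ys" for x y
    unfolding selected_row_def differing_def
    by (induction K) (auto simp: column_map_inject[OF that])
  show ?thesis by (auto simp: separating_def hd len)
qed

lemma column_step_rows:
  assumes "\<And>y. y \<in> set Ys \<Longrightarrow> length y = d" "j < d"
  shows "column_step B T (map (\<lambda>y. (drop j y, selected_row B Ys K y)) Ys)
    = map (\<lambda>y. (drop (Suc j) y, selected_row B Ys
        (if \<exists>x\<in>set Ys. \<exists>y\<in>set Ys. x ! j \<noteq> y ! j \<and> differing K x y \<le> T then j # K else K) y)) Ys"
proof -
  have hd: "drop j y = y ! j # drop (Suc j) y" if "y \<in> set Ys" for y
    using Cons_nth_drop_Suc[of j y] assms that by simp
  have col: "map (\<lambda>v. hd_or 0 (fst v)) (map (\<lambda>y. (drop j y, selected_row B Ys K y)) Ys) = map (\<lambda>y. y ! j) Ys"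
    using hd by (simp cong: map_cong)
  have sep: "separating T (map (\<lambda>y. (drop j y, selected_row B Ys K y)) Ys)
      \<longleftrightarrow> (\<exists>x\<in>set Ys. \<exists>y\<in>set Ys. x ! j \<noteq> y ! j \<and> differing K x y \<le> T)"
    using assms by (rule separating_rows)
  show ?thesis
  proof (cases "\<exists>x\<in>set Ys. \<exists>y\<in>set Ys. x ! j \<noteq> y ! j \<and> differing K x y \<le> T")
    case True
    show ?thesis unfolding column_step_def sep col if_P[OF True]
      by (auto simp: hd selected_row_def column_map_def)
  next
    case False
    show ?thesis unfolding column_step_def sep col if_not_P[OF False]
      by (auto simp: hd)
  qed
qed

text \<open>The fold is followed column by column. A selected column satisfies the greedy condition,
  which bounds the length of \<open>K\<close>. A column is skipped only if all pairs that differ in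
  it are separated more than \<open>T\<close> times already, and later selections only add
  separations.\<close>

lemma select_columns_rows:
  assumes Ys: "\<And>y. y \<in> set Ys \<Longrightarrow> length y = d" and row: "length row = d"
  obtains K where "distinct K" "set K \<subseteq> {..<d}"
    "select_columns B T row (map (\<lambda>y. (y, [])) Ys) = map (\<lambda>y. ([], selected_row B Ys K y)) Ys"
    "length K \<le> length Ys * (T + 1)"
    "\<And>x y l. x \<in> set Ys \<Longrightarrow> y \<in> set Ys \<Longrightarrow> l < d \<Longrightarrow> x ! l \<noteq> y ! l \<Longrightarrow> differing K x y \<le> T \<Longrightarrow> l \<in> set K"
proof -
  define col where "col = (\<lambda>l i. Ys ! i ! l)"
  have "\<exists>K. distinct K \<and> set K \<subseteq> {..<j}
    \<and> fold (\<lambda>_. column_step B T) (take j row) (map (\<lambda>y. (y, [])) Ys) = map (\<lambda>y. (drop j y, selected_row B Ys K y)) Ys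
    \<and> greedy_columns T (length Ys) (map col K)
    \<and> (\<forall>x\<in>set Ys. \<forall>y\<in>set Ys. \<forall>l<j. x ! l \<noteq> y ! l \<longrightarrow> differing K x y \<le> T \<longrightarrow> l \<in> set K)" if "j \<le> d" for j
    using that
  proof (induction j)
    case 0
    show ?case by (rule exI[of _ "[]"]) (simp add: selected_row_def)
  next
    case (Suc j)
    then obtain K where K: "distinct K" "set K \<subseteq> {..<j}"
      "fold (\<lambda>_. column_step B T) (take j row) (map (\<lambda>y. (y, [])) Ys) = map (\<lambda>y. (drop j y, selected_row B Ys K y)) Ys"
      "greedy_columns T (length Ys) (map col K)"
      "\<forall>x\<in>set Ys. \<forall>y\<in>set Ys. \<forall>l<j. x ! l \<noteq> y ! l \<longrightarrow> differing K x y \<le> T \<longrightarrow> l \<in> set K"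
      by auto
    let ?c = "\<exists>x\<in>set Ys. \<exists>y\<in>set Ys. x ! j \<noteq> y ! j \<and> differing K x y \<le> T"
    let ?K = "if ?c then j # K else K"
    have jd: "j < d" using Suc.prems by simp
    have "take (Suc j) row = take j row @ [row ! j]" using jd row by (simp add: take_Suc_conv_app_nth)
    then have "fold (\<lambda>_. column_step B T) (take (Suc j) row) (map (\<lambda>y. (y, [])) Ys)
        = column_step B T (map (\<lambda>y. (drop j y, selected_row B Ys K y)) Ys)"
      using K(3) by simp
    also have "\<dots> = map (\<lambda>y. (drop (Suc j) y, selected_row B Ys ?K y)) Ys"
      by (rule column_step_rows[OF Ys jd])
    finally have 3: "fold (\<lambda>_. column_step B T) (take (Suc j) row) (map (\<lambda>y. (y, [])) Ys)
        = map (\<lambda>y. (drop (Suc j) y, selected_row B Ys ?K y)) Ys" .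
    have 1: "distinct ?K" "set ?K \<subseteq> {..<Suc j}" using K(1,2) by auto
    have 4: "greedy_columns T (length Ys) (map col ?K)"
    proof (cases ?c)
      case True
      then obtain x y where xy: "x \<in> set Ys" "y \<in> set Ys" "x ! j \<noteq> y ! j" "differing K x y \<le> T" by blast
      then obtain a b where ab: "a < length Ys" "b < length Ys" "x = Ys ! a" "y = Ys ! b"
        by (metis in_set_conv_nth)
      have "separations (map col K) a b = differing K x y"
        unfolding separations_def differing_def ab(3,4) col_def by (induction K) auto
      then have "\<exists>i<length Ys. \<exists>k<length Ys. col j i \<noteq> col j k \<and> separations (map col K) i k \<le> T"
        using ab xy by (intro exI[of _ a] exI[of _ b] conjI) (auto simp: col_def)
      then show ?thesis using K(4) True by simp
    next
      case False
      then show ?thesis using K(4) by (simp only: if_False)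
    qed
    have mono: "differing K x y \<le> differing ?K x y" for x y by (simp add: differing_def)
    have 5: "\<forall>x\<in>set Ys. \<forall>y\<in>set Ys. \<forall>l<Suc j. x ! l \<noteq> y ! l \<longrightarrow> differing ?K x y \<le> T \<longrightarrow> l \<in> set ?K"
    proof (intro ballI allI impI)
      fix x y l assume *: "x \<in> set Ys" "y \<in> set Ys" "l < Suc j" "x ! l \<noteq> y ! l" "differing ?K x y \<le> T"
      have le: "differing K x y \<le> T" using mono[of x y] *(5) by (rule order_trans)
      show "l \<in> set ?K"
      proof (cases "l = j")
        case True
        then have ?c using * le by blast
        then show ?thesis using True by simp
      next
        case False
        then have "l \<in> set K" using K(5) * le by simp
        then show ?thesis by simp
      qed
    qed
    show ?case using 1 3 4 5 by (intro exI[of _ ?K] conjI)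
  qed
  from this[OF order_refl] obtain K where K: "distinct K" "set K \<subseteq> {..<d}"
    "fold (\<lambda>_. column_step B T) (take d row) (map (\<lambda>y. (y, [])) Ys) = map (\<lambda>y. (drop d y, selected_row B Ys K y)) Ys"
    "greedy_columns T (length Ys) (map col K)"
    "\<forall>x\<in>set Ys. \<forall>y\<in>set Ys. \<forall>l<d. x ! l \<noteq> y ! l \<longrightarrow> differing K x y \<le> T \<longrightarrow> l \<in> set K"
    by (elim exE conjE)
  show ?thesis
  proof (rule that[OF K(1,2)])
    have "map (\<lambda>y. (drop d y, selected_row B Ys K y)) Ys = map (\<lambda>y. ([], selected_row B Ys K y)) Ys"
      using Ys by auto
    then show "select_columns B T row (map (\<lambda>y. (y, [])) Ys) = map (\<lambda>y. ([], selected_row B Ys K y)) Ys"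
      using K(3) row by (simp add: select_columns_def)
    show "length K \<le> length Ys * (T + 1)" using length_greedy_columns[OF K(4)] by simp
    show "l \<in> set K" if "x \<in> set Ys" "y \<in> set Ys" "l < d" "x ! l \<noteq> y ! l" "differing K x y \<le> T" for x y l
      using K(5) that by blast
  qed
qed

subsection \<open>Clusterings as assignments\<close>

lemma cluster_cost_eq:
  assumes "distinct C"
  shows "cluster_cost p d (mset (map ((!) X) C)) = lp_cost p d ((!) X) (set C)"
proof -
  have "(\<Sum>x\<in>#mset (map ((!) X) C). pdist p c x) = (\<Sum>i\<in>set C. pdist p c (X ! i))" for c
    using assms by (simp add: sum_list_distinct_conv_sum_set[symmetric] sum_mset_sum_list comp_def flip: mset_map)
  then show ?thesis unfolding cluster_cost_def lp_cost_def pdist_def by simp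
qed

lemma clustering_cost_eq:
  assumes "distinct (concat Cs)"
  shows "clustering_cost p (d, X, k) Cs = (\<Sum>C\<leftarrow>Cs. lp_cost p d ((!) X) (set C))"
proof -
  have "cluster_cost p d (mset (map ((!) X) C)) = lp_cost p d ((!) X) (set C)" if "C \<in> set Cs" for C
    using assms that by (intro cluster_cost_eq) (simp add: distinct_concat_iff)
  then have "map (\<lambda>C. cluster_cost p d (mset (map ((!) X) C))) Cs = map (\<lambda>C. lp_cost p d ((!) X) (set C)) Cs"
    by (rule map_cong[OF refl])
  then show ?thesis by (simp only: clustering_cost.simps)
qed

definition block_of :: "nat list list \<Rightarrow> nat \<Rightarrow> nat" where
  "block_of Cs u = (SOME j. j < length Cs \<and> u \<in> set (Cs ! j))"

lemma block_of:
  assumes "u \<in> set (concat Cs)"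
  shows "block_of Cs u < length Cs" "u \<in> set (Cs ! block_of Cs u)"
proof -
  obtain C where C: "C \<in> set Cs" "u \<in> set C" using assms by auto
  then obtain j where "j < length Cs" "Cs ! j = C" by (metis in_set_conv_nth)
  then have "\<exists>j. j < length Cs \<and> u \<in> set (Cs ! j)" using C by auto
  from someI_ex[OF this] show "block_of Cs u < length Cs" "u \<in> set (Cs ! block_of Cs u)"
    by (simp_all add: block_of_def)
qed

lemma distinct_concat_nth_unique:
  assumes "distinct (concat Cs)" "i < length Cs" "j < length Cs" "u \<in> set (Cs ! i)" "u \<in> set (Cs ! j)"
  shows "i = j"
  using assms
proof (induction Cs arbitrary: i j)
  case (Cons C Cs)
  have disj: "set C \<inter> set (concat Cs) = {}" "distinct (concat Cs)" using Cons.prems(1) by auto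
  have tail: "u \<in> set (concat Cs)" if "u \<in> set (Cs ! l)" "l < length Cs" for l
    using that by (auto intro: nth_mem)
  show ?case
  proof (cases i)
    case 0
    show ?thesis
    proof (cases j)
      case (Suc j')
      then have "u \<in> set C" "u \<in> set (concat Cs)" using 0 Cons.prems tail[of j'] by auto
      then show ?thesis using disj(1) by blast
    qed (simp add: 0)
  next
    case (Suc i')
    show ?thesis
    proof (cases j)
      case 0
      then have "u \<in> set C" "u \<in> set (concat Cs)" using Suc Cons.prems tail[of i'] by auto
      then show ?thesis using disj(1) by blast
    next
      case (Suc j')
      then show ?thesis using \<open>i = Suc i'\<close> Cons.IH[OF disj(2), of i' j'] Cons.prems by simp
    qed
  qed
qed simp

lemma block_of_eq:
  assumes "distinct (concat Cs)" "j < length Cs"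
  shows "{u \<in> set (concat Cs). block_of Cs u = j} = set (Cs ! j)"
proof (intro equalityI subsetI)
  fix u assume u: "u \<in> set (Cs ! j)"
  then have "u \<in> set (concat Cs)" using assms(2) by (auto intro: nth_mem)
  moreover from block_of[OF this] have "block_of Cs u = j"
    using distinct_concat_nth_unique[OF assms(1) _ assms(2) _ u] by blast
  ultimately show "u \<in> {u \<in> set (concat Cs). block_of Cs u = j}" by simp
qed (use block_of in blast)

lemma sum_list_blocks:
  fixes F :: "nat set \<Rightarrow> real"
  assumes "distinct (concat Cs)"
  shows "(\<Sum>C\<leftarrow>Cs. F (set C)) = (\<Sum>j<length Cs. F {u \<in> set (concat Cs). block_of Cs u = j})"
proof -
  have "(\<Sum>C\<leftarrow>Cs. F (set C)) = (\<Sum>j<length Cs. F (set (Cs ! j)))"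
    by (simp add: sum_list_sum_nth atLeast0LessThan)
  then show ?thesis using block_of_eq[OF assms] by simp
qed

lemma card_block:
  assumes "distinct (concat Cs)" "j < length Cs"
  shows "card {u \<in> set (concat Cs). block_of Cs u = j} = length (Cs ! j)"
proof -
  have "distinct (Cs ! j)" using assms by (simp add: distinct_concat_iff)
  then show ?thesis by (simp only: block_of_eq[OF assms] distinct_card)
qed

text \<open>Cluster names range over an arbitrary finite set, since clusters that survive the
  splitting keep their old numbers, with gaps.\<close>

lemma assignment_to_clustering:
  fixes F :: "nat set \<Rightarrow> real"
  assumes "finite P" "finite L" "a ` P \<subseteq> L" "\<And>l. l \<in> L \<Longrightarrow> card {u \<in> P. a u = l} = s"
  obtains Cs where "length Cs = card L" "distinct (concat Cs)" "set (concat Cs) = P"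
    "\<And>C. C \<in> set Cs \<Longrightarrow> length C = s" "(\<Sum>C\<leftarrow>Cs. F (set C)) = (\<Sum>l\<in>L. F {u \<in> P. a u = l})"
proof -
  obtain ls where ls: "set ls = L" "distinct ls" using finite_distinct_list[OF assms(2)] by blast
  define blk where "blk = (\<lambda>l. sorted_list_of_set {u \<in> P. a u = l})"
  have blk: "set (blk l) = {u \<in> P. a u = l}" "distinct (blk l)" "length (blk l) = card {u \<in> P. a u = l}" for l
    using assms(1) by (auto simp: blk_def)
  have "distinct (concat (map blk ms))" if "distinct ms" for ms
    using that by (induction ms) (auto simp: blk)
  then have "distinct (concat (map blk ls))" using ls(2) by blast
  moreover have "set (concat (map blk ls)) = P" using blk(1) ls(1) assms(3) by auto
  moreover have "(\<Sum>C\<leftarrow>map blk ls. F (set C)) = (\<Sum>l\<in>L. F {u \<in> P. a u = l})"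
    using ls by (simp add: blk(1) comp_def sum_list_distinct_conv_sum_set)
  ultimately show ?thesis
    using ls assms(4) blk(3) by (intro that[of "map blk ls"]) (auto simp: distinct_card)
qed

subsection \<open>The structure of the kernel\<close>

lemma chunks_props:
  "mset (fst (chunks s xs)) + mset (concat (snd (chunks s xs))) = mset xs
    \<and> (\<forall>c\<in>set (snd (chunks s xs)). length c = s) \<and> (s > 0 \<longrightarrow> length (fst (chunks s xs)) < s)"
proof (induction xs rule: rev_induct)
  case (snoc x xs)
  have "chunks s (xs @ [x]) = (let u = chunks s xs in
      if Suc (length (fst u)) = s then ([], (x # fst u) # snd u) else (x # fst u, snd u))"
    by (simp add: chunks_def Let_def)
  then show ?case using snoc by (auto simp: Let_def)
qed (simp add: chunks_def)

lemma mset_chunks: "mset (fst (chunks s xs)) + mset (concat (snd (chunks s xs))) = mset xs"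
  and length_chunk: "c \<in> set (snd (chunks s xs)) \<Longrightarrow> length c = s"
  and length_chunks_rest: "s > 0 \<Longrightarrow> length (fst (chunks s xs)) < s"
  using chunks_props[of s xs] by blast+

lemma length_concat_uniform: "(\<And>c. c \<in> set Cs \<Longrightarrow> length c = s) \<Longrightarrow> length (concat Cs) = length Cs * s"
  by (induction Cs) auto

lemma chunks_exact:
  assumes "s > 0" "s dvd length xs"
  shows "fst (chunks s xs) = []" "mset (concat (snd (chunks s xs))) = mset xs"
    "length (snd (chunks s xs)) = length xs div s"
proof -
  have len: "length xs = length (fst (chunks s xs)) + length (snd (chunks s xs)) * s"
    using arg_cong[OF mset_chunks[of s xs], of size] length_concat_uniform[of "snd (chunks s xs)" s]
      length_chunk[of _ s xs] by simp
  then have "s dvd length (fst (chunks s xs))" using assms(2) by (simp add: dvd_add_left_iff)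
  then have 0: "length (fst (chunks s xs)) = 0"
    using length_chunks_rest[OF assms(1), of xs] by (meson dvd_imp_le not_less neq0_conv)
  then show 1: "fst (chunks s xs) = []" by simp
  then show "mset (concat (snd (chunks s xs))) = mset xs" using mset_chunks[of s xs] by simp
  show "length (snd (chunks s xs)) = length xs div s" using len 0 assms(1) by simp
qed

locale kernel_input =
  fixes p d :: nat and X :: "int list list" and k B :: nat
  assumes instance_ok: "(d, X, k) \<in> clust_insts"
begin

definition z :: input where "z = ((d, X, k), B)"
definition s :: nat where "s = cluster_size z"
definition U :: "nat list list" where "U = uniform_clusters z"
definition R :: "(int list \<times> nat list) list" where "R = residues z"
definition P1 :: "nat list" where "P1 = concat (map snd R)"
definition G :: "(int list \<times> nat list \<times> nat list) list" where "G = groups z"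
definition Q :: "nat list" where "Q = kept z"
definition t :: nat where "t = surplus z"
definition s' :: nat where "s' = reduced_size z"

lemma input_simps: "input_points z = X" "input_k z = k" "snd z = B" "fst z = (d, X, k)"
  by (simp_all add: z_def input_points_def input_k_def)

lemma lengths: "length X = k * s" "k > 0" "s > 0" "X \<noteq> []" "d > 0" "\<And>x. x \<in> set X \<Longrightarrow> length x = d"
  and s_eq: "s = length X div k"
proof -
  show seq: "s = length X div k" by (simp add: s_def cluster_size_def input_simps)
  show "k > 0" "X \<noteq> []" "d > 0" "\<And>x. x \<in> set X \<Longrightarrow> length x = d"
    using instance_ok by (auto simp: clust_insts_def)
  show len: "length X = k * s" using instance_ok by (auto simp: clust_insts_def seq)
  then show "s > 0" using \<open>X \<noteq> []\<close> by (cases "s = 0") auto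
qed

lemma s'_eq: "s' = min s (2 * B + 1)" and t_eq: "t = s - (2 * B + 1)" and s'_t: "s' + t = s" "s' > 0"
  using lengths(3) by (auto simp: s'_def reduced_size_def t_def surplus_def s_def input_simps)

lemma positions: "distinct (positions z y)" "set (positions z y) = {u. u < length X \<and> X ! u = y}"
proof -
  have "distinct (map fst (List.enumerate 0 X))" by (simp add: map_fst_enumerate_0)
  then show "distinct (positions z y)"
    unfolding positions_def input_simps by (rule distinct_map_filter)
  show "set (positions z y) = {u. u < length X \<and> X ! u = y}"
    unfolding positions_def input_simps by (force simp: in_set_enumerate_eq image_iff)
qed

lemma mset_positions: "mset (concat (map (positions z) (nub X))) = mset [0..<length X]"
proof -
  have "distinct (concat (map (positions z) ys))" if "distinct ys" for ys
    using that by (induction ys) (auto simp: positions)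
  then have "distinct (concat (map (positions z) (nub X)))" by simp
  moreover have "set (concat (map (positions z) (nub X))) = set [0..<length X]"
    by (auto simp: positions)
  ultimately show ?thesis by (simp only: set_eq_iff_mset_eq_distinct[OF _ distinct_upt, symmetric])
qed

lemma mset_U_P1: "mset (concat U) + mset P1 = mset [0..<length X]"
proof -
  have "mset (concat (concat (map (\<lambda>y. snd (chunks s (positions z y))) ys)))
      + mset (concat (map snd (filter (\<lambda>g. snd g \<noteq> []) (map (\<lambda>y. (y, fst (chunks s (positions z y)))) ys))))
      = mset (concat (map (positions z) ys))" for ys
  proof (induction ys)
    case (Cons y ys)
    then show ?case using mset_chunks[of s "positions z y"] by (auto simp: ac_simps)
  qed simp
  from this[of "nub X"] show ?thesis
    unfolding mset_positions U_def P1_def R_def uniform_clusters_def residues_def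
    by (simp add: s_def input_simps)
qed

lemma U_cluster:
  assumes "C \<in> set U"
  obtains y where "y \<in> set X" "length C = s" "\<And>u. u \<in> set C \<Longrightarrow> u < length X \<and> X ! u = y"
proof -
  obtain y where y: "y \<in> set X" "C \<in> set (snd (chunks s (positions z y)))"
    using assms by (auto simp: U_def uniform_clusters_def s_def input_simps)
  have "set C \<subseteq> set (positions z y)"
    using mset_chunks[of s "positions z y"] y(2)
    by (metis (no_types, lifting) UN_upper mset_eq_setD mset_append set_append set_concat sup.coboundedI2)
  then show ?thesis using y length_chunk[OF y(2)] by (intro that[of y]) (auto simp: positions)
qed

lemma residue:
  assumes "(y, r) \<in> set R"
  shows "y \<in> set X" "r \<noteq> []" "length r < s" "distinct r" "\<And>u. u \<in> set r \<Longrightarrow> u < length X \<and> X ! u = y"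
proof -
  have r: "r = fst (chunks s (positions z y))" "y \<in> set X" "r \<noteq> []"
    using assms by (auto simp: R_def residues_def s_def input_simps)
  then show "y \<in> set X" "r \<noteq> []" "length r < s" using length_chunks_rest[OF lengths(3)] by auto
  have m: "mset r + mset (concat (snd (chunks s (positions z y)))) = mset (positions z y)"
    using mset_chunks[of s "positions z y"] r(1) by simp
  have "mset (r @ concat (snd (chunks s (positions z y)))) = mset (positions z y)" using m by simp
  then have "distinct (r @ concat (snd (chunks s (positions z y))))" "set (r @ concat (snd (chunks s (positions z y)))) = set (positions z y)"
    using positions(1) by (metis mset_eq_imp_distinct_iff, metis mset_eq_setD)
  then show "distinct r" "\<And>u. u \<in> set r \<Longrightarrow> u < length X \<and> X ! u = y"
    using positions(2)[of y] by auto
qed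

lemma distinct_R: "distinct (map fst R)"
proof -
  have "distinct (map fst (map (\<lambda>y. (y, fst (chunks s (positions z y)))) (nub X)))"
    by (simp add: comp_def)
  then show ?thesis unfolding R_def residues_def s_def[symmetric] input_simps by (rule distinct_map_filter)
qed

lemma P1_props: "distinct P1" "set P1 \<subseteq> {..<length X}" "set (concat U) \<inter> set P1 = {}"
  "set (concat U) \<union> set P1 = {..<length X}" "distinct (concat U)"
proof -
  have m: "mset (concat U @ P1) = mset [0..<length X]" using mset_U_P1 by simp
  then have "distinct (concat U @ P1)" by (metis mset_eq_imp_distinct_iff distinct_upt)
  moreover have "set (concat U @ P1) = set [0..<length X]" using m by (rule mset_eq_setD)
  ultimately show "distinct P1" "set P1 \<subseteq> {..<length X}" "set (concat U) \<inter> set P1 = {}"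
    "set (concat U) \<union> set P1 = {..<length X}" "distinct (concat U)" by (auto simp: lessThan_atLeast0)
qed

lemma length_P1: "length U * s + length P1 = k * s" "s dvd length P1"
proof -
  have "length (concat U) = length U * s" by (rule length_concat_uniform) (use U_cluster in blast)
  then show *: "length U * s + length P1 = k * s"
    using arg_cong[OF mset_U_P1, of size] lengths(1) by simp
  then have "s dvd length U * s + length P1" by simp
  then show "s dvd length P1" by (simp add: dvd_add_right_iff)
qed

lemma in_P1: "u \<in> set P1 \<longleftrightarrow> (\<exists>y r. (y, r) \<in> set R \<and> u \<in> set r)"
proof -
  have "u \<in> set P1 \<longleftrightarrow> (\<exists>g\<in>set R. u \<in> set (snd g))" by (simp add: P1_def)
  then show ?thesis by (auto simp: Bex_def)
qed

lemma R_values: "{u \<in> set P1. X ! u = y} = (if y \<in> fst ` set R then set (the (map_of R y)) else {})"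
proof (cases "y \<in> fst ` set R")
  case True
  then obtain r where r: "(y, r) \<in> set R" by auto
  have m: "map_of R y = Some r" using distinct_R r by simp
  have "u \<in> set r" if uP: "u \<in> set P1" and uy: "X ! u = y" for u
  proof -
    obtain y' r' where *: "(y', r') \<in> set R" "u \<in> set r'" using iffD1[OF in_P1 uP] by (elim exE conjE)
    then have "y' = y" using residue(5)[OF *(1,2)] uy by simp
    then have "r' = r" using m map_of_is_SomeI[OF distinct_R *(1)] by simp
    then show ?thesis using *(2) by simp
  qed
  moreover have "u \<in> set P1 \<and> X ! u = y" if "u \<in> set r" for u
    using iffD2[OF in_P1] r residue(5)[OF r that] that by blast
  ultimately have "{u \<in> set P1. X ! u = y} = set r" by blast
  then show ?thesis using True m by simp
next
  case False
  have "X ! u \<noteq> y" if uP: "u \<in> set P1" for u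
  proof -
    obtain y' r' where *: "(y', r') \<in> set R" "u \<in> set r'" using iffD1[OF in_P1 uP] by (elim exE conjE)
    then show ?thesis using residue(5)[OF *] False by force
  qed
  then show ?thesis using False by auto
qed

lemma R_group: "(y, r) \<in> set R \<Longrightarrow> {u \<in> set P1. X ! u = y} = set r"
  using R_values[of y] map_of_is_SomeI[OF distinct_R, of y r] by force

lemma small_groups: "card {u \<in> set P1. X ! u = y} < s"
proof (cases "y \<in> fst ` set R")
  case True
  then obtain r where r: "(y, r) \<in> set R" by auto
  then show ?thesis using R_group[OF r] residue(3,4)[OF r] by (simp add: distinct_card)
next
  case False
  then have "{u \<in> set P1. X ! u = y} = {}" using R_values[of y] by simp
  then show ?thesis using lengths(3) by (simp only: card.empty)
qed

lemma values_P1: "(!) X ` set P1 = fst ` set R"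
proof (intro equalityI subsetI)
  fix y assume "y \<in> (!) X ` set P1"
  then obtain u where u: "u \<in> set P1" "y = X ! u" by blast
  obtain y' r where "(y', r) \<in> set R" "u \<in> set r" using iffD1[OF in_P1 u(1)] by (elim exE conjE)
  then show "y \<in> fst ` set R" using residue(5)[of y' r u] u(2) by force
next
  fix y assume "y \<in> fst ` set R"
  then obtain r where r: "(y, r) \<in> set R" by auto
  then obtain u where "u \<in> set r" using residue(2)[OF r] by (cases r) auto
  then have "u \<in> {u \<in> set P1. X ! u = y}" by (simp only: R_group[OF r])
  then show "y \<in> (!) X ` set P1" by auto
qed

lemma length_R: "length R = card ((!) X ` set P1)"
  unfolding values_P1 using distinct_card[OF distinct_R] by simp

definition removed_part :: "nat list \<Rightarrow> nat list" where
  "removed_part r = (if B < length r then take t r else [])"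

definition kept_part :: "nat list \<Rightarrow> nat list" where
  "kept_part r = (if B < length r then drop t r else r)"

lemma G_eq: "G = map (\<lambda>g. (fst g, (kept_part (snd g), removed_part (snd g)))) R"
  unfolding G_def groups_def R_def[symmetric] t_def[symmetric] input_simps
  by (simp add: kept_part_def removed_part_def)

definition Rm :: "nat list" where "Rm = concat (map (\<lambda>g. snd (snd g)) G)"

lemma Q_eq: "Q = concat (map (\<lambda>g. fst (snd g)) G)"
  by (simp add: Q_def kept_def G_def)

lemma mset_parts: "mset (kept_part r) + mset (removed_part r) = mset r"
proof (cases "B < length r")
  case True
  have "mset r = mset (take t r) + mset (drop t r)" by (metis append_take_drop_id mset_append)
  then show ?thesis using True by (simp add: kept_part_def removed_part_def)
qed (simp add: kept_part_def removed_part_def)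

text \<open>A residue has fewer than \<open>s\<close> entries and \<open>s = s' + t\<close>, so
  removing \<open>t\<close> of them leaves fewer than \<open>s'\<close>. This strict bound is what
  later prevents two clusters from claiming the same removed copies.\<close>

lemma length_kept_part: "length (kept_part r) \<le> 2 * B + 1" "removed_part r \<noteq> [] \<Longrightarrow> length (kept_part r) < s'"
  if "length r < s"
  using that by (auto simp: kept_part_def removed_part_def s'_eq t_eq)

lemma mset_Q_Rm: "mset Q + mset Rm = mset P1"
proof -
  have "mset (concat (map (\<lambda>g. kept_part (snd g)) gs)) + mset (concat (map (\<lambda>g. removed_part (snd g)) gs))
      = mset (concat (map snd gs))" for gs :: "(int list \<times> nat list) list"
  proof (induction gs)
    case (Cons g gs)
    then show ?case using mset_parts[of "snd g"] by (simp add: ac_simps)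
  qed simp
  from this[of R] show ?thesis by (simp add: Q_eq Rm_def G_eq P1_def comp_def)
qed

lemma Q_props: "distinct Q" "set Q = set P1 - set Rm" "set Rm \<subseteq> set P1" "distinct Rm" "set Q \<inter> set Rm = {}"
proof -
  have m: "mset (Q @ Rm) = mset P1" using mset_Q_Rm by simp
  then have d: "distinct (Q @ Rm)" using P1_props(1) by (metis mset_eq_imp_distinct_iff)
  moreover have "set (Q @ Rm) = set P1" using m by (rule mset_eq_setD)
  ultimately show "distinct Q" "set Q = set P1 - set Rm" "set Rm \<subseteq> set P1" "distinct Rm" "set Q \<inter> set Rm = {}"
    by auto
qed

lemma G_group:
  assumes "(y, kp, E) \<in> set G"
  obtains r where "(y, r) \<in> set R" "kp = kept_part r" "E = removed_part r"
    "{u \<in> set Q. X ! u = y} = set kp" "{u \<in> set Rm. X ! u = y} = set E"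
proof -
  obtain r where r: "(y, r) \<in> set R" "kp = kept_part r" "E = removed_part r"
    using assms by (auto simp: G_eq)
  have sub: "set kp \<subseteq> set Q" "set E \<subseteq> set Rm" using assms by (force simp: Q_eq Rm_def)+
  have "mset (kp @ E) = mset r" using mset_parts[of r] r by simp
  then have kE: "set kp \<union> set E = set r" by (metis mset_eq_setD set_append)
  have Pr: "{u \<in> set P1. X ! u = y} = set r" by (rule R_group[OF r(1)])
  have "{u \<in> set Q. X ! u = y} = set kp" "{u \<in> set Rm. X ! u = y} = set E"
    using Pr kE sub Q_props(2,3,5) by blast+
  then show ?thesis using that r by blast
qed

lemma distinct_G: "distinct (map fst G)"
  using distinct_R by (simp add: G_eq comp_def)

lemma card_Rm_values:
  "card {u \<in> set Rm. X ! u = y} = (if B < card {u \<in> set P1. X ! u = y} then min t (card {u \<in> set P1. X ! u = y}) else 0)"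
proof (cases "y \<in> fst ` set R")
  case True
  then obtain r where r: "(y, r) \<in> set R" by auto
  then have "(y, kept_part r, removed_part r) \<in> set G" by (force simp: G_eq)
  then have "{u \<in> set Rm. X ! u = y} = set (removed_part r)"
  proof (rule G_group)
    fix r' assume *: "(y, r') \<in> set R" "removed_part r = removed_part r'" "{u \<in> set Rm. X ! u = y} = set (removed_part r)"
    then show ?thesis by blast
  qed
  moreover have "distinct (removed_part r)" using residue(4)[OF r] by (simp add: removed_part_def)
  ultimately show ?thesis
    using R_group[OF r] residue(4)[OF r] by (simp add: distinct_card) (simp add: removed_part_def min.commute)
next
  case False
  then have "{u \<in> set P1. X ! u = y} = {}" using R_values[of y] by simp
  moreover from this have "{u \<in> set Rm. X ! u = y} = {}" using Q_props(3) by blast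
  ultimately show ?thesis by (simp only: card.empty) simp
qed

end

subsection \<open>Cost of the kernel\<close>

context kernel_input
begin

sublocale im: integral_metric "pdist p" "{c. length c = d}" "{x. length x = d}" real_point
  by (rule integral_metric_pdist)

abbreviation F :: "nat set \<Rightarrow> real" where "F \<equiv> lp_cost p d ((!) X)"

abbreviation clusterings :: "nat list list set" where "clusterings \<equiv> equal_clusterings (d, X, k)"

lemma im_cost: "im.cost = lp_cost p d"
  by (rule lp_cost_eq)

lemma X_points: "A \<subseteq> {..<length X} \<Longrightarrow> (!) X ` A \<subseteq> {x. length x = d}"
  using lengths(6) by auto

lemma F_nonneg: "A \<subseteq> {..<length X} \<Longrightarrow> 0 \<le> F A"
  using im.cost_nonneg[OF X_points] by (simp add: im_cost)

lemma F_const: "A \<subseteq> {..<length X} \<Longrightarrow> (\<And>u. u \<in> A \<Longrightarrow> X ! u = y) \<Longrightarrow> F A = 0"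
  using im.cost_const[OF X_points, of A y] by (simp add: im_cost)

lemma clusteringD:
  assumes "Cs \<in> clusterings"
  shows "length Cs = k" "distinct (concat Cs)" "set (concat Cs) = {..<length X}"
    "\<And>C. C \<in> set Cs \<Longrightarrow> length C = s" "\<And>C. C \<in> set Cs \<Longrightarrow> set C \<subseteq> {..<length X}"
    "clustering_cost p (d, X, k) Cs = (\<Sum>C\<leftarrow>Cs. F (set C))"
proof -
  show 1: "length Cs = k" "distinct (concat Cs)" "set (concat Cs) = {..<length X}"
    "\<And>C. C \<in> set Cs \<Longrightarrow> length C = s"
    using assms by (simp_all add: s_eq)
  show "set C \<subseteq> {..<length X}" if "C \<in> set Cs" for C
    unfolding 1(3)[symmetric] using that by auto
  show "clustering_cost p (d, X, k) Cs = (\<Sum>C\<leftarrow>Cs. F (set C))"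
    by (rule clustering_cost_eq[OF 1(2)])
qed

lemma clusteringI:
  assumes "length Cs = k" "distinct (concat Cs)" "set (concat Cs) = {..<length X}"
    "\<And>C. C \<in> set Cs \<Longrightarrow> length C = s"
  shows "Cs \<in> clusterings"
  using assms by (simp add: s_eq)

lemma cost_U: "C \<in> set U \<Longrightarrow> F (set C) = 0"
proof -
  assume "C \<in> set U"
  then obtain y where "\<And>u. u \<in> set C \<Longrightarrow> u < length X \<and> X ! u = y" by (rule U_cluster) blast
  then show ?thesis by (intro F_const[of _ y]) auto
qed

text \<open>A cluster of positive cost contains two different points and costs at least their
  distance. The gap between 0 and 1 later yields \<open>B \<ge> 1\<close> for cheap instances of
  positive cost.\<close>

lemma positive_cost_ge_1:
  assumes "Cs \<in> clusterings" "0 < clustering_cost p (d, X, k) Cs"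
  shows "1 \<le> clustering_cost p (d, X, k) Cs" "2 \<le> s"
proof -
  have nn: "0 \<le> F (set C)" if "C \<in> set Cs" for C using F_nonneg clusteringD(5)[OF assms(1) that] .
  have "\<exists>C\<in>set Cs. F (set C) \<noteq> 0"
  proof (rule ccontr)
    assume "\<not> ?thesis"
    then have "(\<Sum>C\<leftarrow>Cs. F (set C)) = 0" by (simp add: sum_list_0 cong: map_cong)
    then show False using assms clusteringD(6)[OF assms(1)] by simp
  qed
  then obtain C where C: "C \<in> set Cs" "F (set C) \<noteq> 0" by blast
  have sub: "set C \<subseteq> {..<length X}" using clusteringD(5)[OF assms(1) C(1)] .
  have "\<not> (\<forall>u\<in>set C. X ! u = X ! hd C)" using F_const[OF sub] C(2) by blast
  then obtain u where u: "u \<in> set C" "X ! u \<noteq> X ! hd C" by blast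
  then have hd: "hd C \<in> set C" by (cases C) auto
  have "1 \<le> pdist p (real_point (X ! u)) (X ! hd C)"
    using u hd X_points[OF sub] by (intro im.D_ge_1) auto
  also have "\<dots> \<le> im.cost ((!) X) (set C)"
    using u hd X_points[OF sub] by (intro im.D_le_cost) auto
  also have "\<dots> = F (set C)" by (simp only: im_cost)
  also have "\<dots> \<le> (\<Sum>C\<leftarrow>Cs. F (set C))"
    by (rule member_le_sum_list[of "F (set C)" "map (\<lambda>C. F (set C)) Cs"]) (use C nn in auto)
  finally show "1 \<le> clustering_cost p (d, X, k) Cs" using clusteringD(6)[OF assms(1)] by simp
  have "C \<noteq> []" using hd by auto
  moreover have "length C \<noteq> 1"
  proof
    assume "length C = 1"
    then obtain w where "C = [w]" by (auto simp: length_Suc_conv)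
    then show False using u by simp
  qed
  ultimately show "2 \<le> s" using clusteringD(4)[OF assms(1) C(1)] by (cases C; cases "tl C") auto
qed

lemma split_uniform_clusters:
  assumes Cs: "Cs \<in> clusterings" and v: "v = clustering_cost p (d, X, k) Cs" "0 < v" "2 * v < real B + 1"
  obtains L a where "finite L" "card L = k - length U" "a ` set P1 \<subseteq> L"
    "\<And>l. l \<in> (L :: nat set) \<Longrightarrow> card {u \<in> set P1. a u = l} = s"
    "(\<Sum>l\<in>L. F {u \<in> set P1. a u = l}) \<le> 2 * v" "(\<Sum>l\<in>L. F {u \<in> set P1. a u = l}) \<le> real B"
proof -
  have v1: "1 \<le> v" and s2: "2 \<le> s" using positive_cost_ge_1[OF Cs] v by auto
  \<comment> \<open>Regularity requires a full clustering on the uniform side too, so the points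
    outside the uniform clusters are cut into pieces arbitrarily.\<close>
  define W where "W = U @ snd (chunks s P1)"
  note exact = chunks_exact[OF lengths(3) length_P1(2)]
  have mW: "mset (concat W) = mset [0..<length X]"
    using exact(2) mset_U_P1 by (simp add: W_def)
  have W: "distinct (concat W)" "set (concat W) = {..<length X}"
    using mset_eq_imp_distinct_iff[OF mW] mset_eq_setD[OF mW] by auto
  have lenW: "length C = s" if "C \<in> set W" for C
    using that U_cluster length_chunk by (auto simp: W_def)
  have "length (concat W) = length W * s" by (rule length_concat_uniform) (rule lenW)
  moreover have "length (concat W) = k * s" using arg_cong[OF mW, of size] lengths(1) by simp
  ultimately have kW: "length W = k" using lengths(3) by simp
  let ?r = "block_of W" and ?a = "block_of Cs" and ?J = "{..<length U}"
  have rJ: "?r u \<in> ?J \<longleftrightarrow> u \<in> set (concat U)" if u: "u < length X" for u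
  proof
    have uW: "u \<in> set (concat W)" using u W(2) by simp
    {
      assume "?r u \<in> ?J"
      then have "W ! ?r u = U ! ?r u" by (simp add: W_def nth_append)
      then show "u \<in> set (concat U)" using block_of(2)[OF uW] \<open>?r u \<in> ?J\<close> by (auto intro: nth_mem)
    next
      assume "u \<in> set (concat U)"
      from block_of[OF this] have j: "block_of U u < length U" "u \<in> set (U ! block_of U u)" .
      then have "u \<in> set (W ! block_of U u)" "block_of U u < length W" by (simp_all add: W_def nth_append)
      then have "?r u = block_of U u"
        using distinct_concat_nth_unique[OF W(1) block_of(1)[OF uW] _ block_of(2)[OF uW]] by blast
      then show "?r u \<in> ?J" using j by simp
    }
  qed
  have P1_eq: "{u \<in> {..<length X}. ?r u \<notin> ?J} = set P1"
  proof (intro equalityI subsetI)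
    fix u assume "u \<in> {u \<in> {..<length X}. ?r u \<notin> ?J}"
    then have "u \<in> {..<length X}" "u \<notin> set (concat U)" using rJ[of u] by simp_all
    then show "u \<in> set P1" unfolding P1_props(4)[symmetric] by blast
  next
    fix u assume u: "u \<in> set P1"
    then have "u < length X" "u \<notin> set (concat U)" using P1_props(2,3) by blast+
    then show "u \<in> {u \<in> {..<length X}. ?r u \<notin> ?J}" using rJ[of u] by simp
  qed
  have "\<exists>L a'. L \<subseteq> {..<k} \<and> card L = card {..<k} - card ?J \<and> a' ` {u \<in> {..<length X}. ?r u \<notin> ?J} \<subseteq> L
    \<and> (\<forall>l\<in>L. card {u \<in> {..<length X}. ?r u \<notin> ?J \<and> a' u = l} = s)
    \<and> (\<Sum>l\<in>L. im.cost ((!) X) {u \<in> {..<length X}. ?r u \<notin> ?J \<and> a' u = l}) \<le> min (2 * v) (real B)"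
  proof (rule im.split_uniform[where x = "\<lambda>j. X ! hd (U ! j)"])
    show "?r ` {..<length X} \<subseteq> {..<k}"
    proof
      fix j assume "j \<in> ?r ` {..<length X}"
      then obtain u where "u \<in> set (concat W)" "j = ?r u" using W(2) by blast
      then show "j \<in> {..<k}" using block_of(1)[of u W] kW by simp
    qed
    show "?a ` {..<length X} \<subseteq> {..<k}"
    proof
      fix j assume "j \<in> ?a ` {..<length X}"
      then obtain u where "u \<in> set (concat Cs)" "j = ?a u" using clusteringD(3)[OF Cs] by blast
      then show "j \<in> {..<k}" using block_of(1)[of u Cs] clusteringD(1)[OF Cs] by simp
    qed
    show "card {u \<in> {..<length X}. ?r u = i} = s" if "i \<in> {..<k}" for i
      using card_block[OF W(1), of i] that kW lenW[of "W ! i"] unfolding W(2) by simp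
    show "card {u \<in> {..<length X}. ?a u = i} = s" if "i \<in> {..<k}" for i
      using card_block[OF clusteringD(2)[OF Cs], of i] that clusteringD(1)[OF Cs] clusteringD(4)[OF Cs, of "Cs ! i"]
      unfolding clusteringD(3)[OF Cs] by simp
    show "?J \<subseteq> {..<k}" using kW by (auto simp: W_def)
    show "(!) X ` {..<length X} \<subseteq> {x. length x = d}" by (rule X_points) simp
    show "X ! u = X ! hd (U ! ?r u)" if "u \<in> {..<length X}" "?r u \<in> ?J" for u
    proof -
      have "u \<in> set (concat W)" using that W(2) by simp
      from block_of(2)[OF this] have uU: "u \<in> set (U ! ?r u)" using that by (simp add: W_def nth_append)
      have "U ! ?r u \<in> set U" using that by simp
      then show ?thesis
      proof (rule U_cluster)
        fix y assume y: "\<And>w. w \<in> set (U ! ?r u) \<Longrightarrow> w < length X \<and> X ! w = y"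
        have "hd (U ! ?r u) \<in> set (U ! ?r u)" using uU by (cases "U ! ?r u") auto
        then show ?thesis using y uU by metis
      qed
    qed
    show "(\<lambda>j. X ! hd (U ! j)) ` ?J \<subseteq> {x. length x = d}"
    proof
      fix x assume "x \<in> (\<lambda>j. X ! hd (U ! j)) ` ?J"
      then obtain j where j: "j < length U" "x = X ! hd (U ! j)" by auto
      then have "U ! j \<in> set U" by simp
      then show "x \<in> {x. length x = d}"
      proof (rule U_cluster)
        fix y assume y: "length (U ! j) = s" "\<And>w. w \<in> set (U ! j) \<Longrightarrow> w < length X \<and> X ! w = y"
        have "hd (U ! j) \<in> set (U ! j)" using y(1) lengths(3) by (cases "U ! j") auto
        then have "hd (U ! j) < length X" using y(2) by blast
        then show ?thesis using lengths(6) j(2) by simp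
      qed
    qed
    let ?V = "\<Sum>i<k. im.cost ((!) X) {u \<in> {..<length X}. ?a u = i}"
    have V: "?V = v"
      unfolding v(1) clusteringD(6)[OF Cs] sum_list_blocks[OF clusteringD(2)[OF Cs], of F]
        clusteringD(1)[OF Cs] clusteringD(3)[OF Cs] im_cost ..
    show "2 * ?V < real s \<and> ?V \<le> min (2 * v) (real B) \<or> (2 - 2 / real s) * ?V < min (2 * v) (real B)"
      unfolding V
    \<comment> \<open>For \<open>s \<ge> B + 2\<close> the bound \<open>2 v < B + 1\<close> makes
      majority centers available, and \<open>v\<close> itself is at most \<open>B\<close>. Otherwise
      \<open>(2 - 2 / s) v\<close> is less than \<open>(1 - 1 / s) (B + 1)\<close>, which is at most
      \<open>B\<close> because \<open>s \<le> B + 1\<close>.\<close>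
    proof (cases "B + 2 \<le> s")
      case True
      then have "real B + 2 \<le> real s" by linarith
      moreover have "real B \<ge> 1" using v1 v(3) by linarith
      then have "v \<le> real B" using v(3) by linarith
      ultimately show "2 * v < real s \<and> v \<le> min (2 * v) (real B) \<or> (2 - 2 / real s) * v < min (2 * v) (real B)"
        using v by auto
    next
      case False
      then have sB: "real s \<le> real B + 1" by linarith
      have s0: "real s > 0" using s2 by simp
      have "(2 - 2 / real s) * v < 2 * v" using v(2) s0 by (simp add: left_diff_distrib)
      moreover have "(2 - 2 / real s) * v < real B"
      proof -
        have "(1 - 1 / real s) * (2 * v) < (1 - 1 / real s) * (real B + 1)"
          using v(3) s2 by (intro mult_strict_left_mono) auto
        also have "\<dots> \<le> real B" using sB s0 by (simp add: left_diff_distrib)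
        finally show ?thesis by (simp add: left_diff_distrib)
      qed
      ultimately show "2 * v < real s \<and> v \<le> min (2 * v) (real B) \<or> (2 - 2 / real s) * v < min (2 * v) (real B)"
        by simp
    qed
  qed (use s2 in auto)
  then obtain L a where La: "L \<subseteq> {..<k}" "card L = k - length U" "a ` set P1 \<subseteq> L"
    "\<forall>l\<in>L. card {u \<in> {..<length X}. ?r u \<notin> ?J \<and> a u = l} = s"
    "(\<Sum>l\<in>L. F {u \<in> {..<length X}. ?r u \<notin> ?J \<and> a u = l}) \<le> min (2 * v) (real B)"
    unfolding P1_eq im_cost by (elim exE conjE) (simp only: card_lessThan)
  have eq: "{u \<in> {..<length X}. ?r u \<notin> ?J \<and> a u = l} = {u \<in> set P1. a u = l}" for l
    unfolding P1_eq[symmetric] by blast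
  show ?thesis
    using La(1-3) La(4,5)[unfolded eq] by (intro that[of L a]) (auto intro: finite_subset)
qed

lemma length_G_le:
  assumes "finite L" "a ` set P1 \<subseteq> L" "\<And>l. l \<in> L \<Longrightarrow> card {u \<in> set P1. a u = l} = s"
    "(\<Sum>l\<in>L. F {u \<in> set P1. a u = l}) \<le> real B"
  shows "length G \<le> 2 * B"
proof -
  have "real (card ((!) X ` set P1)) \<le> 2 * (\<Sum>l\<in>L. im.cost ((!) X) {u \<in> set P1. a u = l})"
    by (rule im.card_values_total[OF _ assms(1) X_points assms(2,3) small_groups]) (use P1_props(2) in auto)
  then have "real (card ((!) X ` set P1)) \<le> 2 * real B" using assms(4) by (simp add: im_cost)
  then show ?thesis by (simp add: G_eq length_R)
qed

text \<open>The majority argument needs more than \<open>2 * B\<close> points per cluster, so the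
  case \<open>t = 0\<close>, in which nothing is removed, is separate. The last conclusion says that
  each affected group loses the full \<open>t\<close> copies; with it lifted clusters regain exactly
  \<open>s\<close> points.\<close>

lemma shrink_kernel:
  assumes L: "finite L" "a ` set P1 \<subseteq> L" "\<And>l. l \<in> L \<Longrightarrow> card {u \<in> set P1. a u = l} = s"
    and V: "(\<Sum>l\<in>L. F {u \<in> set P1. a u = l}) \<le> real B"
  obtains a' where "a' ` set Q \<subseteq> L" "\<And>l. l \<in> L \<Longrightarrow> card {u \<in> set Q. a' u = l} = s'"
    "(\<Sum>l\<in>L. F {u \<in> set Q. a' u = l}) \<le> (\<Sum>l\<in>L. F {u \<in> set P1. a u = l})"
    "length Q = card L * s'" "\<And>y r. (y, r) \<in> set R \<Longrightarrow> B < length r \<Longrightarrow> length (removed_part r) = t"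
proof (cases "t = 0")
  case True
  then have "removed_part r = []" for r by (simp add: removed_part_def)
  then have "Rm = []" by (simp add: Rm_def G_eq)
  then have QP: "set Q = set P1" "s' = s" using Q_props(2) s'_t True by auto
  have "{u \<in> set Q. a u \<in> L} = set Q" using L(2) QP by auto
  then have "card (set Q) = card L * s"
    using card_fibres[of "set Q" L a s] L QP by simp
  then have lenQ: "length Q = card L * s'" using QP(2) distinct_card[OF Q_props(1)] by simp
  show ?thesis
    by (rule that[of a]) (use L QP lenQ \<open>\<And>r. removed_part r = []\<close> True in auto)
next
  case False
  then have big: "2 * B < s" "t + B \<le> s" by (auto simp: t_eq)
  have PX: "(!) X ` set P1 \<subseteq> {x. length x = d}" using X_points P1_props(2) .
  have V': "(\<Sum>l\<in>L. im.cost ((!) X) {u \<in> set P1. a u = l}) \<le> real B" using V by (simp add: im_cost)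
  note shrink = im.shrink_clusters[where P = "set P1" and K = L and X = "(!) X" and a = a and s = s
      and b = B and t = t and E = "set Rm"]
  have QD: "set P1 - set Rm = set Q" using Q_props(2) by simp
  have st: "s - t = s'" using s'_t by simp
  have "\<exists>a'. a' ` (set P1 - set Rm) \<subseteq> L \<and> (\<forall>l\<in>L. card {u \<in> set P1 - set Rm. a' u = l} = s - t)
      \<and> (\<Sum>l\<in>L. im.cost ((!) X) {u \<in> set P1 - set Rm. a' u = l})
        \<le> (\<Sum>l\<in>L. im.cost ((!) X) {u \<in> set P1. a u = l})"
    by (rule shrink(3)) (fact finite_set L(1,2) PX V' big Q_props(3) small_groups card_Rm_values
        | rule L(3), assumption)+
  then obtain a' where a': "a' ` set Q \<subseteq> L" "\<And>l. l \<in> L \<Longrightarrow> card {u \<in> set Q. a' u = l} = s'"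
    "(\<Sum>l\<in>L. F {u \<in> set Q. a' u = l}) \<le> (\<Sum>l\<in>L. F {u \<in> set P1. a u = l})"
    unfolding QD st im_cost by (elim exE conjE) (rule that, blast+)
  have "{u \<in> set Q. a' u \<in> L} = set Q" using a'(1) by auto
  then have lenQ: "length Q = card L * s'"
    using card_fibres[of "set Q" L a' s'] L(1) a'(2) Q_props(1) by (simp add: distinct_card)
  show ?thesis
  proof (rule that[OF a' lenQ])
    fix y r assume r: "(y, r) \<in> set R" "B < length r"
    have "card {u \<in> set P1. X ! u = y} = length r"
      using R_group[OF r(1)] residue(4)[OF r(1)] by (simp add: distinct_card)
    moreover have "t \<le> card {u \<in> set P1. X ! u = y}" if "B < card {u \<in> set P1. X ! u = y}"
      by (rule shrink(1)) (fact finite_set L(1,2) PX V' big Q_props(3) small_groups card_Rm_values that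
        | rule L(3), assumption)+
    ultimately have "t \<le> length r" using r(2) by simp
    then show "length (removed_part r) = t" using r(2) by (simp add: removed_part_def)
  qed
qed

end

section \<open>Cheap instances and the shape of the output\<close>

context kernel_input
begin

lemma reducible_if_cheap:
  assumes Cs: "Cs \<in> clusterings" and v: "v = clustering_cost p (d, X, k) Cs" "2 * v < real B + 1"
    and pos: "\<And>Cs. Cs \<in> clusterings \<Longrightarrow> 0 < clustering_cost p (d, X, k) Cs"
  obtains L a where "finite L" "card L = k - length U" "a ` set Q \<subseteq> L"
    "\<And>l. l \<in> (L :: nat set) \<Longrightarrow> card {u \<in> set Q. a u = l} = s'" "length Q = card L * s'" "reducible z"
    "(\<Sum>l\<in>L. F {u \<in> set Q. a u = l}) \<le> 2 * v" "(\<Sum>l\<in>L. F {u \<in> set Q. a u = l}) \<le> real B"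
    "\<And>y r. (y, r) \<in> set R \<Longrightarrow> B < length r \<Longrightarrow> length (removed_part r) = t" "length U < k"
proof -
  have "0 < v" using pos[OF Cs] v by simp
  then obtain L a where La: "finite L" "card L = k - length U" "a ` set P1 \<subseteq> L"
    "\<And>l. l \<in> (L :: nat set) \<Longrightarrow> card {u \<in> set P1. a u = l} = s"
    "(\<Sum>l\<in>L. F {u \<in> set P1. a u = l}) \<le> 2 * v" "(\<Sum>l\<in>L. F {u \<in> set P1. a u = l}) \<le> real B"
    using split_uniform_clusters[OF Cs v(1) _ v(2)] by blast
  have G2: "length G \<le> 2 * B" by (rule length_G_le[OF La(1,3,4,6)])
  obtain a' where a': "a' ` set Q \<subseteq> L" "\<And>l. l \<in> L \<Longrightarrow> card {u \<in> set Q. a' u = l} = s'"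
    "(\<Sum>l\<in>L. F {u \<in> set Q. a' u = l}) \<le> (\<Sum>l\<in>L. F {u \<in> set P1. a u = l})"
    "length Q = card L * s'" "\<And>y r. (y, r) \<in> set R \<Longrightarrow> B < length r \<Longrightarrow> length (removed_part r) = t"
    by (rule shrink_kernel[OF La(1,3,4,6)]) blast+
  have "length U * s \<le> k * s" using length_P1(1) by linarith
  then have Uk: "length U \<le> k" using lengths(3) by simp
  \<comment> \<open>Otherwise the uniform clusters would form a clustering of cost 0.\<close>
  have "length U \<noteq> k"
  proof
    assume U: "length U = k"
    then have "P1 = []" using length_P1(1) by simp
    have "U \<in> clusterings"
    proof (rule clusteringI[OF U P1_props(5)])
      show "set (concat U) = {..<length X}" using P1_props(4) \<open>P1 = []\<close> by simp
      show "length C = s" if "C \<in> set U" for C using that by (rule U_cluster) blast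
    qed
    then show False
      using pos[of U] clusteringD(6)[of U] cost_U by (simp add: sum_list_0 cong: map_cong)
  qed
  then have Uk': "length U < k" using Uk by simp
  then have "length Q > 0" using a'(4) La(2) s'_t(2) by simp
  then have "reducible z"
    using G2 a'(4) unfolding reducible_def G_def[symmetric] Q_def[symmetric] s'_def[symmetric] input_simps by auto
  then show ?thesis
    using that[of L a'] La a' Uk' by (meson order_trans)
qed

lemma Q_nonempty_if_reducible: "reducible z \<Longrightarrow> Q \<noteq> [] \<and> length G \<le> 2 * B \<and> s' dvd length Q"
  unfolding reducible_def G_def[symmetric] Q_def[symmetric] s'_def[symmetric] input_simps
  by (auto simp: mod_eq_0_iff_dvd)

definition selected :: "nat list \<Rightarrow> nat \<Rightarrow> int list" where
  "selected K u = selected_row B (map fst R) K (X ! u)"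

lemma kernel_structure:
  assumes "reducible z"
  obtains K where "distinct K" "set K \<subseteq> {..<d}" "K \<noteq> []" "length K \<le> 2 * B * (B ^ max p 1 + 1)"
    "reduce p z = ((length K, map (selected K) Q, length Q div s'), B)"
    "\<And>x y l. x \<in> fst ` set R \<Longrightarrow> y \<in> fst ` set R \<Longrightarrow> l < d \<Longrightarrow> x ! l \<noteq> y ! l
      \<Longrightarrow> differing K x y \<le> min B d ^ max p 1 \<Longrightarrow> l \<in> set K"
proof -
  note Q = Q_nonempty_if_reducible[OF assms]
  have mapG: "map fst G = map fst R" by (simp add: G_eq comp_def)
  have Gne: "G \<noteq> []" using Q by (auto simp: Q_eq)
  then have Rne: "R \<noteq> []" by (simp add: G_eq)
  let ?Ys = "map fst R" and ?T = "min B d ^ max p 1"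
  have Ys: "length y = d" if "y \<in> set ?Ys" for y
    using that residue(1) lengths(6) by auto
  let ?row = "hd_or [] (map fst G)"
  have row: "length ?row = d"
    using Ys Rne unfolding mapG by (cases R) auto
  obtain K where K: "distinct K" "set K \<subseteq> {..<d}"
    "select_columns B ?T ?row (map (\<lambda>y. (y, [])) ?Ys) = map (\<lambda>y. ([], selected_row B ?Ys K y)) ?Ys"
    "length K \<le> length ?Ys * (?T + 1)"
    "\<And>x y l. x \<in> set ?Ys \<Longrightarrow> y \<in> set ?Ys \<Longrightarrow> l < d \<Longrightarrow> x ! l \<noteq> y ! l \<Longrightarrow> differing K x y \<le> ?T \<Longrightarrow> l \<in> set K"
    by (rule select_columns_rows[of ?Ys d ?row B ?T]) (use Ys row in auto)
  have rows: "final_rows p z = map (\<lambda>y. ([], selected_row B ?Ys K y)) ?Ys"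
    unfolding final_rows_def input_simps G_def[symmetric] row
    using K(3) by (simp add: mapG[symmetric] comp_def)
  have "kernel_points p z = concat (map (\<lambda>g. map (\<lambda>_. selected_row B ?Ys K (fst g)) (fst (snd g))) G)"
  proof -
    have "zip (map f (map fst gs)) gs = map (\<lambda>g. (f (fst g), g)) gs" for f and gs :: "(int list \<times> nat list \<times> nat list) list"
      by (induction gs) auto
    then have "zip (final_rows p z) G = map (\<lambda>g. (([], selected_row B ?Ys K (fst g)), g)) G"
      unfolding rows mapG[symmetric] by simp
    then show ?thesis unfolding kernel_points_def G_def[symmetric] by (simp add: comp_def)
  qed
  also have "\<dots> = concat (map (\<lambda>g. map (selected K) (fst (snd g))) G)"
  proof -
    have "map (\<lambda>_. selected_row B ?Ys K (fst g)) (fst (snd g)) = map (selected K) (fst (snd g))" if "g \<in> set G" for g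
    proof -
      obtain y kp E where g: "g = (y, kp, E)" by (cases g) auto
      have "X ! u = y" if "u \<in> set kp" for u
      proof -
        have "(y, kp, E) \<in> set G" using \<open>g \<in> set G\<close> g by simp
        then show ?thesis by (rule G_group) (use that in blast)
      qed
      then show ?thesis by (simp add: g selected_def)
    qed
    then show ?thesis by (simp cong: map_cong)
  qed
  also have "\<dots> = map (selected K) Q"
    by (simp add: Q_eq map_concat comp_def)
  finally have kp: "kernel_points p z = map (selected K) Q" .
  have "length (hd_or [] (map snd (final_rows p z))) = length K"
    unfolding rows using Rne by (cases R) (auto simp: selected_row_def)
  then have red: "reduce p z = ((length K, map (selected K) Q, length Q div s'), B)"
    using assms kp unfolding reduce_def Q_def[symmetric] s'_def[symmetric] input_simps by simp
  have "length K \<le> length G * (?T + 1)" using K(4) by (simp add: G_eq)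
  also have "\<dots> \<le> 2 * B * (B ^ max p 1 + 1)"
    using Q by (intro mult_mono add_mono power_mono) auto
  finally have lenK: "length K \<le> 2 * B * (B ^ max p 1 + 1)" .
  \<comment> \<open>A single residue would be all of \<open>P1\<close>, a nonempty list shorter than
    \<open>s\<close> with length divisible by \<open>s\<close>. Two residues differ in some column,
    and that column must be selected while no column is.\<close>
  have "K \<noteq> []"
  proof
    assume "K = []"
    obtain g gs where R: "R = g # gs" using Rne by (cases R) auto
    show False
    proof (cases gs)
      case Nil
      have g: "(fst g, snd g) \<in> set R" using R by simp
      have "P1 = snd g" using R Nil by (simp add: P1_def)
      then have "s dvd length (snd g)" using length_P1(2) by simp
      then show False using residue(2,3)[OF g] by (simp add: nat_dvd_not_less)
    next
      case (Cons h hs)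
      have "fst g \<noteq> fst h" using distinct_R R Cons by simp
      moreover have "length (fst g) = d" "length (fst h) = d" using Ys R Cons by auto
      ultimately obtain l where l: "l < d" "fst g ! l \<noteq> fst h ! l" by (metis nth_equalityI)
      then have "l \<in> set K" using R Cons \<open>K = []\<close> by (intro K(5)[of "fst g" "fst h"]) (auto simp: differing_def)
      then show False using \<open>K = []\<close> by simp
    qed
  qed
  then show ?thesis
    using K(5) by (intro that[OF K(1,2) _ lenK red]) auto
qed

text \<open>Position \<open>i\<close> of the kernel stands for position \<open>Q ! i\<close> of the
  input. Completeness of the selection supplies \<open>keep\<close>, and the column compression
  supplies \<open>near\<close> and \<open>far\<close>, for
  \<open>lp_cost_transform_bounded\<close>.\<close>

lemma cost_transfer:
  assumes K: "distinct K" "set K \<subseteq> {..<d}"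
    and complete: "\<And>x y l. x \<in> fst ` set R \<Longrightarrow> y \<in> fst ` set R \<Longrightarrow> l < d \<Longrightarrow> x ! l \<noteq> y ! l
      \<Longrightarrow> differing K x y \<le> min B d ^ max p 1 \<Longrightarrow> l \<in> set K"
    and A: "A \<subseteq> {..<length Q}"
    and cost: "F ((!) Q ` A) \<le> real B \<or> lp_cost p (length K) ((!) (map (selected K) Q)) A \<le> real B"
  shows "lp_cost p (length K) ((!) (map (selected K) Q)) A = F ((!) Q ` A)"
proof -
  let ?Y = "\<lambda>i. X ! (Q ! i)" and ?f = "column_map B (map fst R)"
  have val: "?Y i \<in> fst ` set R" "length (?Y i) = d" if "i \<in> A" for i
  proof -
    have "Q ! i \<in> set Q" using that A by auto
    then have "Q ! i \<in> set P1" using Q_props(2) by blast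
    then show "?Y i \<in> fst ` set R" using values_P1 by blast
    then show "length (?Y i) = d" using residue(1) lengths(6) by auto
  qed
  have "inj_on ((!) Q) A" using inj_on_nth[OF Q_props(1), of A] A by auto
  then have FA: "F ((!) Q ` A) = lp_cost p d ?Y A"
    unfolding lp_cost_def by (simp add: sum.reindex)
  have sel: "lp_cost p (length K) ((!) (map (selected K) Q)) A
      = lp_cost p (length K) (\<lambda>i. map (\<lambda>l. ?f l (?Y i ! l)) K) A"
    unfolding lp_cost_def using A
    by (intro INF_cong sum.cong refl) (auto simp: selected_def selected_row_def subset_iff)
  show ?thesis unfolding sel FA
  proof (rule lp_cost_transform_bounded[OF K])
    show "finite A" using A finite_subset by blast
    show "l \<in> set K" if "i \<in> A" "j \<in> A" "l < d" "?Y i ! l \<noteq> ?Y j ! l"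
      "card {l \<in> set K. ?Y i ! l \<noteq> ?Y j ! l} \<le> min B d ^ max p 1" for i j l
    proof (rule complete[OF val(1)[OF that(1)] val(1)[OF that(2)] that(3,4)])
      have "distinct (filter (\<lambda>l. ?Y i ! l \<noteq> ?Y j ! l) K)" using K(1) by simp
      from distinct_card[OF this] show "differing K (?Y i) (?Y j) \<le> min B d ^ max p 1"
        using that(5) by (simp add: differing_def)
    qed
    show "?f l (?Y i ! l) - ?f l (?Y j ! l) = ?Y i ! l - ?Y j ! l"
      if "l < d" "i \<in> A" "j \<in> A" "\<bar>?Y i ! l - ?Y j ! l\<bar> \<le> int B" for l i j
      using column_map_diff(1)[of "?Y i" "map fst R" "?Y j" l B] val(1) that by simp
    show "int B < \<bar>?f l (?Y i ! l) - ?f l (?Y j ! l)\<bar>"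
      if "l < d" "i \<in> A" "j \<in> A" "int B < \<bar>?Y i ! l - ?Y j ! l\<bar>" for l i j
      using column_map_diff(2)[of "?Y i" "map fst R" "?Y j" B l] val(1) that by simp
    show "lp_cost p d ?Y A \<le> real B \<or> lp_cost p (length K) (\<lambda>i. map (\<lambda>l. ?f l (?Y i ! l)) K) A \<le> real B"
      using cost unfolding sel FA .
  qed (use val(2) in auto)
qed

lemma kernel_instance:
  assumes "reducible z" "K \<noteq> []"
  shows "(length K, map (selected K) Q, length Q div s') \<in> clust_insts"
    and "length Q = (length Q div s') * s'" "0 < length Q div s'"
proof -
  note Q = Q_nonempty_if_reducible[OF assms(1)]
  show *: "length Q = (length Q div s') * s'" using Q by simp
  then show "0 < length Q div s'" using Q by (cases "length Q div s' = 0") auto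
  moreover have "length Q div s' dvd length Q" using * by (metis dvd_triv_left)
  ultimately show "(length K, map (selected K) Q, length Q div s') \<in> clust_insts"
    using Q assms(2) by (auto simp: clust_insts_def selected_def selected_row_def)
qed

lemma cheap_kernel_clustering:
  assumes K: "distinct K" "set K \<subseteq> {..<d}"
    and complete: "\<And>x y l. x \<in> fst ` set R \<Longrightarrow> y \<in> fst ` set R \<Longrightarrow> l < d \<Longrightarrow> x ! l \<noteq> y ! l
      \<Longrightarrow> differing K x y \<le> min B d ^ max p 1 \<Longrightarrow> l \<in> set K"
    and La: "finite L" "a ` set Q \<subseteq> L" "\<And>l. l \<in> (L :: nat set) \<Longrightarrow> card {u \<in> set Q. a u = l} = s'"
    "length Q = card L * s'" "(\<Sum>l\<in>L. F {u \<in> set Q. a u = l}) \<le> real B"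
  obtains Cs where "Cs \<in> equal_clusterings (length K, map (selected K) Q, length Q div s')"
    "clustering_cost p (length K, map (selected K) Q, length Q div s') Cs = (\<Sum>l\<in>L. F {u \<in> set Q. a u = l})"
proof -
  let ?X = "map (selected K) Q" and ?F = "lp_cost p (length K) ((!) (map (selected K) Q))"
  let ?b = "\<lambda>i. a (Q ! i)"
  have img: "(!) Q ` {i \<in> {..<length Q}. ?b i = l} = {u \<in> set Q. a u = l}" for l
    by (auto simp: set_conv_nth)
  have inj: "inj_on ((!) Q) {i \<in> {..<length Q}. ?b i = l}" for l
    by (rule inj_on_nth[OF Q_props(1)]) auto
  have card_b: "card {i \<in> {..<length Q}. ?b i = l} = s'" if "l \<in> L" for l
    using card_image[OF inj, of l] La(3)[OF that] unfolding img by simp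
  have b_img: "?b ` {..<length Q} \<subseteq> L" using La(2) by auto
  have F_fib: "?F {i \<in> {..<length Q}. ?b i = l} = F {u \<in> set Q. a u = l}" if l: "l \<in> L" for l
  proof -
    have "set Q \<subseteq> {..<length X}" using Q_props(2) P1_props(2) by blast
    then have nn: "0 \<le> F {u \<in> set Q. a u = l}" for l by (intro F_nonneg) auto
    have "F {u \<in> set Q. a u = l} \<le> (\<Sum>l\<in>L. F {u \<in> set Q. a u = l})"
      using l La(1) nn by (intro member_le_sum) auto
    then have "F ((!) Q ` {i \<in> {..<length Q}. ?b i = l}) \<le> real B" using La(5) unfolding img by linarith
    then have "?F {i \<in> {..<length Q}. ?b i = l} = F ((!) Q ` {i \<in> {..<length Q}. ?b i = l})"
      by (intro cost_transfer[OF K complete]) auto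
    then show ?thesis unfolding img .
  qed
  obtain Cs where Cs: "length Cs = card L" "distinct (concat Cs)" "set (concat Cs) = {..<length Q}"
    "\<And>C. C \<in> set Cs \<Longrightarrow> length C = s'" "(\<Sum>C\<leftarrow>Cs. ?F (set C)) = (\<Sum>l\<in>L. ?F {i \<in> {..<length Q}. ?b i = l})"
    using assignment_to_clustering[of "{..<length Q}" L ?b s' ?F] La(1) b_img card_b by auto
  have len: "length Q div s' = card L" using La(4) s'_t(2) by simp
  show ?thesis
  proof (rule that)
    show "Cs \<in> equal_clusterings (length K, ?X, length Q div s')"
    proof (cases "card L = 0")
      case True
      then show ?thesis using Cs La(4) len by simp
    next
      case False
      then have "length Q div card L = s'" using La(4) by simp
      then show ?thesis using Cs len by (simp del: set_concat)
    qed
    have "clustering_cost p (length K, ?X, length Q div s') Cs = (\<Sum>C\<leftarrow>Cs. ?F (set C))"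
      by (rule clustering_cost_eq[OF Cs(2)])
    also have "\<dots> = (\<Sum>l\<in>L. F {u \<in> set Q. a u = l})" unfolding Cs(5) using F_fib by simp
    finally show "clustering_cost p (length K, ?X, length Q div s') Cs = (\<Sum>l\<in>L. F {u \<in> set Q. a u = l})" .
  qed
qed

end

subsection \<open>Lifting\<close>

lemma filter_fst_enumerate:
  "map snd (filter (\<lambda>u. fst u = n + i) (List.enumerate n xs)) = (if i < length xs then [xs ! i] else [])"
proof (induction xs arbitrary: n i)
  case (Cons x xs)
  show ?case
  proof (cases i)
    case 0
    have "filter (\<lambda>u. fst u = n) (List.enumerate (Suc n) xs) = []"
      by (auto simp: filter_empty_conv in_set_enumerate_eq)
    then show ?thesis using 0 by simp
  next
    case (Suc j)
    then show ?thesis using Cons.IH[of "Suc n" j] by simp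
  qed
qed simp

lemma original_positions_eq:
  assumes "set C \<subseteq> {..<length (kept z)}"
  shows "original_positions z C = map ((!) (kept z)) C"
proof -
  have "map snd (filter (\<lambda>u. fst u = i) (List.enumerate 0 (kept z))) = [kept z ! i]" if "i \<in> set C" for i
    using filter_fst_enumerate[of 0 i "kept z"] that assms by auto
  then have "original_positions z C = concat (map (\<lambda>i. [kept z ! i]) C)"
    unfolding original_positions_def by (simp cong: map_cong)
  then show ?thesis by (simp add: concat_map_singleton)
qed

lemma mset_concat_swap:
  "mset (concat (map (\<lambda>C. concat (map (f C) (g # gs))) Cs))
    = mset (concat (map (\<lambda>C. f C g) Cs)) + mset (concat (map (\<lambda>C. concat (map (f C) gs)) Cs))"
  by (induction Cs) (auto simp: ac_simps)

lemma mset_concat_if_le: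
  assumes "length (filter P Cs) \<le> 1"
  shows "mset (concat (map (\<lambda>C. if P C then E else []) Cs)) \<subseteq># mset E"
proof -
  have "filter P Cs = [] \<Longrightarrow> concat (map (\<lambda>C. if P C then E else []) Cs) = []" for Cs
    by (induction Cs) (auto split: if_splits)
  then show ?thesis using assms by (induction Cs) (auto split: if_splits)
qed

lemma concat_map_if_unique:
  assumes "distinct gs" "g \<in> set gs" "\<And>h. h \<in> set gs \<Longrightarrow> P h \<longleftrightarrow> h = g"
  shows "concat (map (\<lambda>h. if P h then f h else []) gs) = f g"
proof -
  have none: "concat (map (\<lambda>h. if P h then f h else []) hs) = []" if "\<And>h. h \<in> set hs \<Longrightarrow> \<not> P h" for hs
    using that by (induction hs) auto
  obtain hs1 hs2 where gs: "gs = hs1 @ g # hs2" using assms(2) by (auto simp: in_set_conv_decomp)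
  have h: "\<And>h. h \<in> set hs1 \<Longrightarrow> \<not> P h" "\<And>h. h \<in> set hs2 \<Longrightarrow> \<not> P h" "P g"
    using assms gs by auto
  show ?thesis unfolding gs
    by (simp only: map_append list.map concat_append concat.simps none[of hs1, OF h(1)]
      none[of hs2, OF h(2)] h(3) if_True append_Nil append_Nil2)
qed

context kernel_input
begin

definition extension :: "nat list \<Rightarrow> nat list" where
  "extension C = concat (map (\<lambda>g. if length C < 2 * length (filter (\<lambda>q. q \<in> set (fst (snd g))) C)
    then snd (snd g) else []) G)"

lemma restore_eq: "restore z C = C @ extension C"
  by (simp add: restore_def extension_def G_def)

lemma default_clustering: "default_clustering z \<in> clusterings"
proof -
  have dvd: "s dvd length [0..<length X]" using lengths(1) by simp
  note ex = chunks_exact[OF lengths(3) dvd]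
  have def: "default_clustering z = snd (chunks s [0..<length X])"
    by (simp add: default_clustering_def s_def input_simps map_fst_enumerate_0)
  show ?thesis unfolding def
  proof (rule clusteringI)
    show "length (snd (chunks s [0..<length X])) = k" using ex(3) lengths(1,3) by simp
    show "distinct (concat (snd (chunks s [0..<length X])))"
      using mset_eq_imp_distinct_iff[OF ex(2)] by simp
    show "set (concat (snd (chunks s [0..<length X]))) = {..<length X}"
      using mset_eq_setD[OF ex(2)] by (simp only: set_upt atLeast0LessThan)
    show "length C = s" if "C \<in> set (snd (chunks s [0..<length X]))" for C
      using that by (rule length_chunk)
  qed
qed

context
  fixes K :: "nat list" and Cs :: "nat list list"
  assumes red: "reducible z" and K_ne: "K \<noteq> []"
    and Cs: "Cs \<in> equal_clusterings (length K, map (selected K) Q, length Q div s')"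
begin

lemma kernel_clusteringD:
  "length Cs = length Q div s'" "distinct (concat Cs)" "set (concat Cs) = {..<length Q}"
  "\<And>C. C \<in> set Cs \<Longrightarrow> length C = s'" "\<And>C. C \<in> set Cs \<Longrightarrow> set C \<subseteq> {..<length Q}"
  "\<And>C. C \<in> set Cs \<Longrightarrow> distinct C"
proof -
  note inst = kernel_instance[OF red K_ne]
  have "length Q div (length Q div s') = s'"
    using inst(2,3) by (metis nonzero_mult_div_cancel_left not_less_zero)
  then show 1: "length Cs = length Q div s'" "distinct (concat Cs)" "set (concat Cs) = {..<length Q}"
    "\<And>C. C \<in> set Cs \<Longrightarrow> length C = s'"
    using Cs by simp_all
  show "set C \<subseteq> {..<length Q}" if "C \<in> set Cs" for C unfolding 1(3)[symmetric] using that by auto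
  show "distinct C" if "C \<in> set Cs" for C using 1(2) that by (simp add: distinct_concat_iff)
qed

lemma positions_map: "C \<in> set Cs \<Longrightarrow> original_positions z C = map ((!) Q) C"
  using original_positions_eq[of C z] kernel_clusteringD(5) by (simp add: Q_def)

lemma lifted_eq: "lifted z Cs = U @ map (\<lambda>C. map ((!) Q) C @ extension (map ((!) Q) C)) Cs"
  by (simp add: lifted_def restore_eq U_def positions_map cong: map_cong)

lemma mset_original: "mset (concat (map (map ((!) Q)) Cs)) = mset Q"
proof -
  have "mset (concat Cs) = mset [0..<length Q]"
    using kernel_clusteringD(2,3)
    by (simp only: set_eq_iff_mset_eq_distinct[OF _ distinct_upt, symmetric] set_upt atLeast0LessThan)
  then have "image_mset ((!) Q) (mset (concat Cs)) = image_mset ((!) Q) (mset [0..<length Q])" by simp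
  then have "mset (map ((!) Q) (concat Cs)) = mset (map ((!) Q) [0..<length Q])" by (simp only: mset_map)
  then show ?thesis by (simp only: map_nth map_concat)
qed

text \<open>This holds for every kernel solution, cheap or not. Two clusters with a majority in the
  same kept part would need at least \<open>s' + 1\<close> of its entries, but it has fewer than
  \<open>s'\<close> if anything was removed from it.\<close>

lemma mset_extensions: "mset (concat (map extension (map (map ((!) Q)) Cs))) \<subseteq># mset Rm"
proof -
  let ?Ds = "map (map ((!) Q)) Cs"
  let ?P = "\<lambda>C g. length C < 2 * length (filter (\<lambda>q. q \<in> set (fst (snd g))) C)"
  have one: "mset (concat (map (\<lambda>C. if ?P C g then snd (snd g) else []) ?Ds)) \<subseteq># mset (snd (snd g))"
    if g: "g \<in> set G" for g
  proof (cases "snd (snd g) = []")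
    case True
    have "concat (map (\<lambda>C. if ?P C g then snd (snd g) else []) Ds) = []" for Ds
      unfolding True by (induction Ds) auto
    then show ?thesis by (simp only: mset.simps empty_le)
  next
    case False
    obtain y kp E where gE: "g = (y, kp, E)" by (cases g) auto
    then have "(y, kp, E) \<in> set G" using g by simp
    then obtain r where r: "(y, r) \<in> set R" "kp = kept_part r" "E = removed_part r" by (rule G_group)
    have kp: "length kp < s'" using length_kept_part(2)[OF residue(3)[OF r(1)]] r False gE by simp
    have len: "length C = s'" if "C \<in> set ?Ds" for C using that kernel_clusteringD(4) by auto
    have "length (filter (\<lambda>C. ?P C g) Ds) * (s' + 1) \<le> 2 * length (filter (\<lambda>q. q \<in> set kp) (concat Ds))"
      if "\<And>C. C \<in> set Ds \<Longrightarrow> length C = s'" for Ds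
      using that
    proof (induction Ds)
      case (Cons D Ds)
      then have IH: "length (filter (\<lambda>C. ?P C g) Ds) * (s' + 1) \<le> 2 * length (filter (\<lambda>q. q \<in> set kp) (concat Ds))"
        and D: "length D = s'" by auto
      show ?case
      proof (cases "?P D g")
        case True
        then have "s' + 1 \<le> 2 * length (filter (\<lambda>q. q \<in> set kp) D)" using D gE by simp
        then show ?thesis using IH True by simp
      next
        case False
        then show ?thesis using IH by simp
      qed
    qed simp
    then have "length (filter (\<lambda>C. ?P C g) ?Ds) * (s' + 1) \<le> 2 * length (filter (\<lambda>q. q \<in> set kp) (concat ?Ds))"
      using len by blast
    also have "length (filter (\<lambda>q. q \<in> set kp) (concat ?Ds)) = length (filter (\<lambda>q. q \<in> set kp) Q)"
      using mset_original by (metis mset_filter size_mset)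
    also have "\<dots> = card (set (filter (\<lambda>q. q \<in> set kp) Q))"
      by (rule distinct_card[symmetric]) (simp add: Q_props(1))
    also have "\<dots> \<le> card (set kp)" by (intro card_mono) auto
    also have "\<dots> \<le> length kp" by (rule card_length)
    finally have "length (filter (\<lambda>C. ?P C g) ?Ds) * (s' + 1) \<le> 2 * length kp" by simp
    also have "\<dots> < 2 * (s' + 1)" using kp by simp
    finally have "length (filter (\<lambda>C. ?P C g) ?Ds) < 2" by (simp only: mult_less_cancel2)
    then show ?thesis by (intro mset_concat_if_le) simp
  qed
  have "mset (concat (map (\<lambda>C. concat (map (\<lambda>g. if ?P C g then snd (snd g) else []) gs)) ?Ds))
      \<subseteq># mset (concat (map (\<lambda>g. snd (snd g)) gs))" if "set gs \<subseteq> set G" for gs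
    using that
  proof (induction gs)
    case Nil
    have "concat (map (\<lambda>C. []) Ds) = []" for Ds :: "nat list list" by (induction Ds) auto
    then show ?case by simp
  next
    case (Cons g gs)
    have "mset (concat (map (\<lambda>C. if ?P C g then snd (snd g) else []) ?Ds))
        + mset (concat (map (\<lambda>C. concat (map (\<lambda>g. if ?P C g then snd (snd g) else []) gs)) ?Ds))
        \<subseteq># mset (snd (snd g)) + mset (concat (map (\<lambda>g. snd (snd g)) gs))"
      using Cons by (intro subset_mset.add_mono one) auto
    then show ?case unfolding mset_concat_swap by (simp only: list.map concat.simps mset_append)
  qed
  from this[of G] show ?thesis unfolding extension_def[abs_def] Rm_def by (simp only: order_refl)
qed

text \<open>No position is used twice, so the right number of clusters of the right size already
  forces a partition; this makes the test in \<open>lift\<close> sufficient.\<close>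

lemma lifted_valid:
  assumes "length (lifted z Cs) = k" "\<And>C. C \<in> set (lifted z Cs) \<Longrightarrow> length C = s"
  shows "lifted z Cs \<in> clusterings"
proof -
  have "mset (concat (map (\<lambda>C. f C @ g C) Ds)) = mset (concat (map f Ds)) + mset (concat (map g Ds))"
    for f g :: "nat list \<Rightarrow> nat list" and Ds
    by (induction Ds) (auto simp: ac_simps)
  then have "mset (concat (lifted z Cs)) = mset (concat U) + (mset (concat (map (map ((!) Q)) Cs))
      + mset (concat (map extension (map (map ((!) Q)) Cs))))"
    unfolding lifted_eq by (simp add: comp_def)
  also have "\<dots> \<subseteq># mset (concat U) + (mset Q + mset Rm)"
    unfolding mset_original using mset_extensions by simp
  also have "\<dots> = mset [0..<length X]" unfolding mset_Q_Rm by (rule mset_U_P1)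
  finally have sub: "mset (concat (lifted z Cs)) \<subseteq># mset [0..<length X]" .
  moreover have "size (mset (concat (lifted z Cs))) = size (mset [0..<length X])"
    using length_concat_uniform[of "lifted z Cs" s] assms lengths(1) by simp
  ultimately have eq: "mset (concat (lifted z Cs)) = mset [0..<length X]"
    by (metis mset_subset_size less_irrefl subset_mset.le_imp_less_or_eq)
  show ?thesis
  proof (rule clusteringI[OF assms(1) _ _ assms(2)])
    show "distinct (concat (lifted z Cs))" using mset_eq_imp_distinct_iff[OF eq] by simp
    show "set (concat (lifted z Cs)) = {..<length X}"
      using mset_eq_setD[OF eq] by (simp only: set_upt atLeast0LessThan)
  qed
qed

lemma lift_valid: "lift (z, w, Cs) \<in> clusterings"
  using lifted_valid default_clustering
  by (auto simp: lift_def input_simps s_def)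

text \<open>If \<open>t > 0\<close>, the cluster has \<open>2 * B + 1\<close> points and hence a
  majority point with at least \<open>B + 1\<close> copies. Its group is therefore one of those that
  lost exactly \<open>t\<close> copies, no other group has a majority, and the copies come back at
  no cost.\<close>

lemma restore_cluster:
  assumes full: "\<And>y r. (y, r) \<in> set R \<Longrightarrow> B < length r \<Longrightarrow> length (removed_part r) = t"
    and C: "C \<in> set Cs" and cheap: "F ((!) Q ` set C) \<le> real B"
  defines "D \<equiv> map ((!) Q) C"
  shows "length (D @ extension D) = s" "F (set (D @ extension D)) = F (set D)"
proof -
  have lenD: "length D = s'" using kernel_clusteringD(4)[OF C] by (simp add: D_def)
  have DQ: "set D \<subseteq> set Q" using kernel_clusteringD(5)[OF C] by (auto simp: D_def)
  have dD: "distinct D"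
    unfolding D_def distinct_map using kernel_clusteringD(5,6)[OF C]
    by (intro conjI inj_on_nth Q_props(1)) auto
  have cardD: "card (set D) = s'" using dD lenD by (simp add: distinct_card)
  have DX: "set D \<subseteq> {..<length X}" using DQ Q_props(2) P1_props(2) by blast
  have FD: "F (set D) \<le> real B" using cheap by (simp add: D_def)
  have "length (D @ extension D) = s \<and> F (set (D @ extension D)) = F (set D)"
  proof (cases "t = 0")
    case True
    then have "snd (snd g) = []" if "g \<in> set G" for g
      using that by (auto simp: G_eq removed_part_def)
    then have "extension D = []" by (auto simp: extension_def)
    then show ?thesis using lenD s'_t True by simp
  next
    case False
    then have s': "s' = 2 * B + 1" by (simp add: s'_eq t_eq)
    have c: "im.cost ((!) X) (set D) \<le> real B" "2 * B < card (set D)"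
      using FD cardD s' by (simp_all add: im_cost)
    obtain y where y: "y \<in> {x. length x = d}" "card (set D) < 2 * card {u \<in> set D. X ! u = y}"
      "card (set D) \<le> card {u \<in> set D. X ! u = y} + B"
      by (rule im.majority[OF finite_set X_points[OF DX] c]) (rule that, assumption+)
    have "card {u \<in> set D. X ! u = y} \<noteq> 0" using y(2) by linarith
    then have "{u \<in> set D. X ! u = y} \<noteq> {}" by (metis card.empty)
    then obtain u where u: "u \<in> set D" "X ! u = y" by blast
    then have "u \<in> set P1" using DQ Q_props(2) by blast
    then have "y \<in> fst ` set R" using values_P1 u(2) by blast
    then obtain r where r: "(y, r) \<in> set R" by auto
    let ?g = "(y, kept_part r, removed_part r)"
    have gG: "?g \<in> set G" using r by (force simp: G_eq)
    have parts: "{u \<in> set Q. X ! u = y'} = set kp" if "(y', kp, E) \<in> set G" for y' kp E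
      using that by (rule G_group) blast
    have cnt: "length (filter (\<lambda>q. q \<in> set kp) D) = card {u \<in> set D. X ! u = y'}"
      if "(y', kp, E) \<in> set G" for y' kp E
    proof -
      have "length (filter (\<lambda>q. q \<in> set kp) D) = card (set (filter (\<lambda>q. q \<in> set kp) D))"
        by (rule distinct_card[symmetric]) (simp add: dD)
      also have "set (filter (\<lambda>q. q \<in> set kp) D) = {u \<in> set D. X ! u = y'}"
        using parts[OF that] DQ by auto
      finally show ?thesis .
    qed
    have "B + 1 \<le> card {u \<in> set D. X ! u = y}" using y(3) cardD s' by simp
    also have "\<dots> \<le> card {u \<in> set P1. X ! u = y}" using DQ Q_props(2) by (intro card_mono) auto
    also have "\<dots> = length r" using R_group[OF r] residue(4)[OF r] by (simp add: distinct_card)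
    finally have "length (removed_part r) = t" using full[OF r] by simp
    have "extension D = snd (snd ?g)"
      unfolding extension_def
    proof (rule concat_map_if_unique[OF _ gG])
      show "distinct G" using distinct_G by (simp add: distinct_map)
      show "length D < 2 * length (filter (\<lambda>q. q \<in> set (fst (snd h))) D) \<longleftrightarrow> h = ?g" if h: "h \<in> set G" for h
      proof (cases "h = ?g")
        case True
        then show ?thesis using cnt[OF gG] y(2) cardD lenD by simp
      next
        case False
        obtain y' kp E where h': "h = (y', kp, E)" by (cases h) auto
        have "y' \<noteq> y"
        proof
          assume "y' = y"
          then have "fst h = fst ?g" using h' by simp
          moreover have "inj_on fst (set G)" using distinct_G by (simp only: distinct_map)
          ultimately have "h = ?g" using h gG by (simp only: inj_on_eq_iff)
          then show False using False by simp
        qed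
        then have "card {u \<in> set D. X ! u = y'} + card {u \<in> set D. X ! u = y}
            = card ({u \<in> set D. X ! u = y'} \<union> {u \<in> set D. X ! u = y})"
          by (intro card_Un_disjoint[symmetric]) auto
        also have "\<dots> \<le> card (set D)" by (intro card_mono) auto
        finally have "2 * card {u \<in> set D. X ! u = y'} \<le> card (set D)" using y(2) by linarith
        then show ?thesis using False h' cnt[of y' kp E] h cardD lenD by simp
      qed
    qed
    then have ext: "extension D = removed_part r" by simp
    have Ey: "u \<in> set Rm \<and> X ! u = y" if "u \<in> set (removed_part r)" for u
    proof -
      have "{u \<in> set Rm. X ! u = y} = set (removed_part r)" using gG by (rule G_group) blast
      then show ?thesis using that by blast
    qed
    have "F (set D \<union> set (removed_part r)) = F (set D)"
      unfolding im_cost[symmetric]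
    proof (rule im.cost_Un_majority[OF _ _ _ X_points[OF DX] y(1)])
      show "set D \<inter> set (removed_part r) = {}" using Ey DQ Q_props(5) by blast
    qed (use Ey y(2) in auto)
    then show ?thesis
      using ext lenD \<open>length (removed_part r) = t\<close> s'_t(1) by simp
  qed
  then show "length (D @ extension D) = s" "F (set (D @ extension D)) = F (set D)" by auto
qed

text \<open>\<open>full\<close> and \<open>count\<close> make the test in \<open>lift\<close>
  succeed. The uniform clusters contribute 0, and every other cluster keeps its cost under
  restoration and under the change of coordinates.\<close>

lemma lift_cost:
  assumes full: "\<And>y r. (y, r) \<in> set R \<Longrightarrow> B < length r \<Longrightarrow> length (removed_part r) = t"
    and count: "length U + length Q div s' = k"
    and K: "distinct K" "set K \<subseteq> {..<d}"
    and complete: "\<And>x y l. x \<in> fst ` set R \<Longrightarrow> y \<in> fst ` set R \<Longrightarrow> l < d \<Longrightarrow> x ! l \<noteq> y ! l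
      \<Longrightarrow> differing K x y \<le> min B d ^ max p 1 \<Longrightarrow> l \<in> set K"
    and cost: "clustering_cost p (length K, map (selected K) Q, length Q div s') Cs \<le> real B"
  shows "clustering_cost p (d, X, k) (lift (z, w, Cs))
    = clustering_cost p (length K, map (selected K) Q, length Q div s') Cs"
proof -
  let ?F = "lp_cost p (length K) ((!) (map (selected K) Q))"
  interpret jm: integral_metric "pdist p" "{c. length c = length K}" "{x. length x = length K}" real_point
    by (rule integral_metric_pdist)
  have cost_eq: "clustering_cost p (length K, map (selected K) Q, length Q div s') Cs = (\<Sum>C\<leftarrow>Cs. ?F (set C))"
    by (rule clustering_cost_eq[OF kernel_clusteringD(2)])
  have nn: "0 \<le> ?F (set C)" if "C \<in> set Cs" for C
  proof -
    have "(!) (map (selected K) Q) ` set C \<subseteq> {x. length x = length K}"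
      using kernel_clusteringD(5)[OF that] by (auto simp: selected_def selected_row_def)
    from jm.cost_nonneg[OF this] show ?thesis by (simp add: lp_cost_eq)
  qed
  have le: "?F (set C) \<le> real B" if "C \<in> set Cs" for C
  proof -
    have "?F (set C) \<le> (\<Sum>C\<leftarrow>Cs. ?F (set C))"
      by (rule member_le_sum_list[of "?F (set C)" "map (\<lambda>C. ?F (set C)) Cs"]) (use that nn in auto)
    then show ?thesis using cost cost_eq by linarith
  qed
  have tr: "?F (set C) = F ((!) Q ` set C)" if "C \<in> set Cs" for C
    by (rule cost_transfer[OF K complete kernel_clusteringD(5)[OF that]]) (use le[OF that] in blast)+
  have rest: "length (map ((!) Q) C @ extension (map ((!) Q) C)) = s"
    "F (set (map ((!) Q) C @ extension (map ((!) Q) C))) = ?F (set C)" if C: "C \<in> set Cs" for C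
  proof -
    have cheap: "F ((!) Q ` set C) \<le> real B" using le[OF C] tr[OF C] by simp
    show "length (map ((!) Q) C @ extension (map ((!) Q) C)) = s"
      by (rule restore_cluster(1)[OF full C cheap])
    have "F (set (map ((!) Q) C @ extension (map ((!) Q) C))) = F (set (map ((!) Q) C))"
      by (rule restore_cluster(2)[OF full C cheap])
    then show "F (set (map ((!) Q) C @ extension (map ((!) Q) C))) = ?F (set C)"
      unfolding tr[OF C] by simp
  qed
  have lenU: "length C = s" if "C \<in> set U" for C using that by (rule U_cluster) blast
  have len: "length (lifted z Cs) = k" "\<And>C. C \<in> set (lifted z Cs) \<Longrightarrow> length C = s"
    unfolding lifted_eq using count kernel_clusteringD(1) rest(1) lenU by auto
  then have lift_eq: "lift (z, w, Cs) = lifted z Cs"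
    using red by (auto simp: lift_def input_simps s_def)
  have "clustering_cost p (d, X, k) (lifted z Cs) = (\<Sum>C\<leftarrow>lifted z Cs. F (set C))"
    by (rule clusteringD(6)[OF lifted_valid[OF len]])
  also have "\<dots> = (\<Sum>C\<leftarrow>U. F (set C)) + (\<Sum>C\<leftarrow>Cs. F (set (map ((!) Q) C @ extension (map ((!) Q) C))))"
    unfolding lifted_eq by (simp only: map_append sum_list_append map_map comp_def)
  also have "(\<Sum>C\<leftarrow>U. F (set C)) = 0"
    using cost_U by (simp add: sum_list_0 cong: map_cong)
  also have "map (\<lambda>C. F (set (map ((!) Q) C @ extension (map ((!) Q) C)))) Cs = map (\<lambda>C. ?F (set C)) Cs"
    using rest(2) by (intro map_cong refl)
  finally show ?thesis unfolding lift_eq cost_eq by simp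
qed

end

end

subsection \<open>Approximation ratio and size\<close>

lemma sols_simps [simp]:
  "insts (equal_clustering_problem p) = clust_insts"
  "sols (equal_clustering_problem p) I B = equal_clusterings I"
  "val (equal_clustering_problem p) I B Cs = clustering_value p I B Cs"
  "enc_inst (equal_clustering_problem p) = enc_prod enc_nat (enc_prod (enc_list (enc_list enc_int)) enc_nat)"
  "enc_sol (equal_clustering_problem p) = enc_list (enc_list enc_nat)"
  by (simp_all add: equal_clustering_problem_def)

lemma clustering_cost_nonneg:
  assumes "(d, X, k) \<in> clust_insts" "Cs \<in> equal_clusterings (d, X, k)"
  shows "0 \<le> clustering_cost p (d, X, k) Cs"
proof -
  interpret kernel_input p d X k 0 by unfold_locales (rule assms(1))
  have "0 \<le> F (set C)" if "C \<in> set Cs" for C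
    by (rule F_nonneg[OF clusteringD(5)[OF assms(2) that]])
  then have "0 \<le> (\<Sum>C\<leftarrow>Cs. F (set C))" by (intro sum_list_nonneg) auto
  then show ?thesis using clusteringD(6)[OF assms(2)] by simp
qed

lemma Opt_props:
  assumes "I \<in> clust_insts"
  shows "Cs \<in> equal_clusterings I \<Longrightarrow> Opt (equal_clustering_problem p) I B \<le> clustering_value p I B Cs"
    and "\<exists>Cs\<in>equal_clusterings I. Opt (equal_clustering_problem p) I B = clustering_value p I B Cs"
    and "0 \<le> Opt (equal_clustering_problem p) I B"
proof -
  let ?V = "clustering_value p I B ` equal_clusterings I"
  have fin: "finite ?V" and ne: "?V \<noteq> {}"
    using finite_equal_clusterings equal_clusterings_nonempty[OF assms] by auto
  have Opt: "Opt (equal_clustering_problem p) I B = Min ?V" by (simp add: Opt_def)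
  show "Cs \<in> equal_clusterings I \<Longrightarrow> Opt (equal_clustering_problem p) I B \<le> clustering_value p I B Cs"
    unfolding Opt using fin by (intro Min_le) auto
  show ex: "\<exists>Cs\<in>equal_clusterings I. Opt (equal_clustering_problem p) I B = clustering_value p I B Cs"
    unfolding Opt using Min_in[OF fin ne] by auto
  obtain d X k where I: "I = (d, X, k)" by (cases I) auto
  from ex obtain Cs where Cs: "Cs \<in> equal_clusterings I"
    "Opt (equal_clustering_problem p) I B = clustering_value p I B Cs" by blast
  have "0 \<le> clustering_cost p I Cs" unfolding I
    by (rule clustering_cost_nonneg) (use assms Cs I in blast)+
  then show "0 \<le> Opt (equal_clustering_problem p) I B" using Cs(2) by (simp add: clustering_value_def)
qed

lemma clustering_value_le: "clustering_value p I B Cs \<le> real B + 1"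
  by (simp add: clustering_value_def)

lemma ratio_ge_1:
  assumes "I \<in> clust_insts" "Cs \<in> equal_clusterings I"
  shows "1 \<le> ratio (clustering_value p I B Cs) (Opt (equal_clustering_problem p) I B)"
  using Opt_props(1)[OF assms, of p B] Opt_props(3)[OF assms(1), of p B] by (auto simp: ratio_def)

context kernel_input
begin

lemma trivial_reduce: "\<not> reducible z \<Longrightarrow> reduce p z = ((1, [[0]], 1), 0)"
  by (simp add: reduce_def)

lemma reduce_instance: "fst (reduce p z) \<in> clust_insts"
proof (cases "reducible z")
  case True
  then obtain K where K: "K \<noteq> []" "reduce p z = ((length K, map (selected K) Q, length Q div s'), B)"
    by (rule kernel_structure)
  show ?thesis unfolding K(2) fst_conv by (rule kernel_instance(1)[OF True K(1)])
qed (simp add: trivial_reduce clust_insts_def)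

lemma lift_sound:
  assumes "Cs \<in> equal_clusterings (fst (reduce p z))"
  shows "lift (z, w, Cs) \<in> clusterings"
proof (cases "reducible z")
  case True
  then obtain K where K: "K \<noteq> []" "reduce p z = ((length K, map (selected K) Q, length Q div s'), B)"
    by (rule kernel_structure)
  from assms have "Cs \<in> equal_clusterings (length K, map (selected K) Q, length Q div s')"
    by (simp only: K(2) fst_conv)
  with True K(1) show ?thesis by (rule lift_valid)
next
  case False
  then show ?thesis using default_clustering by (simp add: lift_def)
qed

lemma cheap_case:
  assumes Cs: "Cs \<in> clusterings" and v: "v = clustering_cost p (d, X, k) Cs" "2 * v < real B + 1"
    and pos: "\<forall>Cs\<in>clusterings. 0 < clustering_cost p (d, X, k) Cs"
  shows "snd (reduce p z) = B"
    and "\<exists>Ds\<in>equal_clusterings (fst (reduce p z)). clustering_cost p (fst (reduce p z)) Ds \<le> 2 * v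
      \<and> clustering_cost p (fst (reduce p z)) Ds \<le> real B"
    and "Ds \<in> equal_clusterings (fst (reduce p z)) \<Longrightarrow> clustering_cost p (fst (reduce p z)) Ds \<le> real B
      \<Longrightarrow> clustering_cost p (d, X, k) (lift (z, w, Ds)) = clustering_cost p (fst (reduce p z)) Ds"
proof -
  obtain L a where La: "finite L" "card L = k - length U" "a ` set Q \<subseteq> L"
    "\<And>l. l \<in> (L :: nat set) \<Longrightarrow> card {u \<in> set Q. a u = l} = s'" "length Q = card L * s'" "reducible z"
    "(\<Sum>l\<in>L. F {u \<in> set Q. a u = l}) \<le> 2 * v" "(\<Sum>l\<in>L. F {u \<in> set Q. a u = l}) \<le> real B"
    "\<And>y r. (y, r) \<in> set R \<Longrightarrow> B < length r \<Longrightarrow> length (removed_part r) = t" "length U < k"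
    by (rule reducible_if_cheap[OF Cs v bspec[OF pos]]) (assumption, rule that, assumption+)
  obtain K where K: "distinct K" "set K \<subseteq> {..<d}" "K \<noteq> []"
    "reduce p z = ((length K, map (selected K) Q, length Q div s'), B)"
    "\<And>x y l. x \<in> fst ` set R \<Longrightarrow> y \<in> fst ` set R \<Longrightarrow> l < d \<Longrightarrow> x ! l \<noteq> y ! l
      \<Longrightarrow> differing K x y \<le> min B d ^ max p 1 \<Longrightarrow> l \<in> set K"
    by (rule kernel_structure[OF La(6)]) (rule that, assumption+)
  show "snd (reduce p z) = B" by (simp add: K(4))
  have "\<exists>Ds\<in>equal_clusterings (length K, map (selected K) Q, length Q div s').
      clustering_cost p (length K, map (selected K) Q, length Q div s') Ds = (\<Sum>l\<in>L. F {u \<in> set Q. a u = l})"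
    by (rule cheap_kernel_clustering[OF K(1,2) _ La(1,3) _ La(5,8)]) (fact K(5), fact La(4), rule bexI)
  then show "\<exists>Ds\<in>equal_clusterings (fst (reduce p z)). clustering_cost p (fst (reduce p z)) Ds \<le> 2 * v
      \<and> clustering_cost p (fst (reduce p z)) Ds \<le> real B"
    unfolding K(4) fst_conv using La(7,8) by auto
  have "length Q div s' = card L" using La(5) s'_t(2) by simp
  then have count: "length U + length Q div s' = k" using La(2,10) by simp
  show "clustering_cost p (d, X, k) (lift (z, w, Ds)) = clustering_cost p (fst (reduce p z)) Ds"
    if "Ds \<in> equal_clusterings (fst (reduce p z))" "clustering_cost p (fst (reduce p z)) Ds \<le> real B"
    using that unfolding K(4) fst_conv
    by (intro lift_cost[OF La(6) K(3) _ La(9) count K(1,2,5)]) assumption+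
qed

text \<open>If the optimum is 0 or at least \<open>(B + 1) / 2\<close>, the left ratio is at most 2
  for any solution, as no value exceeds \<open>B + 1\<close>. Otherwise the kernel optimum is at
  most twice the optimum, and lifting does not increase values.\<close>

lemma approximation:
  assumes Ds: "Ds \<in> equal_clusterings (fst (reduce p z))"
  shows "ratio (clustering_value p (d, X, k) B (lift (z, w, Ds))) (Opt (equal_clustering_problem p) (d, X, k) B)
    \<le> 2 * ratio (clustering_value p (fst (reduce p z)) (snd (reduce p z)) Ds)
        (Opt (equal_clustering_problem p) (fst (reduce p z)) (snd (reduce p z)))"
proof -
  let ?I = "(d, X, k)" and ?I' = "fst (reduce p z)" and ?B' = "snd (reduce p z)"
  let ?o = "Opt (equal_clustering_problem p) ?I B" and ?o' = "Opt (equal_clustering_problem p) ?I' ?B'"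
  let ?v = "clustering_value p ?I B (lift (z, w, Ds))" and ?v' = "clustering_value p ?I' ?B' Ds"
  have r': "1 \<le> ratio ?v' ?o'" by (rule ratio_ge_1[OF reduce_instance Ds])
  have o0: "0 \<le> ?o" by (rule Opt_props(3)[OF instance_ok])
  have vB: "?v \<le> real B + 1" by (rule clustering_value_le)
  show ?thesis
  proof (cases "?o = 0 \<or> real B + 1 \<le> 2 * ?o")
    case True
    have "ratio ?v ?o \<le> 2"
    proof (cases "?o = 0")
      case True
      then show ?thesis by (simp add: ratio_def)
    next
      case False
      then have "?v \<le> 2 * ?o" "0 < ?o" using True vB o0 by auto
      then show ?thesis by (simp add: ratio_def divide_le_eq)
    qed
    then show ?thesis using r' by linarith
  next
    case False
    then have o: "0 < ?o" "2 * ?o < real B + 1" using o0 by auto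
    obtain Cs where Cs: "Cs \<in> clusterings" "?o = clustering_value p ?I B Cs"
      using Opt_props(2)[OF instance_ok] by blast
    have cost: "clustering_cost p ?I Cs = ?o"
      using Cs(2) o by (simp add: clustering_value_def split: if_splits)
    have pos: "\<forall>C\<in>clusterings. 0 < clustering_cost p ?I C"
    proof (rule ballI, rule ccontr)
      fix C assume C: "C \<in> clusterings" "\<not> 0 < clustering_cost p ?I C"
      then have "clustering_value p ?I B C \<le> 0" by (simp add: clustering_value_def)
      then show False using Opt_props(1)[OF instance_ok C(1), of p B] o by linarith
    qed
    note cheap = cheap_case[OF Cs(1) cost[symmetric] o(2) pos]
    have B': "?B' = B" by (rule cheap(1))
    obtain Ds1 where Ds1: "Ds1 \<in> equal_clusterings ?I'" "clustering_cost p ?I' Ds1 \<le> 2 * ?o"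
      "clustering_cost p ?I' Ds1 \<le> real B" using cheap(2) by blast
    have o'2: "?o' \<le> 2 * ?o"
      using Opt_props(1)[OF reduce_instance Ds1(1), of p ?B'] Ds1(2,3) B' by (simp add: clustering_value_def)
    have transfer: "clustering_value p ?I B (lift (z, w, C)) \<le> clustering_value p ?I' ?B' C"
      if "C \<in> equal_clusterings ?I'" for C
    proof (cases "clustering_cost p ?I' C \<le> real B")
      case True
      then show ?thesis using cheap(3)[OF that True, of w] B' by (simp add: clustering_value_def)
    next
      case False
      then show ?thesis using clustering_value_le[of p ?I B] B' by (simp add: clustering_value_def)
    qed
    \<comment> \<open>A kernel optimum 0 would turn the right ratio into 1 by convention; but
      lifting an optimal kernel solution would then give value 0.\<close>
    have "?o' \<noteq> 0"
    proof
      assume o'0: "?o' = 0"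
      obtain C where C: "C \<in> equal_clusterings ?I'" "?o' = clustering_value p ?I' ?B' C"
        using Opt_props(2)[OF reduce_instance] by blast
      have "?o \<le> clustering_value p ?I B (lift (z, w, C))"
        by (rule Opt_props(1)[OF instance_ok lift_sound[OF C(1)]])
      also have "\<dots> \<le> ?o'" using transfer[OF C(1)] C(2) by simp
      finally show False using o'0 o by simp
    qed
    moreover have "0 \<le> ?o'" by (rule Opt_props(3)[OF reduce_instance])
    ultimately have o': "0 < ?o'" by simp
    have v'0: "0 \<le> ?v'" using Opt_props(1)[OF reduce_instance Ds, of p ?B'] o' by linarith
    have "ratio ?v ?o = ?v / ?o" using o by (simp add: ratio_def)
    also have "\<dots> \<le> ?v' / ?o" using transfer[OF Ds] o by (intro divide_right_mono) auto
    also have "\<dots> = 2 * ?v' / (2 * ?o)" by simp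
    also have "\<dots> \<le> 2 * ?v' / ?o'" using o'2 o' v'0 by (intro divide_left_mono) auto
    also have "\<dots> = 2 * ratio ?v' ?o'" using o' by (simp add: ratio_def)
    finally show ?thesis .
  qed
qed

lemma length_Q_le: "length Q \<le> length G * (2 * B + 1)"
proof -
  have "length (concat (map (\<lambda>g. fst (snd g)) gs)) \<le> length gs * (2 * B + 1)" if "set gs \<subseteq> set G" for gs
    using that
  proof (induction gs)
    case (Cons g gs)
    obtain y kp E where g: "g = (y, kp, E)" by (cases g) auto
    then have "(y, kp, E) \<in> set G" using Cons.prems by simp
    then obtain r where "(y, r) \<in> set R" "kp = kept_part r" by (rule G_group)
    then have "length kp \<le> 2 * B + 1" using length_kept_part(1) residue(3) by blast
    then show ?case using Cons g by simp
  qed simp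
  then show ?thesis unfolding Q_eq by blast
qed

text \<open>The summands 1 account for the trivial output, a single point in dimension one, also for
  \<open>B = 0\<close>. The coordinate bound combines \<open>abs_column_map_le\<close> with at most
  \<open>2 * B\<close> different points.\<close>

lemma reduce_bounds:
  assumes "reduce p z = ((d', X', k'), B')"
  shows "length X' \<le> 2 * B * (2 * B + 1) + 1" "d' \<le> 2 * B * (B ^ max p 1 + 1) + 1" "B' \<le> B"
    "k' \<le> 2 * B * (2 * B + 1) + 1" "\<And>x. x \<in> set X' \<Longrightarrow> length x = d'"
    "\<And>x a. x \<in> set X' \<Longrightarrow> a \<in> set x \<Longrightarrow> \<bar>a\<bar> \<le> int ((4 * B + 3) * (2 * B + 1))"
proof -
  have inst: "(d', X', k') \<in> clust_insts" using reduce_instance assms by simp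
  show "length x = d'" if "x \<in> set X'" for x using inst that by (auto simp: clust_insts_def)
  have k': "k' \<le> length X'"
    using inst by (auto simp: clust_insts_def intro: dvd_imp_le)
  have "length X' \<le> 2 * B * (2 * B + 1) + 1 \<and> d' \<le> 2 * B * (B ^ max p 1 + 1) + 1 \<and> B' \<le> B
    \<and> (\<forall>x\<in>set X'. \<forall>a\<in>set x. \<bar>a\<bar> \<le> int ((4 * B + 3) * (2 * B + 1)))"
  proof (cases "reducible z")
    case True
    then obtain K where K: "length K \<le> 2 * B * (B ^ max p 1 + 1)"
      "reduce p z = ((length K, map (selected K) Q, length Q div s'), B)"
      by (rule kernel_structure)
    note Q = Q_nonempty_if_reducible[OF True]
    have "length Q \<le> length G * (2 * B + 1)" by (rule length_Q_le)
    also have "\<dots> \<le> 2 * B * (2 * B + 1)" using Q by (intro mult_right_mono) auto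
    finally have lenQ: "length Q \<le> 2 * B * (2 * B + 1)" .
    have "\<bar>a\<bar> \<le> int ((4 * B + 3) * (2 * B + 1))" if a: "a \<in> set (selected K u)" for u a
    proof -
      obtain l where "a = column_map B (map fst R) l (X ! u ! l)"
        using a by (auto simp: selected_def selected_row_def)
      then have "\<bar>a\<bar> \<le> int ((2 * length (map fst R) + 3) * (2 * B + 1))"
        using abs_column_map_le by blast
      also have "\<dots> \<le> int ((4 * B + 3) * (2 * B + 1))"
        unfolding of_nat_le_iff using Q by (intro mult_right_mono) (auto simp: G_eq)
      finally show ?thesis .
    qed
    then show ?thesis using assms K lenQ by auto
  next
    case False
    then show ?thesis using assms trivial_reduce by auto
  qed
  then show "length X' \<le> 2 * B * (2 * B + 1) + 1" "d' \<le> 2 * B * (B ^ max p 1 + 1) + 1" "B' \<le> B"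
    "k' \<le> 2 * B * (2 * B + 1) + 1" "\<And>x a. x \<in> set X' \<Longrightarrow> a \<in> set x \<Longrightarrow> \<bar>a\<bar> \<le> int ((4 * B + 3) * (2 * B + 1))"
    using k' by auto
qed

end

text \<open>Only finitely many instances obey given bounds, so the sum of their encoding sizes
  bounds the size of a kernel without any estimate of the encoding.\<close>

definition bounded_insts :: "nat \<Rightarrow> nat \<Rightarrow> nat \<Rightarrow> clust_inst set" where
  "bounded_insts N D C = {(d, X, k). d \<le> D \<and> k \<le> N \<and> length X \<le> N
    \<and> (\<forall>x\<in>set X. length x \<le> D \<and> (\<forall>a\<in>set x. \<bar>a\<bar> \<le> int C))}"

lemma finite_bounded_insts: "finite (bounded_insts N D C)"
proof -
  let ?P = "{x. set x \<subseteq> {- int C..int C} \<and> length x \<le> D}"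
  have "finite ?P" by (intro finite_lists_length_le) simp
  then have "finite {X. set X \<subseteq> ?P \<and> length X \<le> N}" by (rule finite_lists_length_le)
  then have "finite ({..D} \<times> {X. set X \<subseteq> ?P \<and> length X \<le> N} \<times> {..N})" by simp
  then show ?thesis
    by (rule rev_finite_subset) (fastforce simp: bounded_insts_def abs_le_iff)
qed

theorem theorem1:
  fixes p :: nat
  shows "\<exists>reduce lift (g :: nat \<Rightarrow> nat)
      (n_bound :: nat \<Rightarrow> real) (d_bound :: nat \<Rightarrow> real) (c_bound :: nat \<Rightarrow> real).
    approx_kernel (equal_clustering_problem p) 2 g reduce lift \<and>
    n_bound \<in> O(\<lambda>B. real B ^ 2) \<and>
    d_bound \<in> O(\<lambda>B. real B ^ (p + 2)) \<and>
    c_bound \<in> O(\<lambda>B. real B ^ 3) \<and>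
    (\<forall>I\<in>clust_insts. \<forall>B d' X' k' B'. reduce (I, B) = ((d', X', k'), B') \<longrightarrow>
      real (length X') \<le> n_bound B \<and>
      real d' \<le> d_bound B \<and>
      (\<forall>x\<in>set X'. \<forall>a\<in>set x. real_of_int \<bar>a\<bar> \<le> c_bound B))"
proof -
  define N where "N = (\<lambda>B :: nat. 2 * B * (2 * B + 1) + 1)"
  define Dm where "Dm = (\<lambda>B :: nat. 2 * B * (B ^ max p 1 + 1) + 1)"
  define C where "C = (\<lambda>B :: nat. (4 * B + 3) * (2 * B + 1))"
  let ?e = "enc_prod enc_nat (enc_prod (enc_list (enc_list enc_int)) enc_nat) :: clust_inst \<Rightarrow> data"
  define g where "g = (\<lambda>B. (\<Sum>I\<in>bounded_insts (N B) (Dm B) (C B). dsize (?e I)) + B)"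
  have bounds: "length X' \<le> N B \<and> d' \<le> Dm B \<and> B' \<le> B \<and> k' \<le> N B
      \<and> (\<forall>x\<in>set X'. length x = d' \<and> (\<forall>a\<in>set x. \<bar>a\<bar> \<le> int (C B)))"
    if "I \<in> clust_insts" "reduce p (I, B) = ((d', X', k'), B')" for I B d' X' k' B'
  proof -
    obtain d X k where I: "I = (d, X, k)" by (cases I) auto
    interpret kernel_input p d X k B by unfold_locales (use that(1) I in simp)
    have "reduce p z = ((d', X', k'), B')" using that(2) I by (simp add: z_def)
    from reduce_bounds[OF this] show ?thesis unfolding N_def Dm_def C_def by blast
  qed
  have kernel: "approx_kernel (equal_clustering_problem p) 2 g (reduce p) lift"
    unfolding approx_kernel_def
  proof (intro conjI ballI allI impI)
    show "polytime_on (insts (equal_clustering_problem p) \<times> UNIV)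
        (enc_param_inst (equal_clustering_problem p)) (enc_param_inst (equal_clustering_problem p)) (reduce p)"
      unfolding sols_simps by (rule polytime_on_subset[OF polytime_reduce]) simp
    show "polytime_on {(x, x', s'). fst x \<in> insts (equal_clustering_problem p) \<and> x' = reduce p x
          \<and> s' \<in> sols (equal_clustering_problem p) (fst x') (snd x')}
        (enc_prod (enc_param_inst (equal_clustering_problem p))
          (enc_prod (enc_param_inst (equal_clustering_problem p)) (enc_sol (equal_clustering_problem p))))
        (enc_sol (equal_clustering_problem p)) lift"
      unfolding sols_simps by (rule polytime_on_subset[OF polytime_lift]) simp
  next
    fix I B I' B' assume I: "I \<in> insts (equal_clustering_problem p)" and red: "reduce p (I, B) = (I', B')"
    obtain d X k where Ieq: "I = (d, X, k)" by (cases I) auto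
    obtain d' X' k' where I': "I' = (d', X', k')" by (cases I') auto
    interpret kernel_input p d X k B by unfold_locales (use I Ieq in simp)
    have zI: "z = (I, B)" by (simp add: z_def Ieq)
    have redz: "reduce p z = (I', B')" using red zI by simp
    show "I' \<in> insts (equal_clustering_problem p)" using reduce_instance redz by simp
    have "I \<in> clust_insts" using I by simp
    from bounds[OF this red[unfolded I']] have "I' \<in> bounded_insts (N B) (Dm B) (C B)" "B' \<le> B"
      by (auto simp: I' bounded_insts_def)
    then show "dsize (enc_inst (equal_clustering_problem p) I') + B' \<le> g B"
      unfolding g_def sols_simps by (intro add_mono member_le_sum finite_bounded_insts) auto
    fix Ds assume "Ds \<in> sols (equal_clustering_problem p) I' B'"
    then have Ds: "Ds \<in> equal_clusterings (fst (reduce p z))" using redz by simp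
    show "lift ((I, B), (I', B'), Ds) \<in> sols (equal_clustering_problem p) I B"
      using lift_sound[OF Ds, of "(I', B')"] zI Ieq by simp
    show "ratio (val (equal_clustering_problem p) I B (lift ((I, B), (I', B'), Ds))) (Opt (equal_clustering_problem p) I B)
        \<le> 2 * ratio (val (equal_clustering_problem p) I' B' Ds) (Opt (equal_clustering_problem p) I' B')"
      using approximation[OF Ds, of "(I', B')"] zI Ieq redz by simp
  qed
  have nO: "(\<lambda>B. real (N B)) \<in> O(\<lambda>B. real B ^ 2)"
  proof (rule bigoI[where c = 7], rule eventually_mono[OF eventually_ge_at_top[of 1]])
    fix B :: nat assume B: "1 \<le> B"
    have "B \<le> B * B" "1 \<le> B * B" using B by simp_all
    moreover have "N B = 4 * (B * B) + 2 * B + 1" by (simp add: N_def algebra_simps)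
    ultimately have "N B \<le> 7 * B ^ 2" unfolding power2_eq_square by linarith
    then have "real (N B) \<le> real (7 * B ^ 2)" by (simp only: of_nat_le_iff)
    then show "norm (real (N B)) \<le> 7 * norm (real B ^ 2)" by simp
  qed
  \<comment> \<open>The exponent \<open>max p 1 + 1\<close> is at most \<open>p + 2\<close>; the
    constant 5 collects the coefficients 2, 2 and 1 of \<open>Dm\<close>.\<close>
  have dO: "(\<lambda>B. real (Dm B)) \<in> O(\<lambda>B. real B ^ (p + 2))"
  proof (rule bigoI[where c = 5], rule eventually_mono[OF eventually_ge_at_top[of 1]])
    fix B :: nat assume B: "1 \<le> B"
    have "B * B ^ max p 1 = B ^ (max p 1 + 1)" by simp
    also have "\<dots> \<le> B ^ (p + 2)" using B by (intro power_increasing) auto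
    finally have "B * B ^ max p 1 \<le> B ^ (p + 2)" .
    moreover have "B \<le> B ^ (p + 2)" using B by (intro self_le_power) auto
    moreover have "1 \<le> B ^ (p + 2)" using B by simp
    moreover have "Dm B = 2 * (B * B ^ max p 1) + 2 * B + 1" by (simp add: Dm_def algebra_simps)
    ultimately have "Dm B \<le> 5 * B ^ (p + 2)" by linarith
    then have "real (Dm B) \<le> real (5 * B ^ (p + 2))" by (simp only: of_nat_le_iff)
    then show "norm (real (Dm B)) \<le> 5 * norm (real B ^ (p + 2))" by simp
  qed
  \<comment> \<open>The coordinates are even quadratic in \<open>B\<close>: for
    \<open>B \<ge> 1\<close> the two factors of \<open>C\<close> are at most \<open>7 * B\<close>
    and \<open>3 * B\<close>.\<close>
  have cO: "(\<lambda>B. real (C B)) \<in> O(\<lambda>B. real B ^ 3)"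
  proof (rule bigoI[where c = 21], rule eventually_mono[OF eventually_ge_at_top[of 1]])
    fix B :: nat assume B: "1 \<le> B"
    have "C B \<le> (7 * B) * (3 * B)" unfolding C_def using B by (intro mult_mono) auto
    also have "\<dots> = 21 * B ^ 2" by (simp add: power2_eq_square)
    also have "\<dots> \<le> 21 * B ^ 3" using B by (intro mult_left_mono power_increasing) auto
    finally have "real (C B) \<le> real (21 * B ^ 3)" by (simp only: of_nat_le_iff)
    then show "norm (real (C B)) \<le> 21 * norm (real B ^ 3)" by simp
  qed
  have "real (length X') \<le> real (N B) \<and> real d' \<le> real (Dm B)
      \<and> (\<forall>x\<in>set X'. \<forall>a\<in>set x. real_of_int \<bar>a\<bar> \<le> real (C B))"
    if "I \<in> clust_insts" "reduce p (I, B) = ((d', X', k'), B')" for I B d' X' k' B'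
  proof -
    have "real_of_int \<bar>a\<bar> \<le> real (C B)" if "\<bar>a\<bar> \<le> int (C B)" for a
      using that by linarith
    then show ?thesis using bounds[OF that] by auto
  qed
  then have sizes: "\<forall>I\<in>clust_insts. \<forall>B d' X' k' B'. reduce p (I, B) = ((d', X', k'), B') \<longrightarrow>
      real (length X') \<le> real (N B) \<and> real d' \<le> real (Dm B) \<and>
      (\<forall>x\<in>set X'. \<forall>a\<in>set x. real_of_int \<bar>a\<bar> \<le> real (C B))"
    by blast
  show ?thesis
    by (rule exI[of _ "reduce p"], rule exI[of _ lift], rule exI[of _ g], rule exI[of _ "\<lambda>B. real (N B)"],
        rule exI[of _ "\<lambda>B. real (Dm B)"], rule exI[of _ "\<lambda>B. real (C B)"], intro conjI kernel nO dO cO sizes)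
qed

end
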